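(* Let $(X,Y)$ be a pair of real-valued random variables, and let $(X_1,Y_1),(X_2,Y_2),\ldots$ be i.i.d. pairs with the same law as $(X,Y)$. Let $\xi_n(X,Y)$ be the coefficient computed from $(X_1,Y_1),\ldots,(X_n,Y_n)$ as defined in the context. If $Y$ is not almost surely a constant, then as $n\to\infty$, $\xi_n(X,Y)$ converges almost surely to the deterministic limit \[ \xi(X,Y) := \frac{\int \mathrm{Var}\big(\mathbb{E}(1_{\{Y\ge t\}}\mid X)\big)\, d\mu(t)}{\int\mathrm{Var}(1_{\{Y\ge t\}})\, d\mu(t)}, \] where $\mu$ is the law of $Y$. This limit belongs to the interval $[0,1]$. It is $0$ if and only if $X$ and $Y$ are independent, and it is $1$ if and only if there is a measurable function $f:\mathbb{R}\to\mathbb{R}$ such that $Y=f(X)$ almost surely.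
   Context: Definition of $\xi_n(X,Y)$ for $n\ge 2$: rearrange the data as $(X_{(1)},Y_{(1)}),\ldots,(X_{(n)},Y_{(n)})$ so that $X_{(1)}\le\cdots\le X_{(n)}$; if there are ties among the $X_i$'s, the increasing rearrangement is chosen uniformly at random among all increasing rearrangements (given the data). Let $r_i$ be the number of $j$ such that $Y_{(j)}\le Y_{(i)}$ and let $l_i$ be the number of $j$ such that $Y_{(j)}\ge Y_{(i)}$. Then \[ \xi_n(X,Y) := 1-\frac{n\sum_{i=1}^{n-1}|r_{i+1}-r_i|}{2\sum_{i=1}^n l_i(n-l_i)}. \] (When the $Y_i$'s have no ties this equals $1-\frac{3\sum_{i=1}^{n-1}|r_{i+1}-r_i|}{n^2-1}$.) The denominator vanishes only when $Y_1=\cdots=Y_n$; in that case $\xi_n$ may be assigned an arbitrary value. *)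

theory Defs
  imports "HOL-Probability.Probability" "HOL-Combinatorics.Permutations"
begin

text \<open>
  A data set of size \<open>n\<close> is given by sequences \<open>x\<close>, \<open>y\<close> of which only the entries with index in
  \<open>{1..n}\<close> matter. A rearrangement is a permutation \<open>\<sigma>\<close> of \<open>{1..n}\<close>; the \<open>i\<close>-th pair after
  rearranging, written \<open>(X\<^sub>(\<^sub>i\<^sub>), Y\<^sub>(\<^sub>i\<^sub>))\<close> on paper, is \<open>(x (\<sigma> i), y (\<sigma> i))\<close>.
\<close>

definition increasing_rearrangements :: "nat \<Rightarrow> (nat \<Rightarrow> real) \<Rightarrow> (nat \<Rightarrow> nat) set" where
  "increasing_rearrangements n x = {\<sigma>. \<sigma> permutes {1..n} \<and> mono_on {1..n} (\<lambda>i. x (\<sigma> i))}"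

definition rank_le :: "nat \<Rightarrow> (nat \<Rightarrow> real) \<Rightarrow> nat \<Rightarrow> nat" where
  "rank_le n y i = card {j \<in> {1..n}. y j \<le> y i}"

definition rank_ge :: "nat \<Rightarrow> (nat \<Rightarrow> real) \<Rightarrow> nat \<Rightarrow> nat" where
  "rank_ge n y i = card {j \<in> {1..n}. y j \<ge> y i}"

text \<open>
  The coefficient depends on the \<open>x\<close>-values only through the rearrangement \<open>\<sigma>\<close>. The argument \<open>c\<close>
  is the value assigned when the denominator vanishes.
\<close>

definition xi_n :: "nat \<Rightarrow> (nat \<Rightarrow> real) \<Rightarrow> (nat \<Rightarrow> nat) \<Rightarrow> real \<Rightarrow> real" where
  "xi_n n y \<sigma> c =
    (let r = (\<lambda>i. real (rank_le n (\<lambda>j. y (\<sigma> j)) i));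
         l = (\<lambda>i. real (rank_ge n (\<lambda>j. y (\<sigma> j)) i));
         d = 2 * (\<Sum>i=1..n. l i * (real n - l i))
     in if d = 0 then c
        else 1 - real n * (\<Sum>i=1..n-1. \<bar>r (i + 1) - r i\<bar>) / d)"

definition data_algebra ::
    "'b measure \<Rightarrow> (nat \<Rightarrow> 'b \<Rightarrow> real) \<Rightarrow> (nat \<Rightarrow> 'b \<Rightarrow> real) \<Rightarrow> nat \<Rightarrow> 'b measure" where
  "data_algebra N Xs Ys n =
    vimage_algebra (space N) (\<lambda>\<omega>. \<lambda>i\<in>{1..n}. (Xs i \<omega>, Ys i \<omega>)) (\<Pi>\<^sub>M i\<in>{1..n}. borel \<Otimes>\<^sub>M borel)"

text \<open>
  Given the first \<open>n\<close> data pairs, the random permutation \<open>\<pi>\<close> is uniformly distributed on the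
  increasing rearrangements of \<open>Xs 1, \<dots>, Xs n\<close>.
\<close>

definition uniform_increasing_rearrangement ::
    "'b measure \<Rightarrow> (nat \<Rightarrow> 'b \<Rightarrow> real) \<Rightarrow> (nat \<Rightarrow> 'b \<Rightarrow> real) \<Rightarrow> nat \<Rightarrow> ('b \<Rightarrow> nat \<Rightarrow> nat) \<Rightarrow> bool" where
  "uniform_increasing_rearrangement N Xs Ys n \<pi> \<longleftrightarrow>
    \<pi> \<in> N \<rightarrow>\<^sub>M count_space {\<sigma>. \<sigma> permutes {1..n}} \<and>
    (\<forall>\<sigma>. \<sigma> permutes {1..n} \<longrightarrow>
      (AE \<omega> in N. real_cond_exp N (data_algebra N Xs Ys n) (indicator {\<omega> \<in> space N. \<pi> \<omega> = \<sigma>}) \<omega>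
        = pmf (pmf_of_set (increasing_rearrangements n (\<lambda>i. Xs i \<omega>))) \<sigma>))"

definition xi_limit :: "'a measure \<Rightarrow> ('a \<Rightarrow> real) \<Rightarrow> ('a \<Rightarrow> real) \<Rightarrow> real" where
  "xi_limit M X Y =
    (\<integral>t. prob_space.variance M
          (real_cond_exp M (vimage_algebra (space M) X borel) (indicator {\<omega> \<in> space M. Y \<omega> \<ge> t}))
      \<partial>distr M borel Y) /
    (\<integral>t. prob_space.variance M (indicator {\<omega> \<in> space M. Y \<omega> \<ge> t}) \<partial>distr M borel Y)"

end

theory Submission imports Defs begin

text \<open>
  Let \<open>\<mu>\<close> be the law of \<open>Y\<close>, \<open>F\<close> its distribution function, \<open>G t = P (Y \<ge> t)\<close>, and let \<open>h t x\<close> be a version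
  of \<open>P (Y \<ge> t | X = x)\<close>. Dividing all ranks by \<open>n\<close> turns the fraction in the coefficient into the quotient of
  the mean of \<open>\<bar>F\<^sub>n (Y\<^sub>(\<^sub>i\<^sub>+\<^sub>1\<^sub>)) - F\<^sub>n (Y\<^sub>(\<^sub>i\<^sub>))\<bar>\<close> by twice the mean of \<open>G\<^sub>n (Y\<^sub>i) * (1 - G\<^sub>n (Y\<^sub>i))\<close>, where \<open>F\<^sub>n\<close> and
  \<open>G\<^sub>n\<close> are empirical versions of \<open>F\<close> and \<open>G\<close>. By the Glivenko-Cantelli theorem (\<open>glivenko_cantelli\<close>) they
  may be replaced by \<open>F\<close> and \<open>G\<close>, and by the strong law the denominator tends to \<open>2 * (\<integral>t. G t * (1 - G t) \<partial>\<mu>)\<close>.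

  For the numerator, \<open>\<bar>F y' - F y\<bar>\<close> is the \<open>\<mu>\<close>-integral over the levels \<open>t\<close> of the difference of the bits
  \<open>b = 1{y \<ge> t}\<close> and \<open>b' = 1{y' \<ge> t}\<close>, and \<open>\<bar>b - b'\<bar> = b + b' - 2 * b * b'\<close>. So for each level the means of
  \<open>b\<^sub>i * b\<^sub>i\<^sub>+\<^sub>1\<close> over neighbours in the rearrangement are needed. They are found in two steps.

  First, given the \<open>X\<close>-values and the rearrangement, the bits are independent with means \<open>h\<^sub>i = h t X\<^sub>(\<^sub>i\<^sub>)\<close>.
  The sum of \<open>b\<^sub>i * b\<^sub>i\<^sub>+\<^sub>1 - h\<^sub>i * h\<^sub>i\<^sub>+\<^sub>1\<close> is therefore a martingale with bounded increments. Its exponential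
  moments are at most \<open>exp (4 * l\<^sup>2 * n)\<close> (\<open>martingale_exp_moment_le\<close>), and the Borel-Cantelli lemma shows that
  it is \<open>o(n)\<close> almost surely, for any joint behaviour of the rearrangements belonging to different \<open>n\<close>.

  Second, \<open>h t\<close> varies little along the sorted \<open>X\<close>-values: the mean of \<open>\<bar>h\<^sub>i\<^sub>+\<^sub>1 - h\<^sub>i\<bar>\<close> tends to 0 almost surely
  (\<open>AE_variation\<close>). The indicator of a half-line changes at most once along a sorted sequence. The sets for which
  the claim holds form a \<open>\<sigma>\<close>-algebra, because the strong law bounds the error made by truncating a countable
  union; step functions are then uniformly close to \<open>h t\<close>. Hence the mean of \<open>h\<^sub>i * h\<^sub>i\<^sub>+\<^sub>1\<close> has the same limit
  \<open>H t = E ((h t X)\<^sup>2)\<close> as the mean of \<open>h\<^sub>i\<^sup>2\<close>. Integrating over \<open>t\<close>, by Fubini's theorem and dominated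
  convergence, the numerator tends to \<open>2 * (\<integral>t. G t - H t \<partial>\<mu>)\<close>, and the coefficient to the quotient of
  \<open>\<integral>t. H t - (G t)\<^sup>2 \<partial>\<mu>\<close> by \<open>\<integral>t. G t * (1 - G t) \<partial>\<mu>\<close>.

  The values of this limit are read off from \<open>(G t)\<^sup>2 \<le> H t \<le> G t\<close>. Equality on the left means that \<open>h t\<close> is
  constant, so that \<open>{Y \<ge> t}\<close> is independent of \<open>X\<close>; equality on the right means that \<open>{Y \<ge> t}\<close> is determined by
  \<open>X\<close>. The limit is 0 or 1 if one of them holds for \<open>\<mu>\<close>-almost every \<open>t\<close>. In the first case every level can be
  approached through good levels with little \<open>\<mu>\<close>-mass in between (\<open>numerator_eq_0_iff_indep\<close>). In the second case
  \<open>Y\<close> is the supremum of the good levels below it, and countably many of these suffice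
  (\<open>numerator_eq_denominator_iff_function\<close>).
\<close>

section \<open>Almost sure convergence from exponential moments\<close>

text \<open>
  Applied to a bounded centred variable, this bounds the exponential moment: the linear term has mean zero.
\<close>

lemma exp_le_self_plus_exp_square:
  fixes x :: real
  shows "exp x \<le> x + exp (x\<^sup>2)"
proof -
  have sq: "1 + x\<^sup>2 \<le> exp (x\<^sup>2)"
    by (rule exp_ge_add_one_self)
  consider "x \<ge> 1" | "0 \<le> x" "x \<le> 1" | "-1 \<le> x" "x \<le> 0" | "x \<le> -1" by linarith
  then show ?thesis
  proof cases
    case 1
    then have "x \<le> x\<^sup>2" by (simp add: power2_eq_square)
    then have "exp x \<le> exp (x\<^sup>2)" by simp
    then show ?thesis using 1 by linarith
  next
    case 2
    then show ?thesis using exp_bound[of x] sq by linarith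
  next
    case 3
    define y where "y = - x"
    have y: "0 \<le> y" "y \<le> 1" using 3 by (auto simp: y_def)
    have "1 + y + y\<^sup>2 / 2 \<le> exp y" using exp_lower_Taylor_quadratic[OF y(1)] .
    moreover have "1 \<le> (1 - y + y\<^sup>2) * (1 + y + y\<^sup>2 / 2)"
    proof -
      have "(1 - y + y\<^sup>2) * (1 + y + y\<^sup>2 / 2) = 1 + y^2/2 + y^3/2 + y^4/2"
        by (simp add: field_simps power2_eq_square power3_eq_cube power4_eq_xxxx)
      then show ?thesis using y by simp
    qed
    moreover have "1 - y + y\<^sup>2 \<ge> 0" using y by (simp add: add_nonneg_nonneg)
    ultimately have "1 \<le> (1 - y + y\<^sup>2) * exp y"
      by (meson mult_left_mono order_trans)
    then have "exp (- y) \<le> 1 - y + y\<^sup>2"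
      by (simp add: exp_minus field_simps)
    then have "exp x \<le> 1 + x + x\<^sup>2" by (simp add: y_def)
    then show ?thesis using sq by linarith
  next
    case 4
    then have "0 \<le> x + x\<^sup>2"
using mult_nonpos_nonpos[of x "1 + x"] by (simp add: algebra_simps power2_eq_square)
    moreover have "exp x \<le> 1" using 4 by simp
    ultimately show ?thesis using sq by linarith
  qed
qed

text \<open>
  Markov's inequality for the exponential moment gives a deviation probability that is geometric in \<open>n\<close>, so
  Borel-Cantelli applies to the whole sequence with no assumption on how the \<open>T n\<close> are coupled.
\<close>

lemma (in prob_space) AE_averages_tendsto_0_if_subgaussian:
  fixes T :: "nat \<Rightarrow> 'a \<Rightarrow> real"
  assumes meas: "\<And>n. n \<ge> m \<Longrightarrow> T n \<in> borel_measurable M"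
    and "K > 0"
    and mgf: "\<And>n l. n \<ge> m \<Longrightarrow> (\<integral>\<^sup>+\<omega>. ennreal (exp (l * T n \<omega>)) \<partial>M) \<le> ennreal (exp (K * l\<^sup>2 * n))"
  shows "AE \<omega> in M. (\<lambda>n. T n \<omega> / n) \<longlonglongrightarrow> 0"
proof -
  have ev: "AE \<omega> in M. \<forall>\<^sub>F n in sequentially. \<bar>T n \<omega>\<bar> < d * n" if "d > 0" for d :: real
  proof -
    \<comment> \<open>The minimizer of \<open>K * l\<^sup>2 - l * d\<close>.\<close>
    define l where "l = d / (2 * K)"
    define A where "A n = (if n \<ge> m then {\<omega> \<in> space M. \<bar>T n \<omega>\<bar> \<ge> d * n} else {})" for n
    have A_sets: "A n \<in> sets M" for n
    proof (cases "n \<ge> m")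
      case True
      note [measurable] = meas[OF True]
      show ?thesis using True by (simp add: A_def)
    qed (simp add: A_def)
    have bnd: "measure M (A n) \<le> 2 * exp (- (d\<^sup>2 / (4 * K))) ^ n" for n
    proof (cases "n \<ge> m")
      case True
      note [measurable] = meas[OF True]
      have "l > 0" using that \<open>K > 0\<close> by (simp add: l_def)
      have "emeasure M (A n) = (\<integral>\<^sup>+\<omega>. indicator (A n) \<omega> \<partial>M)"
        using A_sets by simp
      also have "\<dots> \<le> (\<integral>\<^sup>+\<omega>. ennreal (exp (- l * d * n)) *
            (ennreal (exp (l * T n \<omega>)) + ennreal (exp (- l * T n \<omega>))) \<partial>M)"
      proof (intro nn_integral_mono)
        fix \<omega> assume "\<omega> \<in> space M"
        have *: "1 \<le> exp (- l * d * n) * (exp (l * T n \<omega>) + exp (- l * T n \<omega>))" if "\<omega> \<in> A n"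
        proof -
          from that have "d * n \<le> \<bar>T n \<omega>\<bar>" by (auto simp: A_def split: if_splits)
          then have "l * (d * n) \<le> l * \<bar>T n \<omega>\<bar>" using \<open>l > 0\<close> by simp
          then have "exp (l * d * n) \<le> exp (l * \<bar>T n \<omega>\<bar>)" by (simp add: mult.assoc)
          also have "\<dots> \<le> exp (l * T n \<omega>) + exp (- l * T n \<omega>)"
            by (cases "T n \<omega> \<ge> 0") (auto intro: add_increasing add_increasing2)
          finally show ?thesis by (simp add: exp_minus field_simps)
        qed
        show "(indicator (A n) \<omega> :: ennreal) \<le> ennreal (exp (- l * d * n)) *
            (ennreal (exp (l * T n \<omega>)) + ennreal (exp (- l * T n \<omega>)))"
          using * by (auto simp: indicator_def simp flip: ennreal_plus ennreal_1 ennreal_mult' intro!: ennreal_leI)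
      qed
      also have "\<dots> = ennreal (exp (- l * d * n)) *
          ((\<integral>\<^sup>+\<omega>. ennreal (exp (l * T n \<omega>)) \<partial>M) + (\<integral>\<^sup>+\<omega>. ennreal (exp (- l * T n \<omega>)) \<partial>M))"
        by (subst nn_integral_cmult, simp) (subst nn_integral_add, auto)
      also have "\<dots> \<le> ennreal (exp (- l * d * n)) * (ennreal (exp (K * l\<^sup>2 * n)) + ennreal (exp (K * l\<^sup>2 * n)))"
        using mgf[OF True, of l] mgf[OF True, of "- l"] by (intro mult_left_mono add_mono) auto
      also have "\<dots> = ennreal (2 * exp (- (d\<^sup>2 / (4 * K))) ^ n)"
      proof -
        have "- l * d * n + K * l\<^sup>2 * n = real n * (- (d\<^sup>2 / (4 * K)))"
          using \<open>K > 0\<close> by (simp add: l_def field_simps power2_eq_square)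
        then have "exp (- l * d * n) * exp (K * l\<^sup>2 * n) = exp (- (d\<^sup>2 / (4 * K))) ^ n"
          by (metis exp_add exp_of_nat_mult)
        then show ?thesis by (simp flip: ennreal_plus ennreal_mult')
      qed
      finally show ?thesis by (simp add: emeasure_eq_measure)
    qed (simp add: A_def)
    have "summable (\<lambda>n. measure M (A n))"
    proof (rule summable_comparison_test')
      show "summable (\<lambda>n. 2 * exp (- (d\<^sup>2 / (4 * K))) ^ n)"
        using that \<open>K > 0\<close> by (intro summable_mult summable_geometric) simp
      show "\<And>n. n \<ge> 0 \<Longrightarrow> norm (measure M (A n)) \<le> 2 * exp (- (d\<^sup>2 / (4 * K))) ^ n"
        using bnd by simp
    qed
    then have "AE \<omega> in M. \<forall>\<^sub>F n in sequentially. \<omega> \<in> space M - A n"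
      by (intro borel_cantelli_AE1 A_sets) (simp_all add: emeasure_eq_measure)
    then show ?thesis
    proof eventually_elim
      case (elim \<omega>)
      show ?case
        using elim eventually_ge_at_top[of m]
        by eventually_elim (auto simp: A_def split: if_splits)
    qed
  qed
  have "AE \<omega> in M. \<forall>k::nat. \<forall>\<^sub>F n in sequentially. \<bar>T n \<omega>\<bar> < inverse (Suc k) * n"
    unfolding AE_all_countable by (intro allI ev) simp
  then show ?thesis
  proof eventually_elim
    case (elim \<omega>)
    show ?case
    proof (rule tendstoI)
      fix e :: real assume "e > 0"
      then obtain k where k: "inverse (real (Suc k)) < e" using reals_Archimedean by blast
      show "\<forall>\<^sub>F n in sequentially. dist (T n \<omega> / n) 0 < e"
        using spec[OF elim, of k] eventually_gt_at_top[of 0]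
      proof eventually_elim
        case (elim n)
        then have "\<bar>T n \<omega>\<bar> / n < inverse (real (Suc k))"
          by (simp add: field_simps)
        then show ?case using k by simp
      qed
    qed
  qed
qed

section \<open>Independent identically distributed sequences\<close>

locale iid_sequence = prob_space N for N :: "'b measure" +
  fixes S :: "'c measure" and P :: "'c measure" and Z :: "nat \<Rightarrow> 'b \<Rightarrow> 'c"
  assumes indep: "indep_vars (\<lambda>_. S) Z {1..}"
    and law: "\<And>i. i \<ge> 1 \<Longrightarrow> distr N S (Z i) = P"
begin

lemma measurable_Z: "i \<ge> 1 \<Longrightarrow> Z i \<in> N \<rightarrow>\<^sub>M S"
  using indep by (auto simp: indep_vars_def)

lemma sets_P: "sets P = sets S"
  using law[of 1] by (metis order_refl sets_distr)

lemma space_P: "space P = space S"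
  using sets_P by (rule sets_eq_imp_space_eq)

lemma measurable_P: "measurable P = measurable S"
  using sets_P by (intro ext measurable_cong_sets) auto

lemma prob_space_P: "prob_space P"
  using prob_space_distr[OF measurable_Z[of 1]] law[of 1] by simp

lemma iid_sequence_compose:
  assumes f: "f \<in> S \<rightarrow>\<^sub>M R"
  shows "iid_sequence N R (distr P R f) (\<lambda>i \<omega>. f (Z i \<omega>))"
proof
  show "indep_vars (\<lambda>_. R) (\<lambda>i \<omega>. f (Z i \<omega>)) {1..}"
    by (rule indep_vars_compose2[OF indep]) (use f in auto)
  show "distr N R (\<lambda>\<omega>. f (Z i \<omega>)) = distr P R f" if "i \<ge> 1" for i
    using that by (subst law[OF that, symmetric], subst distr_distr) (auto simp: f measurable_Z comp_def)
qed

text \<open>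
  For bounded functions the exponential moments of the centred sums factorize into factors that are at most
  \<open>exp (l\<^sup>2 * (2 * C)\<^sup>2)\<close>.
\<close>

lemma strong_law_bounded:
  fixes f :: "'c \<Rightarrow> real"
  assumes f [measurable]: "f \<in> borel_measurable S" and bnd: "\<And>z. z \<in> space S \<Longrightarrow> \<bar>f z\<bar> \<le> C"
  shows "AE \<omega> in N. (\<lambda>n. (\<Sum>i=1..n. f (Z i \<omega>)) / n) \<longlonglongrightarrow> (\<integral>z. f z \<partial>P)"
proof -
  interpret P: prob_space P by (rule prob_space_P)
  define m where "m = (\<integral>z. f z \<partial>P)"
  have fP [measurable]: "f \<in> borel_measurable P" by (simp add: measurable_P)
  have int: "integrable P f"
    by (rule P.integrable_const_bound[where B = C]) (auto simp: bnd space_P intro!: AE_I2)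
  have "\<bar>m\<bar> \<le> C"
  proof -
    have "\<bar>m\<bar> \<le> (\<integral>z. \<bar>f z\<bar> \<partial>P)" unfolding m_def by (rule integral_abs_bound)
    also have "\<dots> \<le> (\<integral>z. C \<partial>P)" by (rule integral_mono) (use int bnd in \<open>auto simp: space_P\<close>)
    finally show ?thesis by (simp add: P.prob_space)
  qed
  have C: "\<bar>f z - m\<bar> \<le> 2 * C" if "z \<in> space S" for z
    using bnd[OF that] \<open>\<bar>m\<bar> \<le> C\<close> by linarith
  have single: "(\<integral>\<^sup>+z. ennreal (exp (l * (f z - m))) \<partial>P) \<le> ennreal (exp (l\<^sup>2 * (2 * C)\<^sup>2))" for l
  proof -
    have pw: "exp (l * (f z - m)) \<le> l * (f z - m) + exp (l\<^sup>2 * (2 * C)\<^sup>2)" if "z \<in> space S" for z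
    proof -
      have "(l * (f z - m))\<^sup>2 \<le> l\<^sup>2 * (2 * C)\<^sup>2"
        using power_mono[OF C[OF that], of 2] by (simp add: power_mult_distrib mult_left_mono)
      then have "exp ((l * (f z - m))\<^sup>2) \<le> exp (l\<^sup>2 * (2 * C)\<^sup>2)" by simp
      then show ?thesis using exp_le_self_plus_exp_square[of "l * (f z - m)"] by linarith
    qed
    have intr: "integrable P (\<lambda>z. l * (f z - m) + exp (l\<^sup>2 * (2 * C)\<^sup>2))"
      using int by auto
    have "(\<integral>\<^sup>+z. ennreal (exp (l * (f z - m))) \<partial>P) \<le> (\<integral>\<^sup>+z. ennreal (l * (f z - m) + exp (l\<^sup>2 * (2 * C)\<^sup>2)) \<partial>P)"
      by (intro nn_integral_mono ennreal_leI pw) (simp add: space_P)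
    also have "\<dots> = ennreal (\<integral>z. l * (f z - m) + exp (l\<^sup>2 * (2 * C)\<^sup>2) \<partial>P)"
    proof (rule nn_integral_eq_integral[OF intr], rule AE_I2)
      fix z assume "z \<in> space P"
      then show "0 \<le> l * (f z - m) + exp (l\<^sup>2 * (2 * C)\<^sup>2)"
        using order_trans[OF exp_ge_zero pw] by (simp add: space_P)
    qed
    also have "(\<integral>z. l * (f z - m) + exp (l\<^sup>2 * (2 * C)\<^sup>2) \<partial>P) = exp (l\<^sup>2 * (2 * C)\<^sup>2)"
      using int by (simp add: m_def P.prob_space)
    finally show ?thesis .
  qed
  define T where "T n \<omega> = (\<Sum>i=1..n. f (Z i \<omega>) - m)" for n \<omega>
  have "AE \<omega> in N. (\<lambda>n. T n \<omega> / n) \<longlonglongrightarrow> 0"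
  proof (rule AE_averages_tendsto_0_if_subgaussian[where m = 1 and K = "(2 * C)\<^sup>2 + 1"])
    fix n :: nat and l :: real assume "n \<ge> 1"
    note measurable_Z[measurable]
    show "T n \<in> borel_measurable N" unfolding T_def by measurable
    have "(\<integral>\<^sup>+\<omega>. ennreal (exp (l * T n \<omega>)) \<partial>N) = (\<integral>\<^sup>+\<omega>. (\<Prod>i=1..n. ennreal (exp (l * (f (Z i \<omega>) - m)))) \<partial>N)"
      by (simp add: T_def sum_distrib_left exp_sum prod_ennreal)
    also have "\<dots> = (\<Prod>i=1..n. \<integral>\<^sup>+\<omega>. ennreal (exp (l * (f (Z i \<omega>) - m))) \<partial>N)"
      by (rule indep_vars_nn_integral, simp, rule indep_vars_compose2[OF indep_vars_subset[OF indep]]) auto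
    also have "\<dots> = (\<Prod>i=1..n. \<integral>\<^sup>+z. ennreal (exp (l * (f z - m))) \<partial>P)"
    proof (rule prod.cong[OF refl])
      fix i assume "i \<in> {1..n}"
      then have i: "i \<ge> 1" by simp
      note [measurable] = measurable_Z[OF i]
      show "(\<integral>\<^sup>+\<omega>. ennreal (exp (l * (f (Z i \<omega>) - m))) \<partial>N) = (\<integral>\<^sup>+z. ennreal (exp (l * (f z - m))) \<partial>P)"
        by (subst law[OF i, symmetric], subst nn_integral_distr) auto
    qed
    also have "\<dots> \<le> (\<Prod>i=1..n. ennreal (exp (l\<^sup>2 * (2 * C)\<^sup>2)))"
      by (intro prod_mono_ennreal single)
    also have "\<dots> = ennreal (exp (n * (l\<^sup>2 * (2 * C)\<^sup>2)))"
      by (simp add: ennreal_power exp_of_nat_mult)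
    also have "\<dots> \<le> ennreal (exp (((2 * C)\<^sup>2 + 1) * l\<^sup>2 * n))"
      by (intro ennreal_leI) (simp add: algebra_simps)
    finally show "(\<integral>\<^sup>+\<omega>. ennreal (exp (l * T n \<omega>)) \<partial>N) \<le> ennreal (exp (((2 * C)\<^sup>2 + 1) * l\<^sup>2 * n))" .
  qed (simp add: add_nonneg_pos)
  then show ?thesis
  proof eventually_elim
    case (elim \<omega>)
    have "(\<lambda>n. T n \<omega> / n + m) \<longlonglongrightarrow> 0 + m" by (intro tendsto_intros elim)
    moreover have "\<forall>\<^sub>F n in sequentially. T n \<omega> / n + m = (\<Sum>i=1..n. f (Z i \<omega>)) / n"
      using eventually_gt_at_top[of 0]
      by eventually_elim (simp add: T_def sum_subtractf field_simps)
    ultimately show ?case by (simp add: m_def filterlim_cong[OF refl refl])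
  qed
qed

end

section \<open>The Glivenko-Cantelli theorem\<close>

text \<open>
  A \<open>q\<close>-quantile \<open>s\<close>, characterized through the distribution function. The second part bounds the mass strictly
  below \<open>s\<close>: an atom at \<open>s\<close> may carry the distribution function far beyond \<open>q\<close>.
\<close>

lemma (in cdf_distribution) ex_quantile:
  assumes "0 < q" "q < 1"
  shows "\<exists>s. (\<forall>x. q \<le> cdf M x \<longleftrightarrow> s \<le> x) \<and> measure M {..<s} \<le> q"
proof -
  define s where "s = I q"
  have inv: "q \<le> cdf M x \<longleftrightarrow> s \<le> x" for x
    unfolding s_def by (rule pseudoinverse[OF assms])
  have "measure M {..<s} \<le> q"
  proof (rule tendsto_upperbound[OF cdf_at_left])
    show "\<forall>\<^sub>F x in at_left s. cdf M x \<le> q"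
      unfolding eventually_at_filter
    proof (intro always_eventually allI impI)
      fix x assume "x \<in> {..<s}"
      then have "\<not> q \<le> cdf M x" unfolding inv by simp
      then show "cdf M x \<le> q" by linarith
    qed
  qed simp
  with inv show ?thesis by blast
qed

text \<open>
  The strong law holds simultaneously at the countably many rational quantiles, for the closed and for the open
  half-lines ending there. Between consecutive quantiles of a grid of mesh \<open>1 / k\<close>, monotonicity squeezes the
  empirical distribution function up to an error \<open>1 / k\<close>.
\<close>

lemma glivenko_cantelli:
  assumes "iid_sequence N borel \<mu> Y"
  shows "AE \<omega> in N. uniform_limit UNIV (\<lambda>n t. card {j\<in>{1..n}. Y j \<omega> \<le> t} / n) (cdf \<mu>) sequentially"
proof -
  interpret iid_sequence N borel \<mu> Y by fact
  interpret \<mu>: prob_space \<mu> by (rule prob_space_P)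
  interpret \<mu>: cdf_distribution \<mu> by standard (rule sets_P)
  let ?Q = "\<rat> \<inter> {0<..<1::real}"
  have "\<forall>q\<in>{0<..<1}. \<exists>s. (\<forall>x. q \<le> cdf \<mu> x \<longleftrightarrow> s \<le> x) \<and> measure \<mu> {..<s} \<le> q"
    using \<mu>.ex_quantile by simp
  then obtain quant where quant: "\<And>q x. 0 < q \<Longrightarrow> q < 1 \<Longrightarrow> q \<le> cdf \<mu> x \<longleftrightarrow> quant q \<le> x"
    "\<And>q. 0 < q \<Longrightarrow> q < 1 \<Longrightarrow> measure \<mu> {..<quant q} \<le> q"
    by (metis greaterThanLessThan_iff)
  define a where "a \<omega> n t = card {j\<in>{1..n}. Y j \<omega> \<le> t} / real n" for \<omega> n t
  define b where "b \<omega> n t = card {j\<in>{1..n}. Y j \<omega> < t} / real n" for \<omega> n t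
  have freq: "AE \<omega> in N. (\<lambda>n. card {j\<in>{1..n}. Y j \<omega> \<in> A} / real n) \<longlonglongrightarrow> measure \<mu> A"
    if A: "A \<in> sets borel" for A
  proof -
    have "AE \<omega> in N. (\<lambda>n. (\<Sum>i=1..n. indicat_real A (Y i \<omega>)) / n) \<longlonglongrightarrow> (\<integral>y. indicat_real A y \<partial>\<mu>)"
      by (rule strong_law_bounded[where C = 1]) (use A in \<open>auto simp: indicator_def\<close>)
    moreover have "(\<Sum>i=1..n. indicat_real A (Y i \<omega>)) = card {j\<in>{1..n}. Y j \<omega> \<in> A}" for n \<omega>
      by (simp add: indicator_def sum.If_cases Int_def)
    ultimately show ?thesis using A by simp
  qed
  have "countable ?Q" using countable_rat by blast
  have "AE \<omega> in N. \<forall>q\<in>?Q. (\<lambda>n. a \<omega> n (quant q)) \<longlonglongrightarrow> cdf \<mu> (quant q) \<and>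
      (\<lambda>n. b \<omega> n (quant q)) \<longlonglongrightarrow> measure \<mu> {..<quant q}"
    unfolding AE_ball_countable[OF \<open>countable ?Q\<close>]
  proof (intro ballI)
    fix q
    show "AE \<omega> in N. (\<lambda>n. a \<omega> n (quant q)) \<longlonglongrightarrow> cdf \<mu> (quant q) \<and>
      (\<lambda>n. b \<omega> n (quant q)) \<longlonglongrightarrow> measure \<mu> {..<quant q}"
      using freq[of "{..quant q}"] freq[of "{..<quant q}"]
      unfolding a_def b_def cdf_def by (auto elim!: eventually_elim2)
  qed
  then show ?thesis
  proof eventually_elim
    case (elim \<omega>)
    have mono: "a \<omega> n s \<le> a \<omega> n t" if "s \<le> t" for n s t
      using that by (auto simp: a_def intro!: divide_right_mono card_mono)
    have ab: "a \<omega> n t \<le> b \<omega> n s" if "t < s" for n s t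
      using that by (auto simp: a_def b_def intro!: divide_right_mono card_mono)
    have bounds: "0 \<le> a \<omega> n t" "a \<omega> n t \<le> 1" for n t
    proof -
      have "card {j \<in> {1..n}. Y j \<omega> \<le> t} \<le> card {1..n}" by (rule card_mono) auto
      then show "a \<omega> n t \<le> 1" by (simp add: a_def divide_le_eq)
    qed (simp add: a_def)
    have "uniform_limit UNIV (a \<omega>) (cdf \<mu>) sequentially"
    proof (rule uniform_limitI)
      fix e :: real assume "e > 0"
      then obtain k :: nat where k: "1 / (e / 2) < k" using reals_Archimedean2 by blast
      have "k > 0" using k \<open>e > 0\<close> by (cases k) (auto simp: field_simps)
      then have k: "1 / k < e / 2" using k \<open>e > 0\<close> by (simp add: field_simps)
      define J where "J = {1..<k}"
      have JQ: "j / k \<in> ?Q" if "j \<in> J" for j using that by (auto simp: J_def)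
      have "\<forall>\<^sub>F n in sequentially. \<forall>j\<in>J. a \<omega> n (quant (j/k)) > cdf \<mu> (quant (j/k)) - e/2 \<and>
         b \<omega> n (quant (j/k)) < measure \<mu> {..<quant (j/k)} + e/2"
      proof (intro eventually_ball_finite ballI)
        fix j assume "j \<in> J"
        with elim JQ have "(\<lambda>n. a \<omega> n (quant (j/k))) \<longlonglongrightarrow> cdf \<mu> (quant (j/k))"
          "(\<lambda>n. b \<omega> n (quant (j/k))) \<longlonglongrightarrow> measure \<mu> {..<quant (j/k)}" by blast+
        from order_tendstoD(1)[OF this(1), of "cdf \<mu> (quant (j/k)) - e/2"]
          order_tendstoD(2)[OF this(2), of "measure \<mu> {..<quant (j/k)} + e/2"] \<open>e > 0\<close>
        show "\<forall>\<^sub>F n in sequentially. a \<omega> n (quant (j/k)) > cdf \<mu> (quant (j/k)) - e/2 \<and>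
         b \<omega> n (quant (j/k)) < measure \<mu> {..<quant (j/k)} + e/2"
          by (auto intro: eventually_conj)
      qed (simp add: J_def)
      then show "\<forall>\<^sub>F n in sequentially. \<forall>t\<in>UNIV. dist (a \<omega> n t) (cdf \<mu> t) < e"
      proof eventually_elim
        case (elim n)
        show ?case
        proof
          fix t
          define j where "j = nat \<lfloor>k * cdf \<mu> t\<rfloor>"
          have F01: "0 \<le> cdf \<mu> t" "cdf \<mu> t \<le> 1" by (auto simp: \<mu>.cdf_nonneg \<mu>.cdf_bounded_prob)
          have j: "real j \<le> k * cdf \<mu> t" "k * cdf \<mu> t < j + 1"
            using F01(1) by (auto simp: j_def intro: of_nat_floor) linarith
          then have jk: "j / k \<le> cdf \<mu> t" "cdf \<mu> t < (j + 1) / k"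
            using \<open>k > 0\<close> by (auto simp: field_simps)
          have lower: "cdf \<mu> t - 1 / k - e / 2 < a \<omega> n t"
          proof -
            \<comment> \<open>There is no \<open>1\<close>-quantile, so a level with \<open>cdf \<mu> t = 1\<close> uses the last grid point.\<close>
            define i where "i = (if j < k then j else k - 1)"
            have i: "real i / k \<ge> cdf \<mu> t - 1 / k" "real i / k \<le> cdf \<mu> t" "i < k"
            proof -
              show "i < k" using \<open>k > 0\<close> by (simp add: i_def)
              have "cdf \<mu> t \<le> (real i + 1) / k"
                using jk(2) F01(2) \<open>k > 0\<close> by (simp add: i_def of_nat_diff add.commute)
              then show "real i / k \<ge> cdf \<mu> t - 1 / k" by (simp add: add_divide_distrib)
              have "real i / k \<le> j / k" by (intro divide_right_mono) (auto simp: i_def)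
              then show "real i / k \<le> cdf \<mu> t" using jk(1) by linarith
            qed
            show ?thesis
            proof (cases "i = 0")
              case True
              then show ?thesis using i(1) bounds(1)[of n t] \<open>e > 0\<close> by simp
            next
              case False
              then have "i \<in> J" using i(3) by (auto simp: J_def)
              then have "0 < real i / k" "real i / k < 1" using JQ by auto
              note q = quant(1)[OF this] quant(2)[OF this]
              have "quant (i/k) \<le> t" using q(1) i(2) by blast
              then have "a \<omega> n (quant (i/k)) \<le> a \<omega> n t" by (rule mono)
              moreover have "a \<omega> n (quant (i/k)) > cdf \<mu> (quant (i/k)) - e/2"
                using elim \<open>i \<in> J\<close> by blast
              moreover have "i / k \<le> cdf \<mu> (quant (i / k))" using q(1) by blast
              ultimately show ?thesis using i(1) by linarith
            qed
          qed
          have upper: "a \<omega> n t < cdf \<mu> t + 1 / k + e / 2"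
          proof (cases "j + 1 < k")
            case True
            then have "j + 1 \<in> J" by (auto simp: J_def)
            then have "0 < real (j + 1) / k" "real (j + 1) / k < 1" using JQ[of "j + 1"] by simp_all
            note q = quant(1)[OF this] quant(2)[OF this]
            have "t < quant (real (j + 1) / k)"
              using q(1)[of t] jk(2) by (simp add: not_le[symmetric] add.commute)
            then have "a \<omega> n t \<le> b \<omega> n (quant (real (j + 1) / k))" by (rule ab)
            moreover have "b \<omega> n (quant (real (j + 1) / k)) < measure \<mu> {..<quant (real (j + 1) / k)} + e / 2"
              using elim \<open>j + 1 \<in> J\<close> by blast
            moreover have "real (j + 1) / k \<le> cdf \<mu> t + 1 / k"
              using jk(1) by (simp add: add_divide_distrib)
            ultimately show ?thesis using q(2) by linarith
          next
            case False
            then have "1 \<le> real (j + 1) / k" using \<open>k > 0\<close> by (simp add: field_simps)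
            then have "1 \<le> cdf \<mu> t + 1 / k" using jk(1) by (simp add: add_divide_distrib)
            then show ?thesis using bounds(2)[of n t] \<open>e > 0\<close> by linarith
          qed
          show "dist (a \<omega> n t) (cdf \<mu> t) < e"
            using lower upper k by (simp add: dist_real_def abs_less_iff)
        qed
      qed
    qed
    then show ?case by (simp add: a_def[abs_def])
  qed
qed

text \<open>The previous theorem for the reflected sequence \<open>- Y\<close>.\<close>

lemma glivenko_cantelli_upper:
  fixes Y :: "nat \<Rightarrow> 'b \<Rightarrow> real"
  assumes "iid_sequence N borel \<mu> Y"
  shows "AE \<omega> in N. uniform_limit UNIV (\<lambda>n t. card {j\<in>{1..n}. Y j \<omega> \<ge> t} / n) (\<lambda>t. measure \<mu> {t..}) sequentially"
proof -
  interpret iid_sequence N borel \<mu> Y by fact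
  interpret neg: iid_sequence N borel "distr \<mu> borel uminus" "\<lambda>i \<omega>. - Y i \<omega>"
    by (rule iid_sequence_compose) simp
  have G: "cdf (distr \<mu> borel uminus) (- t) = measure \<mu> {t..}" for t
  proof -
    have "uminus \<in> measurable \<mu> borel" by (simp add: measurable_P)
    moreover have "uminus -` {..-t} \<inter> space \<mu> = {t..}" by (auto simp: space_P)
    ultimately show ?thesis by (simp add: cdf_def measure_distr)
  qed
  have "AE \<omega> in N. uniform_limit UNIV (\<lambda>n t. card {j\<in>{1..n}. - Y j \<omega> \<le> t} / n) (cdf (distr \<mu> borel uminus)) sequentially"
    by (rule glivenko_cantelli[OF neg.iid_sequence_axioms])
  then show ?thesis
  proof eventually_elim
    case (elim \<omega>)
    from uniform_limit_compose'[OF this, of uminus UNIV] show ?case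
      by (simp add: G)
  qed
qed

section \<open>Exponential moments of indicators given the first coordinates\<close>
lemma centered_bernoulli_exp_moment_le:
  fixes h u :: real
  assumes "0 \<le> h" "h \<le> 1"
  shows "h * exp (u * (1 - h)) + (1 - h) * exp (- (u * h)) \<le> exp (u\<^sup>2)"
proof -
  have *: "exp (u * t) \<le> u * t + exp (u\<^sup>2)" if "\<bar>t\<bar> \<le> 1" for t
  proof -
    have "(u * t)\<^sup>2 \<le> u\<^sup>2"
      using that by (simp add: power_mult_distrib abs_square_le_1 mult_left_le)
    then show ?thesis using exp_le_self_plus_exp_square[of "u * t"]
      by (meson add_left_mono exp_le_cancel_iff order_trans)
  qed
  have "h * exp (u * (1 - h)) \<le> h * (u * (1 - h) + exp (u\<^sup>2))"
    using *[of "1 - h"] assms by (intro mult_left_mono) auto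
  moreover have "(1 - h) * exp (- (u * h)) \<le> (1 - h) * (- (u * h) + exp (u\<^sup>2))"
    using *[of "- h"] assms by (intro mult_left_mono) auto
  ultimately show ?thesis by (simp add: algebra_simps)
qed

text \<open>
  The function \<open>h\<close> is a version of the conditional probability of the event \<open>A\<close> given the first coordinate,
  normalized to take its values in the unit interval everywhere.
\<close>

locale conditional_probability = prob_space P for P :: "(real \<times> real) measure" +
  fixes A :: "(real \<times> real) set" and h :: "real \<Rightarrow> real"
  assumes sets_P [measurable_cong]: "sets P = sets (borel \<Otimes>\<^sub>M borel)"
    and A_sets [measurable]: "A \<in> sets (borel \<Otimes>\<^sub>M borel)"
    and h_measurable [measurable]: "h \<in> borel_measurable borel"
    and h_nonneg: "0 \<le> h x" and h_le_1: "h x \<le> 1"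
    and prob_Int: "C \<in> sets borel \<Longrightarrow> prob (A \<inter> fst -` C) = (\<integral>z. indicator C (fst z) * h (fst z) \<partial>P)"
begin

lemma space_P [simp]: "space P = UNIV"
  using sets_eq_imp_space_eq[OF sets_P] by (simp add: space_pair_measure)

lemma integrable_h: "integrable P (\<lambda>z. h (fst z))"
  by (rule integrable_const_bound[where B = 1]) (auto simp: h_nonneg h_le_1)

lemma conditional_probability_complement: "conditional_probability P (- A) (\<lambda>x. 1 - h x)"
proof
  show "sets P = sets (borel \<Otimes>\<^sub>M borel)" by (rule sets_P)
  show "- A \<in> sets (borel \<Otimes>\<^sub>M borel)" using sets.compl_sets[OF A_sets] by (simp add: space_pair_measure Compl_eq_Diff_UNIV)
  fix C :: "real set" assume C [measurable]: "C \<in> sets borel"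
  have int: "integrable P (\<lambda>z. indicat_real C (fst z) * h (fst z))"
    by (rule integrable_const_bound[where B = 1]) (auto simp: h_nonneg h_le_1 indicator_def)
  have int': "integrable P (\<lambda>z. indicat_real C (fst z))"
    by (rule integrable_const_bound[where B = 1]) (auto simp: indicator_def)
  have vC: "fst -` C \<in> sets P"
    using measurable_sets[OF measurable_fst C, of borel] by (simp add: sets_P space_pair_measure)
  have indicat_fst: "indicat_real (fst -` C) z = indicator C (fst z)" for z :: "real \<times> real"
    by (simp add: indicator_def)
  have "prob (- A \<inter> fst -` C) = prob (fst -` C) - prob (A \<inter> fst -` C)"
    using finite_measure_Diff'[OF vC, of A] A_sets sets_P by (simp add: Int_commute Diff_eq)
  also have "prob (fst -` C) = (\<integral>z. indicat_real (fst -` C) z \<partial>P)" using vC by simp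
  also have "\<dots> - prob (A \<inter> fst -` C) = (\<integral>z. indicator C (fst z) * (1 - h (fst z)) \<partial>P)"
    using int int' by (simp add: prob_Int[OF C] right_diff_distrib indicat_fst)
  finally show "prob (- A \<inter> fst -` C) = (\<integral>z. indicator C (fst z) * (1 - h (fst z)) \<partial>P)" .
qed (auto simp: h_nonneg h_le_1)

text \<open>
  The defining identity for sets says that two measures on the line agree, so it extends to integrands.
\<close>

lemma nn_integral_mult_indicator:
  assumes q [measurable]: "q \<in> borel_measurable borel"
  shows "(\<integral>\<^sup>+z. q (fst z) * indicator A z \<partial>P) = (\<integral>\<^sup>+z. q (fst z) * ennreal (h (fst z)) \<partial>P)"
proof -
  have "distr (density P (indicator A)) borel fst = distr (density P (\<lambda>z. ennreal (h (fst z)))) borel fst"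
  proof (rule measure_eqI)
    fix C :: "real set" assume "C \<in> sets (distr (density P (indicator A)) borel fst)"
    then have C [measurable]: "C \<in> sets borel" by simp
    have vC [measurable]: "fst -` C \<in> sets P"
      using measurable_sets[OF measurable_fst C, of borel] by (simp add: sets_P space_pair_measure)
    have int: "integrable P (\<lambda>z. indicat_real C (fst z) * h (fst z))"
      by (rule integrable_const_bound[where B = 1]) (auto simp: h_nonneg h_le_1 indicator_def)
    have "emeasure (distr (density P (indicator A)) borel fst) C = emeasure P (A \<inter> fst -` C)"
      by (simp add: emeasure_distr emeasure_density nn_integral_indicator flip: indicator_inter_arith)
    also have "\<dots> = (\<integral>\<^sup>+z. ennreal (indicator C (fst z) * h (fst z)) \<partial>P)"
      by (subst nn_integral_eq_integral[OF int]) (auto simp: h_nonneg emeasure_eq_measure prob_Int)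
    also have "\<dots> = emeasure (distr (density P (\<lambda>z. ennreal (h (fst z)))) borel fst) C"
      by (simp add: emeasure_distr emeasure_density ennreal_mult' h_nonneg ennreal_indicator[symmetric] mult.commute)
         (auto intro!: nn_integral_cong simp: indicator_def)
    finally show "emeasure (distr (density P (indicator A)) borel fst) C =
      emeasure (distr (density P (\<lambda>z. ennreal (h (fst z)))) borel fst) C" .
  qed simp
  then have "(\<integral>\<^sup>+x. q x \<partial>distr (density P (indicator A)) borel fst) =
      (\<integral>\<^sup>+x. q x \<partial>distr (density P (\<lambda>z. ennreal (h (fst z)))) borel fst)" by simp
  then show ?thesis
    by (simp add: nn_integral_distr nn_integral_density mult.commute)
qed

text \<open>
  A single martingale increment. Given the first coordinate, the indicator of \<open>A\<close> is a Bernoulli variable with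
  mean \<open>h\<close>, and the weight \<open>q\<close> and the factor \<open>a\<close> are constants.
\<close>

lemma conditional_exp_moment_le:
  fixes q :: "real \<Rightarrow> ennreal" and a :: "real \<Rightarrow> real"
  assumes [measurable]: "q \<in> borel_measurable borel" "a \<in> borel_measurable borel"
    and a: "\<And>x. \<bar>a x\<bar> \<le> c"
  shows "(\<integral>\<^sup>+z. q (fst z) * ennreal (exp ((indicator A z - h (fst z)) * a (fst z))) \<partial>P)
    \<le> ennreal (exp (c\<^sup>2)) * (\<integral>\<^sup>+z. q (fst z) \<partial>P)"
proof -
  interpret compl: conditional_probability P "- A" "\<lambda>x. 1 - h x"
    by (rule conditional_probability_complement)
  let ?u = "\<lambda>x. ennreal (exp (a x * (1 - h x)))" and ?v = "\<lambda>x. ennreal (exp (- (a x * h x)))"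
  have "(\<integral>\<^sup>+z. q (fst z) * ennreal (exp ((indicator A z - h (fst z)) * a (fst z))) \<partial>P)
    = (\<integral>\<^sup>+z. (q (fst z) * ?u (fst z)) * indicator A z + (q (fst z) * ?v (fst z)) * indicator (- A) z \<partial>P)"
    by (intro nn_integral_cong) (auto simp: indicator_def mult.commute)
  also have "\<dots> = (\<integral>\<^sup>+z. (q (fst z) * ?u (fst z)) * indicator A z \<partial>P)
      + (\<integral>\<^sup>+z. (q (fst z) * ?v (fst z)) * indicator (- A) z \<partial>P)"
    using compl.A_sets by (intro nn_integral_add) auto
  also have "\<dots> = (\<integral>\<^sup>+z. (q (fst z) * ?u (fst z)) * ennreal (h (fst z)) \<partial>P)
      + (\<integral>\<^sup>+z. (q (fst z) * ?v (fst z)) * ennreal (1 - h (fst z)) \<partial>P)"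
    using nn_integral_mult_indicator[of "\<lambda>x. q x * ?u x"] compl.nn_integral_mult_indicator[of "\<lambda>x. q x * ?v x"]
    by simp
  also have "\<dots> = (\<integral>\<^sup>+z. (q (fst z) * ?u (fst z)) * ennreal (h (fst z)) + (q (fst z) * ?v (fst z)) * ennreal (1 - h (fst z)) \<partial>P)"
    by (intro nn_integral_add[symmetric]) auto
  also have "\<dots> \<le> (\<integral>\<^sup>+z. q (fst z) * ennreal (exp (c\<^sup>2)) \<partial>P)"
  proof (rule nn_integral_mono)
    fix z :: "real \<times> real"
    obtain x where x: "fst z = x" by blast
    have "(a x)\<^sup>2 \<le> c\<^sup>2" using power_mono[OF a[of x], of 2] by simp
    then have "h x * exp (a x * (1 - h x)) + (1 - h x) * exp (- (a x * h x)) \<le> exp (c\<^sup>2)"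
      using centered_bernoulli_exp_moment_le[OF h_nonneg h_le_1, of x "a x"]
      by (meson exp_le_cancel_iff order_trans)
    then have "?u x * ennreal (h x) + ?v x * ennreal (1 - h x) \<le> ennreal (exp (c\<^sup>2))"
      using h_nonneg[of x] h_le_1[of x]
      by (simp add: mult.commute flip: ennreal_mult' ennreal_plus)
    from mult_left_mono[OF this, of "q x"]
    show "(q (fst z) * ?u (fst z)) * ennreal (h (fst z)) + (q (fst z) * ?v (fst z)) * ennreal (1 - h (fst z))
      \<le> q (fst z) * ennreal (exp (c\<^sup>2))"
      by (simp add: x algebra_simps)
  qed
  also have "\<dots> = ennreal (exp (c\<^sup>2)) * (\<integral>\<^sup>+z. q (fst z) \<partial>P)"
    by (simp add: nn_integral_multc mult.commute)
  finally show ?thesis .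
qed

text \<open>
  The same estimate for one coordinate \<open>k\<close> of an independent sample: \<open>U\<close> and \<open>a\<close> may depend on everything except
  the second component of that coordinate, so Fubini's theorem reduces the claim to the one-coordinate bound. That
  a function ignores this component is expressed by resetting it to 0.
\<close>

lemma product_exp_moment_le:
  fixes U :: "('i \<Rightarrow> real \<times> real) \<Rightarrow> ennreal" and a :: "('i \<Rightarrow> real \<times> real) \<Rightarrow> real"
  assumes I: "finite I" "k \<in> I"
    and [measurable]: "U \<in> borel_measurable (\<Pi>\<^sub>M i\<in>I. borel \<Otimes>\<^sub>M borel)"
      "a \<in> borel_measurable (\<Pi>\<^sub>M i\<in>I. borel \<Otimes>\<^sub>M borel)"
    and U: "\<And>z x y. U (z(k := (x, y))) = U (z(k := (x, 0)))"
    and a: "\<And>z x y. a (z(k := (x, y))) = a (z(k := (x, 0)))"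
    and bound: "\<And>z. \<bar>a z\<bar> \<le> c"
  shows "(\<integral>\<^sup>+z. U z * ennreal (exp ((indicator A (z k) - h (fst (z k))) * a z)) \<partial>(\<Pi>\<^sub>M i\<in>I. P))
    \<le> ennreal (exp (c\<^sup>2)) * (\<integral>\<^sup>+z. U z \<partial>(\<Pi>\<^sub>M i\<in>I. P))"
proof -
  interpret product_sigma_finite "\<lambda>_. P" by standard
  define J where "J = I - {k}"
  have J: "finite J" "k \<notin> J" "I = insert k J" using I by (auto simp: J_def)
  have sets_PiM: "sets (\<Pi>\<^sub>M i\<in>I. P) = sets (\<Pi>\<^sub>M i\<in>I. borel \<Otimes>\<^sub>M borel)"
    by (intro sets_PiM_cong refl sets_P)
  have [measurable]: "(\<lambda>z. z k) \<in> (\<Pi>\<^sub>M i\<in>I. borel \<Otimes>\<^sub>M borel) \<rightarrow>\<^sub>M borel \<Otimes>\<^sub>M borel"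
    using I by simp
  have m1: "(\<lambda>z. U z * ennreal (exp ((indicator A (z k) - h (fst (z k))) * a z))) \<in> borel_measurable (\<Pi>\<^sub>M i\<in>insert k J. P)"
    unfolding J(3)[symmetric] measurable_cong_sets[OF sets_PiM refl] by measurable
  have m2: "U \<in> borel_measurable (\<Pi>\<^sub>M i\<in>insert k J. P)"
    unfolding J(3)[symmetric] measurable_cong_sets[OF sets_PiM refl] by measurable
  have "(\<integral>\<^sup>+z. U z * ennreal (exp ((indicator A (z k) - h (fst (z k))) * a z)) \<partial>(\<Pi>\<^sub>M i\<in>I. P))
    = (\<integral>\<^sup>+z. \<integral>\<^sup>+y. U (z(k := y)) * ennreal (exp ((indicator A y - h (fst y)) * a (z(k := y)))) \<partial>P \<partial>(\<Pi>\<^sub>M i\<in>J. P))"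
    unfolding J(3) by (subst product_nn_integral_insert[OF J(1,2) m1]) simp
  also have "\<dots> \<le> (\<integral>\<^sup>+z. ennreal (exp (c\<^sup>2)) * (\<integral>\<^sup>+y. U (z(k := y)) \<partial>P) \<partial>(\<Pi>\<^sub>M i\<in>J. P))"
  proof (rule nn_integral_mono)
    fix z assume z: "z \<in> space (\<Pi>\<^sub>M i\<in>J. P)"
    have "(\<lambda>y. z(k := y)) \<in> P \<rightarrow>\<^sub>M (\<Pi>\<^sub>M i\<in>insert k J. P)"
      by (rule measurable_component_update[OF z J(2)])
    then have upd: "(\<lambda>y. z(k := y)) \<in> borel \<Otimes>\<^sub>M borel \<rightarrow>\<^sub>M (\<Pi>\<^sub>M i\<in>I. borel \<Otimes>\<^sub>M borel)"
      by (simp only: J(3)[symmetric] measurable_cong_sets[OF sets_P sets_PiM])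
    have upd' [measurable]: "(\<lambda>x. z(k := (x, 0))) \<in> borel \<rightarrow>\<^sub>M (\<Pi>\<^sub>M i\<in>I. borel \<Otimes>\<^sub>M borel)"
      by (rule measurable_compose[OF _ upd]) measurable
    define q where "q x = U (z(k := (x, 0)))" for x
    define b where "b x = a (z(k := (x, 0)))" for x
    have q: "U (z(k := y)) = q (fst y)" and b: "a (z(k := y)) = b (fst y)" for y
      using U[of z "fst y" "snd y"] a[of z "fst y" "snd y"] by (simp_all add: q_def b_def)
    have [measurable]: "q \<in> borel_measurable borel" "b \<in> borel_measurable borel"
      unfolding q_def b_def by measurable
    show "(\<integral>\<^sup>+y. U (z(k := y)) * ennreal (exp ((indicator A y - h (fst y)) * a (z(k := y)))) \<partial>P)
      \<le> ennreal (exp (c\<^sup>2)) * (\<integral>\<^sup>+y. U (z(k := y)) \<partial>P)"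
      unfolding q b by (rule conditional_exp_moment_le) (auto simp: b_def bound)
  qed
  also have "\<dots> = ennreal (exp (c\<^sup>2)) * (\<integral>\<^sup>+z. \<integral>\<^sup>+y. U (z(k := y)) \<partial>P \<partial>(\<Pi>\<^sub>M i\<in>J. P))"
  proof (rule nn_integral_cmult)
    have "(\<lambda>(z, y). U (z(k := y))) \<in> borel_measurable ((\<Pi>\<^sub>M i\<in>J. P) \<Otimes>\<^sub>M P)"
      using measurable_compose[OF measurable_add_dim m2] by (simp add: split_beta')
    then show "(\<lambda>z. \<integral>\<^sup>+y. U (z(k := y)) \<partial>P) \<in> borel_measurable (\<Pi>\<^sub>M i\<in>J. P)"
      by (rule borel_measurable_nn_integral)
  qed
  also have "(\<integral>\<^sup>+z. \<integral>\<^sup>+y. U (z(k := y)) \<partial>P \<partial>(\<Pi>\<^sub>M i\<in>J. P)) = (\<integral>\<^sup>+z. U z \<partial>(\<Pi>\<^sub>M i\<in>I. P))"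
    unfolding J(3) by (subst product_nn_integral_insert[OF J(1,2) m2]) simp
  finally show ?thesis .
qed

text \<open>
  The coordinates are visited in the order \<open>\<sigma> 1, \<sigma> 2, \<dots>\<close>. The increment \<open>W z j\<close> is the centred indicator at
  \<open>\<sigma> j\<close> times a factor in the interval from 0 to 2 that involves only first components and the indicator at
  \<open>\<sigma> (j - 1)\<close>. The weight \<open>p\<close> involves only first components; it will be the conditional probability of the
  rearrangement \<open>\<sigma>\<close>. Removing the increments one by one, the last one first, costs a factor \<open>exp (4 * l\<^sup>2)\<close> each.
\<close>

lemma martingale_exp_moment_le:
  fixes p :: "(nat \<Rightarrow> real \<times> real) \<Rightarrow> ennreal" and \<sigma> :: "nat \<Rightarrow> nat" and l :: real and n :: nat
  defines "W \<equiv> \<lambda>z j. (indicator A (z (\<sigma> j)) - h (fst (z (\<sigma> j)))) *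
      ((if 2 \<le> j then indicator A (z (\<sigma> (j - 1))) else 0) + (if j < n then h (fst (z (\<sigma> (j + 1)))) else 0))"
  assumes \<sigma>: "\<sigma> permutes {1..n}"
    and p_meas [measurable]: "p \<in> borel_measurable (\<Pi>\<^sub>M i\<in>{1..n}. borel \<Otimes>\<^sub>M borel)"
    and p: "\<And>k z x y. p (z(k := (x, y))) = p (z(k := (x, 0)))"
    and "m \<le> n"
  shows "(\<integral>\<^sup>+z. p z * ennreal (exp (l * (\<Sum>j=1..m. W z j))) \<partial>(\<Pi>\<^sub>M i\<in>{1..n}. P))
    \<le> ennreal (exp (4 * l\<^sup>2 * m)) * (\<integral>\<^sup>+z. p z \<partial>(\<Pi>\<^sub>M i\<in>{1..n}. P))"
  using \<open>m \<le> n\<close>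
proof (induction m)
  case 0
  then show ?case by simp
next
  case (Suc m)
  define k where "k = \<sigma> (Suc m)"
  have inj: "\<sigma> i = \<sigma> j \<longleftrightarrow> i = j" for i j
    using permutes_inj[OF \<sigma>] by (auto dest: injD)
  have k: "k \<in> {1..n}" using Suc.prems permutes_in_image[OF \<sigma>, of "Suc m"] by (simp add: k_def)
  have comp: "(\<lambda>z. z (\<sigma> j)) \<in> (\<Pi>\<^sub>M i\<in>{1..n}. borel \<Otimes>\<^sub>M borel) \<rightarrow>\<^sub>M borel \<Otimes>\<^sub>M borel" if "j \<in> {1..n}" for j
    using that permutes_in_image[OF \<sigma>, of j] by (intro measurable_component_singleton) simp
  define U where "U z = p z * ennreal (exp (l * (\<Sum>j=1..m. W z j)))" for z
  define a where "a z = l * ((if 2 \<le> Suc m then indicator A (z (\<sigma> m)) else 0) +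
      (if Suc m < n then h (fst (z (\<sigma> (m + 2)))) else 0))" for z
  have step: "U z * ennreal (exp ((indicator A (z k) - h (fst (z k))) * a z)) =
     p z * ennreal (exp (l * (\<Sum>j=1..Suc m. W z j)))" for z
    by (simp add: U_def a_def W_def k_def distrib_left exp_add ennreal_mult' mult_ac)
  have W_meas: "(\<lambda>z. W z j) \<in> borel_measurable (\<Pi>\<^sub>M i\<in>{1..n}. borel \<Otimes>\<^sub>M borel)" if "j \<in> {1..n}" for j
  proof -
    have "(\<lambda>z. if 2 \<le> j then indicat_real A (z (\<sigma> (j - 1))) else 0) \<in> borel_measurable (\<Pi>\<^sub>M i\<in>{1..n}. borel \<Otimes>\<^sub>M borel)"
    proof (cases "2 \<le> j")
      case True
      then have [measurable]: "(\<lambda>z. z (\<sigma> (j - 1))) \<in> (\<Pi>\<^sub>M i\<in>{1..n}. borel \<Otimes>\<^sub>M borel) \<rightarrow>\<^sub>M borel \<Otimes>\<^sub>M borel"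
        using that by (intro comp) auto
      show ?thesis unfolding if_P[OF True] by measurable
    qed simp
    moreover have "(\<lambda>z. if j < n then h (fst (z (\<sigma> (j + 1)))) else 0) \<in> borel_measurable (\<Pi>\<^sub>M i\<in>{1..n}. borel \<Otimes>\<^sub>M borel)"
    proof (cases "j < n")
      case True
      then have [measurable]: "(\<lambda>z. z (\<sigma> (j + 1))) \<in> (\<Pi>\<^sub>M i\<in>{1..n}. borel \<Otimes>\<^sub>M borel) \<rightarrow>\<^sub>M borel \<Otimes>\<^sub>M borel"
        using that by (intro comp) auto
      show ?thesis unfolding if_P[OF True] by measurable
    qed simp
    moreover note [measurable] = comp[OF that]
    ultimately show ?thesis unfolding W_def by measurable
  qed
  have "(\<integral>\<^sup>+z. p z * ennreal (exp (l * (\<Sum>j=1..Suc m. W z j))) \<partial>(\<Pi>\<^sub>M i\<in>{1..n}. P)) =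
     (\<integral>\<^sup>+z. U z * ennreal (exp ((indicator A (z k) - h (fst (z k))) * a z)) \<partial>(\<Pi>\<^sub>M i\<in>{1..n}. P))"
    unfolding step ..
  also have "\<dots> \<le> ennreal (exp ((2 * \<bar>l\<bar>)\<^sup>2)) * (\<integral>\<^sup>+z. U z \<partial>(\<Pi>\<^sub>M i\<in>{1..n}. P))"
  proof (rule product_exp_moment_le)
    have [measurable]: "(\<lambda>z. W z j) \<in> borel_measurable (\<Pi>\<^sub>M i\<in>{1..n}. borel \<Otimes>\<^sub>M borel)" if "j \<in> {1..m}" for j
      using that Suc.prems by (intro W_meas) auto
    show "U \<in> borel_measurable (\<Pi>\<^sub>M i\<in>{1..n}. borel \<Otimes>\<^sub>M borel)"
      unfolding U_def by measurable
    have "(\<lambda>z. if 2 \<le> Suc m then indicat_real A (z (\<sigma> m)) else 0) \<in> borel_measurable (\<Pi>\<^sub>M i\<in>{1..n}. borel \<Otimes>\<^sub>M borel)"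
    proof (cases "2 \<le> Suc m")
      case True
      then have [measurable]: "(\<lambda>z. z (\<sigma> m)) \<in> (\<Pi>\<^sub>M i\<in>{1..n}. borel \<Otimes>\<^sub>M borel) \<rightarrow>\<^sub>M borel \<Otimes>\<^sub>M borel"
        using Suc.prems by (intro comp) auto
      show ?thesis unfolding if_P[OF True] by measurable
    qed simp
    moreover have "(\<lambda>z. if Suc m < n then h (fst (z (\<sigma> (m + 2)))) else 0) \<in> borel_measurable (\<Pi>\<^sub>M i\<in>{1..n}. borel \<Otimes>\<^sub>M borel)"
    proof (cases "Suc m < n")
      case True
      then have [measurable]: "(\<lambda>z. z (\<sigma> (m + 2))) \<in> (\<Pi>\<^sub>M i\<in>{1..n}. borel \<Otimes>\<^sub>M borel) \<rightarrow>\<^sub>M borel \<Otimes>\<^sub>M borel"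
        by (intro comp) auto
      show ?thesis unfolding if_P[OF True] by measurable
    qed simp
    ultimately show "a \<in> borel_measurable (\<Pi>\<^sub>M i\<in>{1..n}. borel \<Otimes>\<^sub>M borel)"
      unfolding a_def by measurable
    fix z :: "nat \<Rightarrow> real \<times> real" and x y :: real
    have "W (z(k := (x, y))) j = W (z(k := (x, 0))) j" if "j \<in> {1..m}" for j
    proof -
      have "j \<noteq> Suc m" "j - 1 \<noteq> Suc m" using that by auto
      then show ?thesis by (simp add: W_def k_def inj)
    qed
    then show "U (z(k := (x, y))) = U (z(k := (x, 0)))"
      using p[of z k x y] by (simp only: U_def cong: sum.cong)
    show "a (z(k := (x, y))) = a (z(k := (x, 0)))"
      by (simp add: a_def k_def inj)
    show "\<bar>a z\<bar> \<le> 2 * \<bar>l\<bar>"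
      using h_nonneg[of "fst (z (\<sigma> (m + 2)))"] h_le_1[of "fst (z (\<sigma> (m + 2)))"]
      by (auto simp: a_def abs_mult indicator_def mult.commute intro!: mult_left_mono)
  qed (use k in auto)
  also have "\<dots> \<le> ennreal (exp ((2 * \<bar>l\<bar>)\<^sup>2)) * (ennreal (exp (4 * l\<^sup>2 * m)) * (\<integral>\<^sup>+z. p z \<partial>(\<Pi>\<^sub>M i\<in>{1..n}. P)))"
    unfolding U_def using Suc.IH Suc.prems by (intro mult_left_mono) auto
  also have "\<dots> = ennreal (exp (4 * l\<^sup>2 * Suc m)) * (\<integral>\<^sup>+z. p z \<partial>(\<Pi>\<^sub>M i\<in>{1..n}. P))"
    by (simp add: mult.assoc[symmetric] flip: ennreal_mult' exp_add) (simp add: power_mult_distrib distrib_left add.commute)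
  finally show ?case .
qed

end

text \<open>
  Summation of \<open>b\<^sub>i * b\<^sub>i\<^sub>+\<^sub>1 - h\<^sub>i * h\<^sub>i\<^sub>+\<^sub>1 = b\<^sub>i * (b\<^sub>i\<^sub>+\<^sub>1 - h\<^sub>i\<^sub>+\<^sub>1) + h\<^sub>i\<^sub>+\<^sub>1 * (b\<^sub>i - h\<^sub>i)\<close>, collected by centred
  factors. This exhibits the sum as the martingale of the preceding estimate.
\<close>

lemma sum_centered_consecutive_products:
  fixes b h :: "nat \<Rightarrow> real"
  shows "(\<Sum>j=1..n. (b j - h j) * ((if 2 \<le> j then b (j - 1) else 0) + (if j < n then h (j + 1) else 0)))
    = (\<Sum>i=1..<n. b i * b (i + 1)) - (\<Sum>i=1..<n. h i * h (i + 1))"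
proof -
  have "(\<Sum>j=1..n. (b j - h j) * (if 2 \<le> j then b (j - 1) else 0)) = (\<Sum>j=2..n. (b j - h j) * b (j - 1))"
    by (rule sum.mono_neutral_cong_right) auto
  also have "\<dots> = (\<Sum>i=1..<n. (b (i + 1) - h (i + 1)) * b i)"
    by (rule sum.reindex_bij_witness[of _ "\<lambda>i. i + 1" "\<lambda>j. j - 1"]) auto
  finally have 1: "(\<Sum>j=1..n. (b j - h j) * (if 2 \<le> j then b (j - 1) else 0))
      = (\<Sum>i=1..<n. (b (i + 1) - h (i + 1)) * b i)" .
  have 2: "(\<Sum>j=1..n. (b j - h j) * (if j < n then h (j + 1) else 0)) = (\<Sum>i=1..<n. (b i - h i) * h (i + 1))"
    by (rule sum.mono_neutral_cong_right) auto
  show ?thesis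
    unfolding distrib_left sum.distrib 1 2
    by (simp add: sum_subtractf[symmetric] sum.distrib[symmetric] algebra_simps)
qed

section \<open>Uniformly random increasing rearrangements\<close>

(* Keeps the index sets {1..n} syntactically intact. *)
declare One_nat_def [simp del]

lemma finite_increasing_rearrangements: "finite (increasing_rearrangements n x)"
  unfolding increasing_rearrangements_def
  by (rule finite_subset[OF _ finite_permutations[of "{1..n}"]]) auto

lemma increasing_rearrangements_nonempty: "increasing_rearrangements n x \<noteq> {}"
proof -
  define zs where "zs = sort_key x [1..<Suc n]"
  have len: "length zs = n" by (simp add: zs_def)
  have "bij_betw ((!) zs) {..<n} {1..n}"
    by (rule bij_betw_nth) (auto simp: zs_def)
  moreover have "bij_betw (\<lambda>i. i - 1) {1..n} {..<n}"
    by (rule bij_betw_byWitness[where f' = Suc]) auto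
  ultimately have bij: "bij_betw (\<lambda>i. zs ! (i - 1)) {1..n} {1..n}"
    using bij_betw_trans by (fastforce simp: comp_def)
  define \<sigma> where "\<sigma> i = (if i \<in> {1..n} then zs ! (i - 1) else i)" for i
  have "\<sigma> permutes {1..n}"
  proof (rule bij_imp_permutes)
    show "bij_betw \<sigma> {1..n} {1..n}"
      using bij by (rule bij_betw_cong[THEN iffD1, rotated]) (auto simp: \<sigma>_def)
  qed (auto simp: \<sigma>_def)
  moreover have "mono_on {1..n} (\<lambda>i. x (\<sigma> i))"
  proof (rule mono_onI)
    fix i j assume ij: "i \<in> {1..n}" "j \<in> {1..n}" "i \<le> j"
    have "sorted (map x zs)" by (simp add: zs_def)
    from sorted_nth_mono[OF this, of "i - 1" "j - 1"] ij
    show "x (\<sigma> i) \<le> x (\<sigma> j)" by (auto simp: \<sigma>_def len)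
  qed
  ultimately show ?thesis by (auto simp: increasing_rearrangements_def)
qed

lemma increasing_rearrangements_cong:
  assumes "\<And>i. i \<in> {1..n} \<Longrightarrow> x i = x' i"
  shows "increasing_rearrangements n x = increasing_rearrangements n x'"
proof -
  have "x (\<sigma> i) = x' (\<sigma> i)" if "\<sigma> permutes {1..n}" "i \<in> {1..n}" for \<sigma> i
    using assms that permutes_in_image[of \<sigma> "{1..n}" i] by simp
  then show ?thesis
    unfolding increasing_rearrangements_def by (auto simp: monotone_on_def)
qed

text \<open>
  The conditional probability of the rearrangement \<open>\<sigma>\<close> given the data \<open>z\<close>.
\<close>

definition rearrangement_weight :: "nat \<Rightarrow> (nat \<Rightarrow> nat) \<Rightarrow> (nat \<Rightarrow> real \<times> real) \<Rightarrow> real" where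
  "rearrangement_weight n \<sigma> z = pmf (pmf_of_set (increasing_rearrangements n (\<lambda>i. fst (z i)))) \<sigma>"

lemma rearrangement_weight_nonneg: "0 \<le> rearrangement_weight n \<sigma> z"
  by (simp add: rearrangement_weight_def)

lemma sum_rearrangement_weight: "(\<Sum>\<sigma> | \<sigma> permutes {1..n}. rearrangement_weight n \<sigma> z) = 1"
  unfolding rearrangement_weight_def
  by (rule sum_pmf_eq_1)
     (auto simp: finite_permutations set_pmf_of_set finite_increasing_rearrangements
        increasing_rearrangements_nonempty, auto simp: increasing_rearrangements_def)

lemma rearrangement_weight_eq_0:
  "\<sigma> \<notin> increasing_rearrangements n (\<lambda>i. fst (z i)) \<Longrightarrow> rearrangement_weight n \<sigma> z = 0"
  unfolding rearrangement_weight_def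
  by (subst pmf_of_set) (auto simp: finite_increasing_rearrangements increasing_rearrangements_nonempty)

lemma measurable_mem_increasing_rearrangements:
  assumes "\<sigma> permutes {1..n}"
  shows "Measurable.pred (\<Pi>\<^sub>M i\<in>{1..n}. borel \<Otimes>\<^sub>M borel)
    (\<lambda>z. \<sigma> \<in> increasing_rearrangements n (\<lambda>i. fst (z i :: real \<times> real)))"
proof -
  have fst_meas: "(\<lambda>z. fst (z (\<sigma> j) :: real \<times> real)) \<in> (\<Pi>\<^sub>M i\<in>{1..n}. borel \<Otimes>\<^sub>M borel) \<rightarrow>\<^sub>M (borel :: real measure)"
    if "j \<in> {1..n}" for j
  proof -
    have "(\<lambda>z. z (\<sigma> j)) \<in> (\<Pi>\<^sub>M i\<in>{1..n}. borel \<Otimes>\<^sub>M borel) \<rightarrow>\<^sub>M borel \<Otimes>\<^sub>M (borel :: real measure)"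
      using that permutes_in_image[OF assms, of j] by (intro measurable_component_singleton) simp
    from measurable_compose[OF this measurable_fst] show ?thesis .
  qed
  have "(\<lambda>z. \<sigma> \<in> increasing_rearrangements n (\<lambda>i. fst (z i :: real \<times> real))) =
      (\<lambda>z. \<forall>i\<in>{1..n}. \<forall>j\<in>{1..n}. i \<le> j \<longrightarrow> fst (z (\<sigma> i)) \<le> fst (z (\<sigma> j)))"
    using assms by (auto simp: increasing_rearrangements_def monotone_on_def fun_eq_iff)
  moreover have "Measurable.pred (\<Pi>\<^sub>M i\<in>{1..n}. borel \<Otimes>\<^sub>M borel)
      (\<lambda>z. \<forall>i\<in>{1..n}. \<forall>j\<in>{1..n}. i \<le> j \<longrightarrow> fst (z (\<sigma> i) :: real \<times> real) \<le> fst (z (\<sigma> j)))"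
  proof (intro pred_intros_finite(3) pred_intros_imp' finite_atLeastAtMost)
    fix i j assume "i \<in> {1..n}" "j \<in> {1..n}"
    then show "Measurable.pred (\<Pi>\<^sub>M i\<in>{1..n}. borel \<Otimes>\<^sub>M borel)
      (\<lambda>z. fst (z (\<sigma> i) :: real \<times> real) \<le> fst (z (\<sigma> j)))"
      unfolding pred_def by (intro borel_measurable_le fst_meas)
  qed
  ultimately show ?thesis by (simp only:)
qed

lemma borel_measurable_rearrangement_weight:
  assumes "\<sigma> permutes {1..n}"
  shows "rearrangement_weight n \<sigma> \<in> borel_measurable (\<Pi>\<^sub>M i\<in>{1..n}. borel \<Otimes>\<^sub>M borel)"
proof -
  have card: "real (card (increasing_rearrangements n x)) =
      (\<Sum>\<tau> | \<tau> permutes {1..n}. if \<tau> \<in> increasing_rearrangements n x then 1 else 0)" for x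
    by (subst sum.If_cases) (auto simp: finite_permutations increasing_rearrangements_def Collect_conj_eq intro!: arg_cong[where f = card])
  have "rearrangement_weight n \<sigma> = (\<lambda>z. (if \<sigma> \<in> increasing_rearrangements n (\<lambda>i. fst (z i)) then 1 else 0) /
      (\<Sum>\<tau> | \<tau> permutes {1..n}. if \<tau> \<in> increasing_rearrangements n (\<lambda>i. fst (z i)) then 1 else 0))"
    by (auto simp: rearrangement_weight_def fun_eq_iff finite_increasing_rearrangements
        increasing_rearrangements_nonempty indicator_def card[symmetric])
  moreover have "\<dots> \<in> borel_measurable (\<Pi>\<^sub>M i\<in>{1..n}. borel \<Otimes>\<^sub>M borel)"
    using assms by (intro borel_measurable_divide borel_measurable_sum measurable_If measurable_mem_increasing_rearrangements[unfolded pred_def] borel_measurable_const) auto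
  ultimately show ?thesis by simp
qed

locale rearranged_sample =
  iid_sequence N "borel \<Otimes>\<^sub>M borel" P "\<lambda>i \<omega>. (Xs i \<omega>, Ys i \<omega>)"
  for N :: "'b measure" and P :: "(real \<times> real) measure" and Xs Ys :: "nat \<Rightarrow> 'b \<Rightarrow> real" +
  fixes \<pi> :: "nat \<Rightarrow> 'b \<Rightarrow> nat \<Rightarrow> nat"
  assumes uniform: "n \<ge> 2 \<Longrightarrow> uniform_increasing_rearrangement N Xs Ys n (\<pi> n)"
begin

abbreviation samples :: "nat \<Rightarrow> (nat \<Rightarrow> real \<times> real) measure" where
  "samples n \<equiv> \<Pi>\<^sub>M i\<in>{1..n}. borel \<Otimes>\<^sub>M borel"

definition data :: "nat \<Rightarrow> 'b \<Rightarrow> nat \<Rightarrow> real \<times> real" where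
  "data n \<omega> = (\<lambda>i\<in>{1..n}. (Xs i \<omega>, Ys i \<omega>))"

lemma measurable_data [measurable]: "data n \<in> N \<rightarrow>\<^sub>M samples n"
  unfolding data_def by (rule measurable_restrict) (use measurable_Z in auto)

lemma distr_data: "n \<ge> 1 \<Longrightarrow> distr N (samples n) (data n) = (\<Pi>\<^sub>M i\<in>{1..n}. P)"
proof -
  assume "n \<ge> 1"
  have "distr N (samples n) (data n) = (\<Pi>\<^sub>M i\<in>{1..n}. distr N (borel \<Otimes>\<^sub>M borel) (\<lambda>\<omega>. (Xs i \<omega>, Ys i \<omega>)))"
    unfolding data_def using \<open>n \<ge> 1\<close> measurable_Z indep_vars_subset[OF indep, of "{1..n}"]
    by (subst indep_vars_iff_distr_eq_PiM'[symmetric]) auto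
  also have "\<dots> = (\<Pi>\<^sub>M i\<in>{1..n}. P)"
    by (intro PiM_cong refl law) auto
  finally show ?thesis .
qed

lemma measurable_\<pi>: "n \<ge> 2 \<Longrightarrow> \<pi> n \<in> N \<rightarrow>\<^sub>M count_space {\<sigma>. \<sigma> permutes {1..n}}"
  using uniform by (simp add: uniform_increasing_rearrangement_def)

lemma \<pi>_permutes: "n \<ge> 2 \<Longrightarrow> \<omega> \<in> space N \<Longrightarrow> \<pi> n \<omega> permutes {1..n}"
  using measurable_space[OF measurable_\<pi>] by simp

lemma sets_\<pi>_eq: "n \<ge> 2 \<Longrightarrow> \<sigma> permutes {1..n} \<Longrightarrow> {\<omega> \<in> space N. \<pi> n \<omega> = \<sigma>} \<in> sets N"
  using measurable_sets[OF measurable_\<pi>, of n "{\<sigma>}"] by (simp add: vimage_def Int_def conj_commute)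

lemma measurable_rearranged:
  assumes "n \<ge> 2" and "\<And>\<sigma>. \<sigma> permutes {1..n} \<Longrightarrow> f \<sigma> \<in> N \<rightarrow>\<^sub>M R"
  shows "(\<lambda>\<omega>. f (\<pi> n \<omega>) \<omega>) \<in> N \<rightarrow>\<^sub>M R"
  by (rule measurable_compose_countable'[OF _ measurable_\<pi>[OF \<open>n \<ge> 2\<close>]])
     (use assms in \<open>auto intro: countable_finite finite_permutations\<close>)

lemma subalgebra_data: "subalgebra N (data_algebra N Xs Ys n)"
  using sets_image_in_sets[OF refl measurable_data[of n]]
  unfolding data_algebra_def subalgebra_def data_def[abs_def] by simp

text \<open>
  Integrating out the random choice of the rearrangement. On sets this is the defining property of the conditional
  probability given the data; as an equality of two measures on the sample space it extends to all integrands.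
\<close>

lemma nn_integral_rearrangement_eq:
  assumes n: "n \<ge> 2" and \<sigma>: "\<sigma> permutes {1..n}" and W [measurable]: "W \<in> borel_measurable (samples n)"
  shows "(\<integral>\<^sup>+\<omega>. W (data n \<omega>) * indicator {\<omega> \<in> space N. \<pi> n \<omega> = \<sigma>} \<omega> \<partial>N)
    = (\<integral>\<^sup>+z. W z * ennreal (rearrangement_weight n \<sigma> z) \<partial>(\<Pi>\<^sub>M i\<in>{1..n}. P))"
proof -
  define E where "E = {\<omega> \<in> space N. \<pi> n \<omega> = \<sigma>}"
  have E [measurable]: "E \<in> sets N" unfolding E_def by (rule sets_\<pi>_eq[OF n \<sigma>])
  note [measurable] = borel_measurable_rearrangement_weight[OF \<sigma>]
  define w where "w = rearrangement_weight n \<sigma>"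
  have [measurable]: "w \<in> borel_measurable (samples n)"
    unfolding w_def by (rule borel_measurable_rearrangement_weight[OF \<sigma>])
  have w_nn: "0 \<le> w z" for z by (simp add: w_def rearrangement_weight_nonneg)
  have w_le: "w z \<le> 1" for z by (simp add: w_def rearrangement_weight_def pmf_le_1)
  interpret F: finite_measure_subalgebra N "data_algebra N Xs Ys n"
    by standard (rule subalgebra_data)
  have AE: "AE \<omega> in N. real_cond_exp N (data_algebra N Xs Ys n) (indicator E) \<omega> = w (data n \<omega>)"
  proof -
    have "increasing_rearrangements n (\<lambda>i. Xs i \<omega>) = increasing_rearrangements n (\<lambda>i. fst (data n \<omega> i))" for \<omega>
      by (rule increasing_rearrangements_cong) (simp add: data_def)
    then show ?thesis
      using uniform[OF n] \<sigma> by (simp add: uniform_increasing_rearrangement_def E_def w_def rearrangement_weight_def)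
  qed
  have "distr (density N (indicator E)) (samples n) (data n) = density (distr N (samples n) (data n)) w"
  proof (rule measure_eqI)
    fix D assume "D \<in> sets (distr (density N (indicator E)) (samples n) (data n))"
    then have D [measurable]: "D \<in> sets (samples n)" by simp
    define D' where "D' = data n -` D \<inter> space N"
    have D': "D' \<in> sets (data_algebra N Xs Ys n)"
      unfolding D'_def data_algebra_def data_def by (rule in_vimage_algebra) (rule D)
    have [measurable]: "D' \<in> sets N" using D' subalgebra_data[of n] by (auto simp: subalgebra_def)
    have int: "integrable N (indicat_real E)" by (simp add: emeasure_eq_measure)
    have int2: "integrable N (\<lambda>\<omega>. indicator D' \<omega> * w (data n \<omega>))"
      by (rule integrable_const_bound[where B = 1]) (auto simp: w_nn w_le indicator_def)
    have "prob (E \<inter> D') = (\<integral>\<omega>\<in>D'. indicator E \<omega> \<partial>N)"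
      by (simp add: set_lebesgue_integral_def flip: indicator_inter_arith) (simp add: Int_commute)
    also have "\<dots> = (\<integral>\<omega>\<in>D'. real_cond_exp N (data_algebra N Xs Ys n) (indicator E) \<omega> \<partial>N)"
      by (rule F.real_cond_exp_intA[OF int D'])
    also have "\<dots> = (\<integral>\<omega>\<in>D'. w (data n \<omega>) \<partial>N)"
      unfolding set_lebesgue_integral_def using AE by (intro integral_cong_AE) auto
    finally have eq: "prob (E \<inter> D') = (\<integral>\<omega>. indicator D' \<omega> * w (data n \<omega>) \<partial>N)"
      by (simp add: set_lebesgue_integral_def)
    have "emeasure (distr (density N (indicator E)) (samples n) (data n)) D = emeasure (density N (indicator E)) D'"
      by (subst emeasure_distr) (auto simp: D'_def)
    also have "\<dots> = emeasure N (E \<inter> D')"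
      by (simp add: emeasure_density flip: indicator_inter_arith)
    also have "\<dots> = (\<integral>\<^sup>+\<omega>. ennreal (indicator D' \<omega> * w (data n \<omega>)) \<partial>N)"
      by (subst nn_integral_eq_integral[OF int2]) (auto simp: w_nn emeasure_eq_measure eq)
    also have "\<dots> = (\<integral>\<^sup>+\<omega>. ennreal (w (data n \<omega>)) * indicator D (data n \<omega>) \<partial>N)"
      by (intro nn_integral_cong) (auto simp: D'_def indicator_def)
    also have "\<dots> = emeasure (density (distr N (samples n) (data n)) w) D"
      by (simp add: emeasure_density nn_integral_distr)
    finally show "emeasure (distr (density N (indicator E)) (samples n) (data n)) D =
      emeasure (density (distr N (samples n) (data n)) w) D" .
  qed simp
  then have "(\<integral>\<^sup>+z. W z \<partial>distr (density N (indicator E)) (samples n) (data n)) =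
      (\<integral>\<^sup>+z. W z \<partial>density (distr N (samples n) (data n)) w)" by simp
  then have "(\<integral>\<^sup>+\<omega>. W (data n \<omega>) * indicator E \<omega> \<partial>N) =
      (\<integral>\<^sup>+z. W z * ennreal (w z) \<partial>distr N (samples n) (data n))"
    by (simp add: nn_integral_distr nn_integral_density mult.commute)
  then show ?thesis using n by (simp add: distr_data E_def w_def)
qed

lemma AE_increasing: "AE \<omega> in N. \<forall>n\<ge>2. \<pi> n \<omega> \<in> increasing_rearrangements n (\<lambda>i. Xs i \<omega>)"
proof -
  have "AE \<omega> in N. \<pi> n \<omega> \<in> increasing_rearrangements n (\<lambda>i. Xs i \<omega>)" if n: "n \<ge> 2" for n
  proof -
    have Inc: "increasing_rearrangements n (\<lambda>i. Xs i \<omega>) = increasing_rearrangements n (\<lambda>i. fst (data n \<omega> i))" for \<omega>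
      by (rule increasing_rearrangements_cong) (simp add: data_def)
    have "AE \<omega> in N. \<pi> n \<omega> = \<sigma> \<longrightarrow> \<sigma> \<in> increasing_rearrangements n (\<lambda>i. Xs i \<omega>)"
      if \<sigma>: "\<sigma> permutes {1..n}" for \<sigma>
    proof -
      note [measurable] = measurable_mem_increasing_rearrangements[OF \<sigma>] sets_\<pi>_eq[OF n \<sigma>]
      define W :: "_ \<Rightarrow> ennreal" where
        "W z = (if \<sigma> \<in> increasing_rearrangements n (\<lambda>i. fst (z i :: real \<times> real)) then 0 else 1)" for z
      have W [measurable]: "W \<in> borel_measurable (samples n)" unfolding W_def by measurable
      have "(\<integral>\<^sup>+\<omega>. W (data n \<omega>) * indicator {\<omega> \<in> space N. \<pi> n \<omega> = \<sigma>} \<omega> \<partial>N) = 0"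
        unfolding nn_integral_rearrangement_eq[OF n \<sigma> W]
        by (auto simp: W_def rearrangement_weight_eq_0 intro!: nn_integral_zero')
      then have "AE \<omega> in N. W (data n \<omega>) * indicator {\<omega> \<in> space N. \<pi> n \<omega> = \<sigma>} \<omega> = 0"
        by (subst (asm) nn_integral_0_iff_AE) auto
      then show ?thesis
        using AE_space by eventually_elim (auto simp: W_def Inc split: if_splits)
    qed
    then have "AE \<omega> in N. \<forall>\<sigma>\<in>{\<sigma>. \<sigma> permutes {1..n}}. \<pi> n \<omega> = \<sigma> \<longrightarrow> \<sigma> \<in> increasing_rearrangements n (\<lambda>i. Xs i \<omega>)"
      by (intro AE_finite_allI finite_permutations) auto
    then show ?thesis
      using AE_space by eventually_elim (auto simp: \<pi>_permutes[OF n])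
  qed
  then show ?thesis unfolding AE_all_countable by auto
qed

text \<open>
  Given the data, the exponential moment is a mixture over \<open>\<sigma>\<close> with the rearrangement weights. The martingale
  bound applies to each \<open>\<sigma>\<close>, and the weights sum to 1.
\<close>

lemma AE_consecutive_products_centered:
  assumes "conditional_probability P A h"
  shows "AE \<omega> in N. (\<lambda>n. ((\<Sum>i=1..<n. indicator A (Xs (\<pi> n \<omega> i) \<omega>, Ys (\<pi> n \<omega> i) \<omega>) *
        indicator A (Xs (\<pi> n \<omega> (i + 1)) \<omega>, Ys (\<pi> n \<omega> (i + 1)) \<omega>)) -
      (\<Sum>i=1..<n. h (Xs (\<pi> n \<omega> i) \<omega>) * h (Xs (\<pi> n \<omega> (i + 1)) \<omega>))) / n) \<longlonglongrightarrow> (0::real)"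
proof -
  interpret P: conditional_probability P A h by fact
  define V where "V n \<sigma> z = (\<Sum>j=1..n. (indicator A (z (\<sigma> j)) - h (fst (z (\<sigma> j)))) *
      ((if 2 \<le> j then indicator A (z (\<sigma> (j - 1))) else 0) + (if j < n then h (fst (z (\<sigma> (j + 1)))) else 0)))"
    for n and \<sigma> :: "nat \<Rightarrow> nat" and z
  define T where "T n \<omega> = V n (\<pi> n \<omega>) (data n \<omega>)" for n \<omega>
  have V_alt: "V n \<sigma> z = (\<Sum>i=1..<n. indicator A (z (\<sigma> i)) * indicator A (z (\<sigma> (i + 1)))) -
      (\<Sum>i=1..<n. h (fst (z (\<sigma> i))) * h (fst (z (\<sigma> (i + 1)))))" for n \<sigma> z
    unfolding V_def by (rule sum_centered_consecutive_products)
  have V_meas: "V n \<sigma> \<in> borel_measurable (samples n)" if \<sigma>: "\<sigma> permutes {1..n}" for n \<sigma>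
  proof -
    have [measurable]: "(\<lambda>z. z (\<sigma> j)) \<in> samples n \<rightarrow>\<^sub>M borel \<Otimes>\<^sub>M borel"
      "(\<lambda>z. z (\<sigma> (j + 1))) \<in> samples n \<rightarrow>\<^sub>M borel \<Otimes>\<^sub>M borel" if "j \<in> {1..<n}" for j
      using that permutes_in_image[OF \<sigma>, of j] permutes_in_image[OF \<sigma>, of "j + 1"]
      by (auto intro!: measurable_component_singleton)
    show ?thesis unfolding V_alt[abs_def] by measurable
  qed
  have "AE \<omega> in N. (\<lambda>n. T n \<omega> / n) \<longlonglongrightarrow> 0"
  proof (rule AE_averages_tendsto_0_if_subgaussian[where m = 2 and K = 4])
    fix n :: nat assume n: "n \<ge> 2"
    show "T n \<in> borel_measurable N"
      unfolding T_def by (rule measurable_rearranged[OF n]) (use V_meas in measurable)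
    fix l :: real
    let ?Perm = "{\<sigma>. \<sigma> permutes {1..n}}" and ?E = "\<lambda>\<sigma>. {\<omega> \<in> space N. \<pi> n \<omega> = \<sigma>}"
    have fin: "finite ?Perm" by (simp add: finite_permutations)
    have "(\<integral>\<^sup>+\<omega>. ennreal (exp (l * T n \<omega>)) \<partial>N) =
        (\<integral>\<^sup>+\<omega>. (\<Sum>\<sigma>\<in>?Perm. ennreal (exp (l * V n \<sigma> (data n \<omega>))) * indicator (?E \<sigma>) \<omega>) \<partial>N)"
    proof (rule nn_integral_cong)
      fix \<omega> assume \<omega>: "\<omega> \<in> space N"
      then have "indicator (?E \<sigma>) \<omega> = (if \<sigma> = \<pi> n \<omega> then 1 else 0 :: ennreal)" for \<sigma>
        by (auto simp: indicator_def)
      then show "ennreal (exp (l * T n \<omega>)) =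
          (\<Sum>\<sigma>\<in>?Perm. ennreal (exp (l * V n \<sigma> (data n \<omega>))) * indicator (?E \<sigma>) \<omega>)"
        using \<pi>_permutes[OF n \<omega>] fin by (simp add: T_def if_distrib[where f = "\<lambda>x. _ * x"] sum.delta cong: if_cong)
    qed
    also have "\<dots> = (\<Sum>\<sigma>\<in>?Perm. \<integral>\<^sup>+\<omega>. ennreal (exp (l * V n \<sigma> (data n \<omega>))) * indicator (?E \<sigma>) \<omega> \<partial>N)"
    proof (rule nn_integral_sum)
      fix \<sigma> assume \<sigma>: "\<sigma> \<in> ?Perm"
      then have [measurable]: "?E \<sigma> \<in> sets N" "V n \<sigma> \<in> borel_measurable (samples n)"
        using sets_\<pi>_eq[OF n] V_meas by auto
      show "(\<lambda>\<omega>. ennreal (exp (l * V n \<sigma> (data n \<omega>))) * indicator (?E \<sigma>) \<omega>) \<in> borel_measurable N"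
        by measurable
    qed
    also have "\<dots> \<le> (\<Sum>\<sigma>\<in>?Perm. ennreal (exp (4 * l\<^sup>2 * n)) *
        (\<integral>\<^sup>+z. ennreal (rearrangement_weight n \<sigma> z) \<partial>(\<Pi>\<^sub>M i\<in>{1..n}. P)))"
    proof (rule sum_mono)
      fix \<sigma> assume "\<sigma> \<in> ?Perm"
      then have \<sigma>: "\<sigma> permutes {1..n}" by simp
      note [measurable] = V_meas[OF \<sigma>] borel_measurable_rearrangement_weight[OF \<sigma>]
      have "(\<integral>\<^sup>+\<omega>. ennreal (exp (l * V n \<sigma> (data n \<omega>))) * indicator (?E \<sigma>) \<omega> \<partial>N) =
          (\<integral>\<^sup>+z. ennreal (rearrangement_weight n \<sigma> z) * ennreal (exp (l * V n \<sigma> z)) \<partial>(\<Pi>\<^sub>M i\<in>{1..n}. P))"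
        by (subst nn_integral_rearrangement_eq[OF n \<sigma>]) (auto simp: mult.commute)
      also have "\<dots> \<le> ennreal (exp (4 * l\<^sup>2 * n)) *
        (\<integral>\<^sup>+z. ennreal (rearrangement_weight n \<sigma> z) \<partial>(\<Pi>\<^sub>M i\<in>{1..n}. P))"
        unfolding V_def
      proof (rule P.martingale_exp_moment_le[OF \<sigma>])
        fix k x y and z :: "nat \<Rightarrow> real \<times> real"
        have "(\<lambda>i. fst ((z(k := (x, y))) i)) = (\<lambda>i. fst ((z(k := (x, 0))) i))" by auto
        then show "ennreal (rearrangement_weight n \<sigma> (z(k := (x, y)))) =
            ennreal (rearrangement_weight n \<sigma> (z(k := (x, 0))))"
          unfolding rearrangement_weight_def by metis
      qed simp_all
      finally show "(\<integral>\<^sup>+\<omega>. ennreal (exp (l * V n \<sigma> (data n \<omega>))) * indicator (?E \<sigma>) \<omega> \<partial>N) \<le>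
        ennreal (exp (4 * l\<^sup>2 * n)) * (\<integral>\<^sup>+z. ennreal (rearrangement_weight n \<sigma> z) \<partial>(\<Pi>\<^sub>M i\<in>{1..n}. P))" .
    qed
    also have "\<dots> = ennreal (exp (4 * l\<^sup>2 * n)) *
        (\<integral>\<^sup>+z. (\<Sum>\<sigma>\<in>?Perm. ennreal (rearrangement_weight n \<sigma> z)) \<partial>(\<Pi>\<^sub>M i\<in>{1..n}. P))"
    proof (subst nn_integral_sum)
      fix \<sigma> assume "\<sigma> \<in> ?Perm"
      then have [measurable]: "rearrangement_weight n \<sigma> \<in> borel_measurable (\<Pi>\<^sub>M i\<in>{1..n}. P)"
        using borel_measurable_rearrangement_weight[of \<sigma> n]
        by (simp add: measurable_cong_sets[OF sets_PiM_cong[OF refl P.sets_P] refl])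
      show "(\<lambda>z. ennreal (rearrangement_weight n \<sigma> z)) \<in> borel_measurable (\<Pi>\<^sub>M i\<in>{1..n}. P)" by measurable
    qed (simp add: sum_distrib_left)
    also have "\<dots> = ennreal (exp (4 * l\<^sup>2 * n))"
    proof -
      interpret PiM: prob_space "\<Pi>\<^sub>M i\<in>{1..n}. P" by (rule prob_space_PiM) (rule prob_space_P)
      show ?thesis
        by (simp add: sum_ennreal rearrangement_weight_nonneg sum_rearrangement_weight PiM.emeasure_space_1)
    qed
    finally show "(\<integral>\<^sup>+\<omega>. ennreal (exp (l * T n \<omega>)) \<partial>N) \<le> ennreal (exp (4 * l\<^sup>2 * n))" .
  qed simp
  then show ?thesis
    using AE_space
  proof eventually_elim
    case (elim \<omega>)
    have "\<forall>\<^sub>F n in sequentially. T n \<omega> / n = ((\<Sum>i=1..<n. indicator A (Xs (\<pi> n \<omega> i) \<omega>, Ys (\<pi> n \<omega> i) \<omega>) *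
        indicator A (Xs (\<pi> n \<omega> (i + 1)) \<omega>, Ys (\<pi> n \<omega> (i + 1)) \<omega>)) -
      (\<Sum>i=1..<n. h (Xs (\<pi> n \<omega> i) \<omega>) * h (Xs (\<pi> n \<omega> (i + 1)) \<omega>))) / n"
      using eventually_ge_at_top[of 2]
    proof eventually_elim
      case (elim n)
      have "data n \<omega> (\<pi> n \<omega> i) = (Xs (\<pi> n \<omega> i) \<omega>, Ys (\<pi> n \<omega> i) \<omega>)" if "i \<in> {1..n}" for i
        using that permutes_in_image[OF \<pi>_permutes[OF elim \<open>\<omega> \<in> space N\<close>], of i] by (simp add: data_def)
      then show ?case unfolding T_def V_alt by (intro arg_cong2[where f = "(/)"] arg_cong2[where f = "(-)"] sum.cong) auto
    qed
    with elim(1) show ?case by (rule Lim_transform_eventually)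
  qed
qed

end

section \<open>Neighbours in the rearrangement\<close>

lemma tendsto_0_if_approximable:
  fixes R :: "nat \<Rightarrow> real"
  assumes "\<And>n. 0 \<le> R n" and "\<And>K. \<forall>\<^sub>F n in sequentially. R n \<le> a K n"
    and "\<And>K. a K \<longlonglongrightarrow> c K" and "c \<longlonglongrightarrow> (0::real)"
  shows "R \<longlonglongrightarrow> 0"
proof (rule tendstoI)
  fix e :: real assume "e > 0"
  then obtain K where "c K < e"
    using order_tendstoD(2)[OF assms(4), of e] by (auto simp: eventually_sequentially)
  from order_tendstoD(2)[OF assms(3) this] assms(2)[of K]
  show "\<forall>\<^sub>F n in sequentially. dist (R n) 0 < e"
    by eventually_elim (use assms(1) in \<open>auto simp: abs_le_iff intro: order.strict_trans1\<close>)
qed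

lemma sum_consecutive_le:
  fixes f :: "nat \<Rightarrow> real"
  assumes "\<And>i. i \<in> {1..n} \<Longrightarrow> 0 \<le> f i"
  shows "(\<Sum>i=1..<n. f i + f (i + 1)) \<le> 2 * (\<Sum>i=1..n. f i)"
proof -
  have "(\<Sum>i=1..<n. f (i + 1)) = (\<Sum>i=2..n. f i)"
    by (rule sum.reindex_bij_witness[of _ "\<lambda>i. i - 1" "\<lambda>i. i + 1"]) auto
  moreover have "(\<Sum>i=2..n. f i) \<le> (\<Sum>i=1..n. f i)" "(\<Sum>i=1..<n. f i) \<le> (\<Sum>i=1..n. f i)"
    using assms by (auto intro!: sum_mono2)
  ultimately show ?thesis by (simp add: sum.distrib)
qed

lemma sum_consecutive_eq:
  fixes f :: "nat \<Rightarrow> real"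
  assumes "n \<ge> 1"
  shows "(\<Sum>i=1..<n. f i + f (i + 1)) = 2 * (\<Sum>i=1..n. f i) - f 1 - f n"
proof -
  have "(\<Sum>i=1..<n. f (i + 1)) = (\<Sum>i=2..n. f i)"
    by (rule sum.reindex_bij_witness[of _ "\<lambda>i. i - 1" "\<lambda>i. i + 1"]) auto
  moreover have "(\<Sum>i=1..n. f i) = f 1 + (\<Sum>i=2..n. f i)"
    using assms by (simp add: sum.atLeast_Suc_atMost numeral_2_eq_2)
  moreover have "(\<Sum>i=1..n. f i) = (\<Sum>i=1..<n. f i) + f n"
    using assms by (simp add: sum.last_plus add.commute)
  ultimately show ?thesis by (simp add: sum.distrib)
qed

context rearranged_sample
begin

definition variation :: "nat \<Rightarrow> (real \<times> real \<Rightarrow> real) \<Rightarrow> 'b \<Rightarrow> real" where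
  "variation n f \<omega> = (\<Sum>i=1..<n. \<bar>f (Xs (\<pi> n \<omega> (i + 1)) \<omega>, Ys (\<pi> n \<omega> (i + 1)) \<omega>) - f (Xs (\<pi> n \<omega> i) \<omega>, Ys (\<pi> n \<omega> i) \<omega>)\<bar>)"

lemma variation_nonneg: "0 \<le> variation n f \<omega>"
  by (simp add: variation_def sum_nonneg)

lemma sum_rearranged:
  assumes "n \<ge> 2" "\<omega> \<in> space N"
  shows "(\<Sum>i=1..n. f (\<pi> n \<omega> i)) = (\<Sum>i=1..n. f i)"
  using sum.permute[OF \<pi>_permutes[OF assms], of f] by (simp add: comp_def)

text \<open>
  If increments of \<open>f\<close> are dominated by those of the \<open>g k\<close> up to an error \<open>r\<close>, then so are the variations.
  Each data point has at most two neighbours, and the error is summed over all of them, so it no longer depends on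
  the rearrangement and falls under the strong law.
\<close>

lemma variation_le_sum:
  assumes n: "n \<ge> 2" "\<omega> \<in> space N" and r: "\<And>z. 0 \<le> r z"
    and f: "\<And>z z'. \<bar>f z - f z'\<bar> \<le> (\<Sum>k\<in>J. c * \<bar>g k z - g k z'\<bar>) + (r z + r z')"
  shows "variation n f \<omega> \<le> (\<Sum>k\<in>J. c * variation n (g k) \<omega>) + 2 * (\<Sum>i=1..n. r (Xs i \<omega>, Ys i \<omega>))"
proof -
  let ?z = "\<lambda>i. (Xs (\<pi> n \<omega> i) \<omega>, Ys (\<pi> n \<omega> i) \<omega>)"
  have "variation n f \<omega> \<le> (\<Sum>i=1..<n. (\<Sum>k\<in>J. c * \<bar>g k (?z (i + 1)) - g k (?z i)\<bar>) + (r (?z i) + r (?z (i + 1))))"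
    unfolding variation_def by (intro sum_mono order_trans[OF f]) simp
  also have "\<dots> = (\<Sum>i=1..<n. \<Sum>k\<in>J. c * \<bar>g k (?z (i + 1)) - g k (?z i)\<bar>) + (\<Sum>i=1..<n. r (?z i) + r (?z (i + 1)))"
    by (rule sum.distrib)
  also have "(\<Sum>i=1..<n. \<Sum>k\<in>J. c * \<bar>g k (?z (i + 1)) - g k (?z i)\<bar>) = (\<Sum>k\<in>J. c * variation n (g k) \<omega>)"
    by (subst sum.swap) (simp add: variation_def sum_distrib_left)
  also have "(\<Sum>i=1..<n. r (?z i) + r (?z (i + 1))) \<le> 2 * (\<Sum>i=1..n. r (?z i))"
    by (rule sum_consecutive_le) (rule r)
  also have "(\<Sum>i=1..n. r (?z i)) = (\<Sum>i=1..n. r (Xs i \<omega>, Ys i \<omega>))"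
    by (rule sum_rearranged[OF n])
  finally show ?thesis by simp
qed

text \<open>
  Induction over the \<open>\<sigma>\<close>-algebra generated by the half-lines \<open>{..a}\<close>. The indicator of such a half-line decreases
  along the sorted values, hence has variation at most 1. For a union of sets \<open>A k\<close>, the
  first \<open>K\<close> sets contribute nothing in the limit, and the remainder \<open>D K\<close> contributes at most twice its probability.
\<close>

lemma AE_variation_indicator:
  assumes "C \<in> sets borel"
  shows "AE \<omega> in N. (\<lambda>n. variation n (\<lambda>z. indicator C (fst z)) \<omega> / n) \<longlonglongrightarrow> 0"
proof -
  interpret P: prob_space P by (rule prob_space_P)
  have "C \<in> sigma_sets UNIV (range atMost)"
    using assms borel_eq_atMost by (metis sets_measure_of Pow_UNIV subset_UNIV)
  then show ?thesis
  proof induction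
    case (Basic C)
    then obtain a where C: "C = {..a}" by auto
    show ?case
      using AE_increasing
    proof eventually_elim
      case (elim \<omega>)
      have le: "variation n (\<lambda>z. indicator C (fst z)) \<omega> \<le> 1" if n: "n \<ge> 2" for n
      proof -
        define d where "d i = indicat_real C (Xs (\<pi> n \<omega> i) \<omega>)" for i
        from elim n have "mono_on {1..n} (\<lambda>i. Xs (\<pi> n \<omega> i) \<omega>)"
          by (auto simp: increasing_rearrangements_def)
        then have "Xs (\<pi> n \<omega> i) \<omega> \<le> Xs (\<pi> n \<omega> (i + 1)) \<omega>" if "i \<in> {1..<n}" for i
          using that by (auto simp: monotone_on_def)
        then have "d (i + 1) \<le> d i" if "i \<in> {1..<n}" for i
          using that by (force simp: d_def C indicator_def)
        then have "variation n (\<lambda>z. indicator C (fst z)) \<omega> = (\<Sum>i=1..<n. d i - d (Suc i))"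
          unfolding variation_def Suc_eq_plus1 by (intro sum.cong) (auto simp: d_def)
        also have "\<dots> = d 1 - d n"
          using sum_Suc_diff'[of 1 n d] n by (simp add: sum_subtractf)
        finally show ?thesis by (simp add: d_def indicator_def)
      qed
      show ?case
      proof (rule tendsto_sandwich[OF _ _ tendsto_const])
        show "\<forall>\<^sub>F n in sequentially. 0 \<le> variation n (\<lambda>z. indicator C (fst z)) \<omega> / n"
          by (simp add: variation_nonneg)
        show "\<forall>\<^sub>F n in sequentially. variation n (\<lambda>z. indicator C (fst z)) \<omega> / n \<le> 1 / n"
          using eventually_ge_at_top[of 2] by eventually_elim (simp add: le divide_right_mono)
        show "(\<lambda>n. 1 / real n) \<longlonglongrightarrow> 0" by (rule lim_1_over_n)
      qed
    qed
  next
    case Empty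
    then show ?case by (simp add: variation_def)
  next
    case (Compl C)
    have "\<bar>indicat_real (UNIV - C) x - indicator (UNIV - C) y\<bar> = \<bar>indicator C x - indicator C y\<bar>" for x y :: real
      by (auto simp: indicator_def)
    with Compl.IH show ?case by (simp add: variation_def)
  next
    case (Union A)
    have A [measurable]: "A k \<in> sets borel" for k
      using Union.hyps[of k] borel_eq_atMost by (metis sets_measure_of Pow_UNIV subset_UNIV)
    define D where "D K = (\<Union>k. A k) - (\<Union>k<K. A k)" for K
    have D [measurable]: "D K \<in> sets borel" for K by (simp add: D_def)
    define s where "s K = (\<integral>z. indicat_real (D K) (fst z) \<partial>P)" for K
    have mfst [measurable]: "fst \<in> P \<rightarrow>\<^sub>M borel" by (simp add: measurable_P)
    have "(\<lambda>K. measure (distr P borel fst) (D K)) \<longlonglongrightarrow> measure (distr P borel fst) (\<Inter>K. D K)"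
    proof -
      interpret Q: prob_space "distr P borel fst" by (rule P.prob_space_distr) simp
      show ?thesis
        by (rule Q.finite_Lim_measure_decseq) (auto simp: D_def decseq_def)
    qed
    moreover have "(\<Inter>K. D K) = {}" by (auto simp: D_def)
    moreover have "s = (\<lambda>K. measure (distr P borel fst) (D K))"
    proof
      show "s K = measure (distr P borel fst) (D K)" for K
        unfolding s_def using integral_distr[OF mfst, of "indicat_real (D K)"] by simp
    qed
    ultimately have s: "s \<longlonglongrightarrow> 0"
      by (simp only: measure_empty)
    have "AE \<omega> in N. \<forall>K. (\<lambda>n. (\<Sum>i=1..n. indicat_real (D K) (Xs i \<omega>)) / n) \<longlonglongrightarrow> s K"
      unfolding AE_all_countable
    proof
      fix K
      show "AE \<omega> in N. (\<lambda>n. (\<Sum>i=1..n. indicat_real (D K) (Xs i \<omega>)) / n) \<longlonglongrightarrow> s K"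
        using strong_law_bounded[of "\<lambda>z. indicator (D K) (fst z)" 1] by (simp add: s_def indicator_def)
    qed
    moreover have "AE \<omega> in N. \<forall>k. (\<lambda>n. variation n (\<lambda>z. indicator (A k) (fst z)) \<omega> / n) \<longlonglongrightarrow> 0"
      unfolding AE_all_countable using Union.IH by blast
    ultimately show ?case
      using AE_space
    proof eventually_elim
      case (elim \<omega>)
      show ?case
      proof (rule tendsto_0_if_approximable)
        show "0 \<le> variation n (\<lambda>z. indicator (\<Union>k. A k) (fst z)) \<omega> / n" for n
          by (simp add: variation_nonneg)
        fix K
        let ?a = "\<lambda>n. (\<Sum>k<K. 1 * (variation n (\<lambda>z. indicator (A k) (fst z)) \<omega> / n)) +
          2 * ((\<Sum>i=1..n. indicat_real (D K) (Xs i \<omega>)) / n)"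
        show "?a \<longlonglongrightarrow> 2 * s K"
        proof -
          have "?a \<longlonglongrightarrow> (\<Sum>k<K. 1 * 0) + 2 * s K"
            by (intro tendsto_intros) (use elim in blast)+
          then show ?thesis by simp
        qed
        have "\<bar>indicat_real (\<Union>k. A k) x - indicator (\<Union>k. A k) y\<bar> \<le>
          (\<Sum>k<K. 1 * \<bar>indicat_real (A k) x - indicator (A k) y\<bar>) + (indicator (D K) x + indicator (D K) y)" for x y
        proof -
          define V where "V = (\<Sum>k<K. 1 * \<bar>indicat_real (A k) x - indicator (A k) y\<bar>)"
          have V: "\<bar>indicat_real (A k) x - indicator (A k) y\<bar> \<le> V" if "k < K" for k
            using that member_le_sum[of k "{..<K}" "\<lambda>k. \<bar>indicat_real (A k) x - indicator (A k) y\<bar>"]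
            by (simp add: V_def)
          have nn: "0 \<le> V" by (simp add: V_def sum_nonneg)
          consider "x \<in> (\<Union>k. A k) \<longleftrightarrow> y \<in> (\<Union>k. A k)" | "x \<in> D K" | "y \<in> D K"
            | k where "k < K" "(x \<in> A k) \<noteq> (y \<in> A k)"
            unfolding D_def by blast
          then show ?thesis
            unfolding V_def[symmetric]
          proof cases
            case 4
            then have "1 \<le> V" using V[of k] by (auto simp: indicator_def split: if_splits)
            then show "\<bar>indicat_real (\<Union>k. A k) x - indicator (\<Union>k. A k) y\<bar> \<le> V + (indicator (D K) x + indicator (D K) y)"
              by (auto simp: indicator_def)
          qed (use nn in \<open>auto simp: indicator_def\<close>)
        qed
        then have le: "variation n (\<lambda>z. indicator (\<Union>k. A k) (fst z)) \<omega> \<le>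
          (\<Sum>k<K. 1 * variation n (\<lambda>z. indicator (A k) (fst z)) \<omega>) + 2 * (\<Sum>i=1..n. indicat_real (D K) (Xs i \<omega>))"
          if "n \<ge> 2" for n
          using variation_le_sum[OF that \<open>\<omega> \<in> space N\<close>, where r = "\<lambda>z. indicator (D K) (fst z)" and c = 1
            and J = "{..<K}" and f = "\<lambda>z. indicator (\<Union>k. A k) (fst z)" and g = "\<lambda>k z. indicator (A k) (fst z)"]
          by simp
        show "\<forall>\<^sub>F n in sequentially. variation n (\<lambda>z. indicator (\<Union>k. A k) (fst z)) \<omega> / n \<le> ?a n"
          using eventually_ge_at_top[of 2]
        proof eventually_elim
          case (elim n)
          show ?case
            unfolding times_divide_eq_right sum_divide_distrib[symmetric] add_divide_distrib[symmetric]
            by (rule divide_right_mono[OF le[OF elim]]) simp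
        qed
      next
        show "(\<lambda>K. 2 * s K) \<longlonglongrightarrow> 0" using s by (auto intro!: tendsto_eq_intros)
      qed
    qed
  qed
qed

text \<open>
  The function \<open>h\<close> is within \<open>e = 1 / Suc K\<close> of the step function that adds \<open>e\<close> for each level \<open>j * e\<close> with
  \<open>1 \<le> j \<le> Suc K\<close> that \<open>h\<close> reaches.
\<close>

lemma AE_variation:
  fixes h :: "real \<Rightarrow> real"
  assumes h [measurable]: "h \<in> borel_measurable borel" and h01: "\<And>x. 0 \<le> h x" "\<And>x. h x \<le> 1"
  shows "AE \<omega> in N. (\<lambda>n. variation n (\<lambda>z. h (fst z)) \<omega> / n) \<longlonglongrightarrow> 0"
proof -
  define C where "C K j = {x. h x \<ge> real j / real (Suc K)}" for K j
  have [measurable]: "C K j \<in> sets borel" for K j unfolding C_def by measurable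
  have "AE \<omega> in N. \<forall>K j. (\<lambda>n. variation n (\<lambda>z. indicator (C K j) (fst z)) \<omega> / n) \<longlonglongrightarrow> 0"
    unfolding AE_all_countable by (intro allI AE_variation_indicator) simp
  then show ?thesis
    using AE_space
  proof eventually_elim
    case (elim \<omega>)
    show ?case
    proof (rule tendsto_0_if_approximable)
      show "0 \<le> variation n (\<lambda>z. h (fst z)) \<omega> / n" for n by (simp add: variation_nonneg)
      fix K
      define e where "e = 1 / real (Suc K)"
      have e: "e > 0" by (simp add: e_def)
      have layer: "\<bar>h x - (\<Sum>j\<in>{1..Suc K}. e * indicator (C K j) x)\<bar> \<le> e" for x
      proof -
        define m where "m = nat \<lfloor>h x / e\<rfloor>"
        have "h x / e \<le> Suc K" using h01(2)[of x] by (simp add: e_def mult_le_cancel_right1 mult.commute)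
        moreover have m: "real m \<le> h x / e" "h x / e < real m + 1"
          using h01(1)[of x] e by (auto simp: m_def of_nat_floor) 
        ultimately have "real m \<le> Suc K" by linarith
        then have "m \<le> Suc K" by simp
        have "x \<in> C K j \<longleftrightarrow> j \<le> m" for j
        proof -
          have "x \<in> C K j \<longleftrightarrow> real j \<le> h x / e"
            by (simp add: C_def e_def divide_le_eq del: of_nat_Suc)
          also have "\<dots> \<longleftrightarrow> j \<le> m" using m by (auto simp: m_def le_nat_floor) 
          finally show ?thesis .
        qed
        then have "(\<Sum>j\<in>{1..Suc K}. e * indicator (C K j) x) = (\<Sum>j\<in>{1..Suc K}. if j \<le> m then e else 0)"
          by (intro sum.cong) (auto simp: indicator_def)
        also have "\<dots> = (\<Sum>j\<in>{1..m}. e)"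
          using \<open>m \<le> Suc K\<close> by (intro sum.mono_neutral_cong_right) auto
        also have "\<dots> = e * m" by simp
        finally have "h x - (\<Sum>j\<in>{1..Suc K}. e * indicator (C K j) x) = h x - e * m" by simp
        moreover have "e * m \<le> h x" "h x \<le> e * m + e" using m e by (auto simp: field_simps)
        ultimately show ?thesis by simp
      qed
      have "\<bar>h x - h y\<bar> \<le> (\<Sum>j\<in>{1..Suc K}. e * \<bar>indicat_real (C K j) x - indicator (C K j) y\<bar>) + (e + e)" for x y
      proof -
        have "\<bar>(\<Sum>j\<in>{1..Suc K}. e * indicat_real (C K j) x) - (\<Sum>j\<in>{1..Suc K}. e * indicator (C K j) y)\<bar> \<le>
           (\<Sum>j\<in>{1..Suc K}. e * \<bar>indicat_real (C K j) x - indicator (C K j) y\<bar>)"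
          unfolding sum_subtractf[symmetric] right_diff_distrib[symmetric]
          by (rule order_trans[OF sum_abs]) (use e in \<open>simp add: abs_mult\<close>)
        then show ?thesis using layer[of x] layer[of y] by linarith
      qed
      then have le: "variation n (\<lambda>z. h (fst z)) \<omega> \<le>
        (\<Sum>j\<in>{1..Suc K}. e * variation n (\<lambda>z. indicator (C K j) (fst z)) \<omega>) + 2 * (\<Sum>i=1..n. e)"
        if "n \<ge> 2" for n
        using variation_le_sum[OF that \<open>\<omega> \<in> space N\<close>, where r = "\<lambda>_. e" and c = e and J = "{1..Suc K}"
            and f = "\<lambda>z. h (fst z)" and g = "\<lambda>j z. indicator (C K j) (fst z)"] e by simp
      show "\<forall>\<^sub>F n in sequentially. variation n (\<lambda>z. h (fst z)) \<omega> / n \<le>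
        (\<Sum>j\<in>{1..Suc K}. e * (variation n (\<lambda>z. indicator (C K j) (fst z)) \<omega> / n)) + 2 * e"
        using eventually_ge_at_top[of 2]
      proof eventually_elim
        case (elim n)
        from divide_right_mono[OF le[OF elim], of "real n"] elim
        show ?case by (simp add: add_divide_distrib sum_divide_distrib)
      qed
      show "(\<lambda>n. (\<Sum>j\<in>{1..Suc K}. e * (variation n (\<lambda>z. indicator (C K j) (fst z)) \<omega> / n)) + 2 * e) \<longlonglongrightarrow> 2 * (1 / real (Suc K))"
      proof -
        have "(\<lambda>n. (\<Sum>j\<in>{1..Suc K}. e * (variation n (\<lambda>z. indicator (C K j) (fst z)) \<omega> / n)) + 2 * e)
          \<longlonglongrightarrow> (\<Sum>j\<in>{1..Suc K}. e * 0) + 2 * e"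
          by (intro tendsto_intros) (use elim in blast)
        then show ?thesis by (simp add: e_def)
      qed
    next
      show "(\<lambda>K. 2 * (1 / real (Suc K))) \<longlonglongrightarrow> 0"
        using tendsto_mult[OF tendsto_const[of 2] LIMSEQ_Suc[OF lim_1_over_n]] by simp
    qed
  qed
qed

lemma AE_consecutive_products:
  fixes h :: "real \<Rightarrow> real"
  assumes h [measurable]: "h \<in> borel_measurable borel" and h01: "\<And>x. 0 \<le> h x" "\<And>x. h x \<le> 1"
  shows "AE \<omega> in N. (\<lambda>n. (\<Sum>i=1..<n. h (Xs (\<pi> n \<omega> i) \<omega>) * h (Xs (\<pi> n \<omega> (i + 1)) \<omega>)) / n)
     \<longlonglongrightarrow> (\<integral>z. (h (fst z))\<^sup>2 \<partial>P)"
proof -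
  have "AE \<omega> in N. (\<lambda>n. (\<Sum>i=1..n. (h (Xs i \<omega>))\<^sup>2) / n) \<longlonglongrightarrow> (\<integral>z. (h (fst z))\<^sup>2 \<partial>P)"
    using strong_law_bounded[of "\<lambda>z. (h (fst z))\<^sup>2" 1] by (simp add: h01 power_le_one)
  with AE_variation[OF h h01] AE_space show ?thesis
  proof eventually_elim
    case (elim \<omega>)
    let ?p = "\<lambda>n. \<Sum>i=1..<n. h (Xs (\<pi> n \<omega> i) \<omega>) * h (Xs (\<pi> n \<omega> (i + 1)) \<omega>)"
    let ?q = "\<lambda>n. \<Sum>i=1..n. (h (Xs i \<omega>))\<^sup>2"
    let ?v = "\<lambda>n. variation n (\<lambda>z. h (fst z)) \<omega>"
    have diff: "\<bar>?p n - ?q n\<bar> \<le> ?v n + 1" if n: "n \<ge> 2" for n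
    proof -
      let ?h = "\<lambda>i. h (Xs (\<pi> n \<omega> i) \<omega>)"
      have "?q n = (\<Sum>i=1..n. (?h i)\<^sup>2)"
        using sum_rearranged[OF n \<open>\<omega> \<in> space N\<close>, of "\<lambda>i. (h (Xs i \<omega>))\<^sup>2"] by simp
      also have "\<dots> = (\<Sum>i=1..<n. (?h i)\<^sup>2) + (?h n)\<^sup>2"
        using n by (simp add: sum.last_plus add.commute)
      finally have "?p n - ?q n = (\<Sum>i=1..<n. ?h i * (?h (i + 1) - ?h i)) - (?h n)\<^sup>2"
        by (simp add: sum_subtractf right_diff_distrib power2_eq_square)
      moreover have "\<bar>\<Sum>i=1..<n. ?h i * (?h (i + 1) - ?h i)\<bar> \<le> ?v n"
        unfolding variation_def
        by (rule order_trans[OF sum_abs], rule sum_mono) (simp add: abs_mult h01 mult_left_le_one_le)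
      moreover have "0 \<le> (?h n)\<^sup>2" "(?h n)\<^sup>2 \<le> 1" by (simp_all add: h01 power_le_one)
      ultimately show ?thesis by linarith
    qed
    have "(\<lambda>n. ?p n / n - ?q n / n) \<longlonglongrightarrow> 0"
    proof (rule Lim_null_comparison)
      show "\<forall>\<^sub>F n in sequentially. norm (?p n / n - ?q n / n) \<le> ?v n / n + 1 / n"
        using eventually_ge_at_top[of 2]
      proof eventually_elim
        case (elim n)
        from divide_right_mono[OF diff[OF elim], of "real n"] show ?case
          by (simp add: diff_divide_distrib[symmetric] add_divide_distrib[symmetric])
      qed
      show "(\<lambda>n. ?v n / n + 1 / n) \<longlonglongrightarrow> 0"
        using tendsto_add[OF elim(1) lim_1_over_n] by simp
    qed
    from tendsto_add[OF this elim(3)] show ?case by simp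
  qed
qed

text \<open>
  For bits, \<open>\<bar>b - b'\<bar> = b + b' - 2 * b * b'\<close>. The linear part follows the strong law, up to the two end points of the
  rearrangement.
\<close>

lemma AE_variation_conditional:
  assumes "conditional_probability P A h"
  shows "AE \<omega> in N. (\<lambda>n. variation n (indicator A) \<omega> / n) \<longlonglongrightarrow> 2 * (measure P A - (\<integral>z. (h (fst z))\<^sup>2 \<partial>P))"
proof -
  interpret P: conditional_probability P A h by fact
  note [measurable] = P.A_sets
  have "AE \<omega> in N. (\<lambda>n. (\<Sum>i=1..n. indicat_real A (Xs i \<omega>, Ys i \<omega>)) / n) \<longlonglongrightarrow> measure P A"
  proof -
    have "AE \<omega> in N. (\<lambda>n. (\<Sum>i=1..n. indicat_real A (Xs i \<omega>, Ys i \<omega>)) / n) \<longlonglongrightarrow> (\<integral>z. indicat_real A z \<partial>P)"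
      by (rule strong_law_bounded[where C = 1]) (use P.A_sets in \<open>auto simp: indicator_def\<close>)
    then show ?thesis using P.A_sets P.sets_P by simp
  qed
  with AE_consecutive_products_centered[OF assms]
    AE_consecutive_products[OF P.h_measurable P.h_nonneg P.h_le_1] AE_space
  show ?thesis
  proof eventually_elim
    case (elim \<omega>)
    let ?b = "\<lambda>n i. indicat_real A (Xs (\<pi> n \<omega> i) \<omega>, Ys (\<pi> n \<omega> i) \<omega>)"
    let ?bb = "\<lambda>n. (\<Sum>i=1..<n. ?b n i * ?b n (i + 1))"
    let ?c = "\<lambda>n. (\<Sum>i=1..n. indicat_real A (Xs i \<omega>, Ys i \<omega>))"
    have bb: "(\<lambda>n. ?bb n / n) \<longlonglongrightarrow> (\<integral>z. (h (fst z))\<^sup>2 \<partial>P)"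
      using tendsto_add[OF elim(1,2)] by (simp add: add_divide_distrib[symmetric])
    have eq: "variation n (indicator A) \<omega> = 2 * ?c n - ?b n 1 - ?b n n - 2 * ?bb n" if n: "n \<ge> 2" for n
    proof -
      have "variation n (indicator A) \<omega> = (\<Sum>i=1..<n. (?b n i + ?b n (i + 1)) - 2 * (?b n i * ?b n (i + 1)))"
        unfolding variation_def by (intro sum.cong) (auto simp: indicator_def)
      also have "\<dots> = (2 * (\<Sum>i=1..n. ?b n i) - ?b n 1 - ?b n n) - 2 * ?bb n"
        using n sum_consecutive_eq[of n "?b n"] by (simp only: sum_subtractf sum_distrib_left[symmetric])
      also have "(\<Sum>i=1..n. ?b n i) = ?c n"
        by (rule sum_rearranged[OF n \<open>\<omega> \<in> space N\<close>])
      finally show ?thesis .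
    qed
    have small: "(\<lambda>n. (?b n 1 + ?b n n) / n) \<longlonglongrightarrow> 0"
    proof (rule Lim_null_comparison)
      show "\<forall>\<^sub>F n in sequentially. norm ((?b n 1 + ?b n n) / n) \<le> 2 * (1 / n)"
        by (intro always_eventually allI) (auto simp: indicator_def divide_simps)
      show "(\<lambda>n. 2 * (1 / real n)) \<longlonglongrightarrow> 0" using tendsto_mult[OF tendsto_const[of 2] lim_1_over_n] by simp
    qed
    have "(\<lambda>n. 2 * (?c n / n) - (?b n 1 + ?b n n) / n - 2 * (?bb n / n)) \<longlonglongrightarrow>
        2 * measure P A - 0 - 2 * (\<integral>z. (h (fst z))\<^sup>2 \<partial>P)"
      by (intro tendsto_intros elim small bb)
    then have "(\<lambda>n. 2 * (?c n / n) - (?b n 1 + ?b n n) / n - 2 * (?bb n / n)) \<longlonglongrightarrow>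
        2 * (measure P A - (\<integral>z. (h (fst z))\<^sup>2 \<partial>P))" by simp
    moreover have "\<forall>\<^sub>F n in sequentially. 2 * (?c n / n) - (?b n 1 + ?b n n) / n - 2 * (?bb n / n) = variation n (indicator A) \<omega> / n"
      using eventually_ge_at_top[of 2]
    proof eventually_elim
      case (elim n)
      show ?case unfolding eq[OF elim] by (simp add: add_divide_distrib diff_divide_distrib)
    qed
    ultimately show ?case by (rule Lim_transform_eventually)
  qed
qed

end

section \<open>Exceptional levels of a distribution on the line\<close>
lemma (in prob_space) AE_not_if_small_cover:
  assumes "\<And>d. d > 0 \<Longrightarrow> \<exists>S\<in>sets M. {x \<in> space M. Q x} \<subseteq> S \<and> prob S \<le> d"
  shows "AE x in M. \<not> Q x"
proof -
  have "\<forall>k. \<exists>S. S \<in> sets M \<and> {x \<in> space M. Q x} \<subseteq> S \<and> prob S \<le> inverse (real (Suc k))"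
    using assms by (simp add: Bex_def)
  then have "\<exists>S. \<forall>k. S k \<in> sets M \<and> {x \<in> space M. Q x} \<subseteq> S k \<and> prob (S k) \<le> inverse (real (Suc k))"
    by (rule choice)
  then obtain S where all: "\<forall>k. S k \<in> sets M \<and> {x \<in> space M. Q x} \<subseteq> S k \<and> prob (S k) \<le> inverse (real (Suc k))"
    by (rule exE)
  have S: "S k \<in> sets M" "{x \<in> space M. Q x} \<subseteq> S k" "prob (S k) \<le> inverse (real (Suc k))" for k
    using spec[OF all, of k] by simp_all
  have [measurable]: "(\<Inter>k. S k) \<in> sets M" using S(1) by (intro sets.countable_INT) auto
  have "prob (\<Inter>k. S k) \<le> inverse (real (Suc k))" for k
    using S(1,3) by (meson INT_lower UNIV_I finite_measure_mono order_trans)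
  then have "prob (\<Inter>k. S k) \<le> 0"
    by (intro LIMSEQ_le_const[OF LIMSEQ_inverse_real_of_nat]) auto
  then have "emeasure M (\<Inter>k. S k) = 0"
    by (simp add: emeasure_eq_measure measure_le_0_iff)
  moreover have "{x \<in> space M. \<not> \<not> Q x} \<subseteq> (\<Inter>k. S k)" using S(2) by blast
  ultimately show ?thesis by (intro AE_I) auto
qed

context cdf_distribution
begin

text \<open>
  A level \<open>t\<close> without mass in \<open>{t..}\<close> lies above every quantile, and little mass lies above the quantile for a
  probability near 1. If that quantile \<open>s\<close> itself has mass in \<open>{s..}\<close>, then \<open>t\<close> even lies strictly above it.
\<close>

lemma AE_upper_tail_pos: "AE t in M. measure M {t..} \<noteq> 0"
proof -
  have "AE t in M. \<not> (measure M {t..} = 0)"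
  proof (rule AE_not_if_small_cover)
    fix d :: real assume "d > 0"
    define p where "p = max (1 / 2) (1 - d)"
    have p: "0 < p" "p < 1" "1 - p \<le> d" using \<open>d > 0\<close> by (auto simp: p_def)
    then obtain s where s: "\<And>x. p \<le> cdf M x \<longleftrightarrow> s \<le> x" "measure M {..<s} \<le> p"
      using ex_quantile[OF p(1,2)] by blast
    have ge: "s \<le> t" if "measure M {t..} = 0" for t
    proof -
      have "measure M {..<t} = 1"
        using prob_compl[of "{t..}"] that by (simp add: Compl_eq_Diff_UNIV[symmetric])
      moreover have "measure M {..<t} \<le> cdf M t"
        unfolding cdf_def by (intro finite_measure_mono) auto
      ultimately show ?thesis using p(2) s(1)[of t] by simp
    qed
    show "\<exists>S\<in>sets M. {t \<in> space M. measure M {t..} = 0} \<subseteq> S \<and> measure M S \<le> d"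
    proof (cases "measure M {s..} = 0")
      case True
      then show ?thesis using ge \<open>d > 0\<close> by (intro bexI[of _ "{s..}"]) auto
    next
      case False
      have "measure M {s<..} = 1 - cdf M s"
        using prob_compl[of "{..s}"] by (simp add: cdf_def Compl_eq_Diff_UNIV[symmetric])
      also have "\<dots> \<le> d" using s(1)[of s] p(3) by simp
      finally have "measure M {s<..} \<le> d" .
      moreover have "{t \<in> space M. measure M {t..} = 0} \<subseteq> {s<..}"
        using ge False by (auto simp: less_le)
      ultimately show ?thesis by (intro bexI[of _ "{s<..}"]) auto
    qed
  qed
  then show ?thesis .
qed

text \<open>
  The points \<open>y > q\<close> in question lie below every quantile for a probability slightly larger than \<open>cdf M q\<close>, and
  little mass lies strictly between \<open>q\<close> and such a quantile.
\<close>

lemma AE_cdf_less: "AE y in M. \<not> (q < y \<and> measure M {q<..y} = 0)"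
proof (rule AE_not_if_small_cover)
  fix d :: real assume "d > 0"
  show "\<exists>S\<in>sets M. {y \<in> space M. q < y \<and> measure M {q<..y} = 0} \<subseteq> S \<and> measure M S \<le> d"
  proof (cases "cdf M q < 1")
    case True
    define p where "p = min (cdf M q + d) ((1 + cdf M q) / 2)"
    have p: "0 < p" "p < 1" "cdf M q < p" "p \<le> cdf M q + d"
      using True \<open>d > 0\<close> cdf_nonneg[of q] by (auto simp: p_def min_less_iff_disj)
    then obtain s where s: "\<And>x. p \<le> cdf M x \<longleftrightarrow> s \<le> x" "measure M {..<s} \<le> p"
      using ex_quantile[OF p(1,2)] by blast
    have qs: "q < s" using s(1)[of q] p(3) by simp
    have "{y \<in> space M. q < y \<and> measure M {q<..y} = 0} \<subseteq> {q<..<s}"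
    proof safe
      fix y assume y: "q < y" "measure M {q<..y} = 0"
      then have "cdf M y = cdf M q" using cdf_diff_eq[OF y(1)] by simp
      then show "y \<in> {q<..<s}" using s(1)[of y] p(3) y(1) by simp
    qed
    moreover have "measure M {q<..<s} \<le> d"
    proof -
      have "measure M {..<s} = cdf M q + measure M {q<..<s}"
        unfolding cdf_def using qs by (subst finite_measure_Union[symmetric]) (auto intro!: arg_cong[where f = "measure M"])
      then show ?thesis using s(2) p(4) by simp
    qed
    ultimately show ?thesis by (intro bexI[of _ "{q<..<s}"]) auto
  next
    case False
    then have "cdf M q = 1" using cdf_bounded_prob[of q] by simp
    moreover have "measure M {q<..} = 1 - cdf M q"
      using prob_compl[of "{..q}"] by (simp add: cdf_def Compl_eq_Diff_UNIV[symmetric])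
    ultimately show ?thesis using \<open>d > 0\<close> by (intro bexI[of _ "{q<..}"]) auto
  qed
qed

text \<open>
  Almost every level has no mass below it. Levels above a median \<open>s\<close> have mass at least 1/2 below them, so there is
  no mass above \<open>s\<close>, and \<open>s\<close> is an atom. Atoms satisfy every property that holds almost everywhere, so there is no mass below
  \<open>s\<close> either.
\<close>

lemma AE_eq_const_if_upper_tail_trivial:
  assumes "AE t in M. measure M {t..} = 0 \<or> measure M {t..} = 1"
  shows "\<exists>s. AE t in M. t = s"
proof -
  have tail: "measure M {..<t} = 1 - measure M {t..}" for t
    using prob_compl[of "{t..}"] by (simp add: Compl_eq_Diff_UNIV[symmetric])
  have good: "AE t in M. measure M {..<t} = 0"
    using assms AE_upper_tail_pos by eventually_elim (auto simp: tail)
  obtain s where s: "\<And>x. 1/2 \<le> cdf M x \<longleftrightarrow> s \<le> x" "measure M {..<s} \<le> 1/2"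
    using ex_quantile[of "1/2"] by auto
  have upper: "AE t in M. t \<le> s"
    using good
  proof eventually_elim
    case (elim t)
    show ?case
    proof (rule ccontr)
      assume "\<not> t \<le> s"
      then have "cdf M s \<le> measure M {..<t}" unfolding cdf_def by (intro finite_measure_mono) auto
      then show False using s(1)[of s] elim by simp
    qed
  qed
  have "measure M {s..} = measure M {s}"
    using upper by (intro finite_measure_eq_AE) auto
  then have "measure M {s} \<noteq> 0" using s(2) tail[of s] by simp
  then have atom: "\<not> (AE t in M. t \<notin> {s})" using prob_eq_0[of "{s}"] by simp
  have "measure M {..<s} = 0"
  proof (rule ccontr)
    assume nz: "measure M {..<s} \<noteq> 0"
    have "AE t in M. t \<notin> {s}" using good by eventually_elim (use nz in auto)
    with atom show False ..
  qed
  then have "AE t in M. t \<notin> {..<s}" using prob_eq_0[of "{..<s}"] by simp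
  with upper have "AE t in M. t = s" by eventually_elim auto
  then show ?thesis ..
qed

end

section \<open>Factorization and conditional probabilities\<close>

text \<open>
  A measurable function that recovers a number \<open>y\<close> from the countably many answers \<open>x \<in> B t\<close>, whenever the levels
  answered positively have supremum \<open>y\<close>. It serves twice: to factorize through a random variable, and to construct
  \<open>f\<close> with \<open>Y = f X\<close>.
\<close>

lemma countable_sup_selector:
  fixes T :: "real set" and B :: "real \<Rightarrow> 'a set"
  assumes "countable T" and [measurable]: "\<And>t. t \<in> T \<Longrightarrow> B t \<in> sets S"
  shows "\<exists>f\<in>borel_measurable S. \<forall>x\<in>space S. \<forall>y::real.
    (\<forall>t\<in>T. x \<in> B t \<longrightarrow> t \<le> y) \<and> (\<forall>e>0. \<exists>t\<in>T. x \<in> B t \<and> y - e < t) \<longrightarrow> f x = y"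
proof
  let ?g = "\<lambda>x. SUP t\<in>T. if x \<in> B t then ereal t else - \<infinity>"
  show "(\<lambda>x. real_of_ereal (?g x)) \<in> borel_measurable S"
  proof -
    have "?g \<in> borel_measurable S"
      by (rule borel_measurable_SUP[OF \<open>countable T\<close>]) measurable
    then show ?thesis by measurable
  qed
  show "\<forall>x\<in>space S. \<forall>y. (\<forall>t\<in>T. x \<in> B t \<longrightarrow> t \<le> y) \<and> (\<forall>e>0. \<exists>t\<in>T. x \<in> B t \<and> y - e < t) \<longrightarrow>
      real_of_ereal (?g x) = y"
  proof (intro ballI allI impI, elim conjE)
    fix x and y :: real assume le: "\<forall>t\<in>T. x \<in> B t \<longrightarrow> t \<le> y" and ex: "\<forall>e>0. \<exists>t\<in>T. x \<in> B t \<and> y - e < t"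
    have "?g x = ereal y"
    proof (rule antisym)
      show "?g x \<le> ereal y" using le by (intro SUP_least) auto
      show "ereal y \<le> ?g x"
      proof (rule ereal_le_epsilon2)
        fix e :: real assume "0 < e"
        with ex obtain t where t: "t \<in> T" "x \<in> B t" "y - e < t" by blast
        have "ereal t \<le> ?g x" using t by (intro SUP_upper2[OF t(1)]) simp
        then have "ereal t + ereal e \<le> ?g x + ereal e" by (rule add_right_mono)
        moreover have "ereal y \<le> ereal t + ereal e" using t(3) by simp
        ultimately show "ereal y \<le> ?g x + ereal e" by (rule order_trans[rotated])
      qed
    qed
    then show "real_of_ereal (?g x) = y" by simp
  qed
qed

text \<open>
  The Doob-Dynkin lemma for real functions. Each event \<open>{q < f}\<close> with rational \<open>q\<close> is a preimage under \<open>X\<close>, and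
  \<open>f\<close> is the supremum of the rational numbers below it.
\<close>

lemma borel_measurable_vimage_algebra_factor:
  fixes f :: "'a \<Rightarrow> real"
  assumes f: "f \<in> borel_measurable (vimage_algebra \<Omega> X S)" and X: "X \<in> \<Omega> \<rightarrow> space S"
  shows "\<exists>g\<in>borel_measurable S. \<forall>\<omega>\<in>\<Omega>. f \<omega> = g (X \<omega>)"
proof -
  have "\<exists>B\<in>sets S. {\<omega> \<in> \<Omega>. q < f \<omega>} = X -` B \<inter> \<Omega>" for q
  proof -
    have "{\<omega> \<in> space (vimage_algebra \<Omega> X S). q < f \<omega>} \<in> sets (vimage_algebra \<Omega> X S)"
      using f by measurable
    then show ?thesis unfolding sets_vimage_algebra2[OF X] by auto
  qed
  then obtain B where B: "\<And>q. B q \<in> sets S" "\<And>q. {\<omega> \<in> \<Omega>. q < f \<omega>} = X -` B q \<inter> \<Omega>" by metis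
  obtain g where g: "g \<in> borel_measurable S" "\<And>x y. x \<in> space S \<Longrightarrow>
    (\<forall>t\<in>\<rat>. x \<in> B t \<longrightarrow> t \<le> y) \<Longrightarrow> (\<forall>e>0. \<exists>t\<in>\<rat>. x \<in> B t \<and> y - e < t) \<Longrightarrow> g x = y"
    using countable_sup_selector[OF countable_rat, of B S] B(1) by blast
  have "f \<omega> = g (X \<omega>)" if "\<omega> \<in> \<Omega>" for \<omega>
  proof (rule g(2)[symmetric])
    have iff: "X \<omega> \<in> B q \<longleftrightarrow> q < f \<omega>" for q using B(2)[of q] that by blast
    show "X \<omega> \<in> space S" using X that by auto
    show "\<forall>t\<in>\<rat>. X \<omega> \<in> B t \<longrightarrow> t \<le> f \<omega>" by (simp add: iff)
    show "\<forall>e>0. \<exists>t\<in>\<rat>. X \<omega> \<in> B t \<and> f \<omega> - e < t"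
    proof (intro allI impI)
      fix e :: real assume "0 < e"
      then obtain t where "t \<in> \<rat>" "f \<omega> - e < t" "t < f \<omega>"
        using Rats_dense_in_real[of "f \<omega> - e" "f \<omega>"] by auto
      then show "\<exists>t\<in>\<rat>. X \<omega> \<in> B t \<and> f \<omega> - e < t" using iff by blast
    qed
  qed
  with g(1) show ?thesis by blast
qed

context conditional_probability
begin

lemma integral_mult_indicator:
  assumes q [measurable]: "q \<in> borel_measurable borel" and q01: "\<And>x. 0 \<le> q x" "\<And>x. q x \<le> (1::real)"
  shows "(\<integral>z. q (fst z) * indicator A z \<partial>P) = (\<integral>z. q (fst z) * h (fst z) \<partial>P)"
proof -
  have "(\<integral>\<^sup>+z. ennreal (q (fst z) * indicator A z) \<partial>P) = (\<integral>\<^sup>+z. ennreal (q (fst z)) * indicator A z \<partial>P)"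
    by (intro nn_integral_cong) (auto simp: indicator_def)
  also have "\<dots> = (\<integral>\<^sup>+z. ennreal (q (fst z)) * ennreal (h (fst z)) \<partial>P)"
    by (rule nn_integral_mult_indicator[of "\<lambda>x. ennreal (q x)"]) simp
  also have "\<dots> = (\<integral>\<^sup>+z. ennreal (q (fst z) * h (fst z)) \<partial>P)"
    by (simp add: ennreal_mult' q01)
  finally have "(\<integral>\<^sup>+z. ennreal (q (fst z) * indicator A z) \<partial>P) = (\<integral>\<^sup>+z. ennreal (q (fst z) * h (fst z)) \<partial>P)" .
  then show ?thesis
    by (simp add: integral_eq_nn_integral q01 h_nonneg)
qed

lemma integral_h: "(\<integral>z. h (fst z) \<partial>P) = prob A"
  using integral_mult_indicator[of "\<lambda>_. 1"] A_sets sets_P by simp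

lemma integrable_h_square: "integrable P (\<lambda>z. (h (fst z))\<^sup>2)"
  by (rule integrable_const_bound[where B = 1]) (auto simp: h_nonneg h_le_1 power_le_one)

lemma integral_square_le_prob: "(\<integral>z. (h (fst z))\<^sup>2 \<partial>P) \<le> prob A"
  unfolding integral_h[symmetric]
  by (intro integral_mono integrable_h integrable_h_square)
     (auto simp: power2_eq_square h_nonneg h_le_1 mult_left_le)

lemma variance_h: "(\<integral>z. (h (fst z) - prob A)\<^sup>2 \<partial>P) = (\<integral>z. (h (fst z))\<^sup>2 \<partial>P) - (prob A)\<^sup>2"
  using variance_eq[OF integrable_h integrable_h_square] by (simp add: integral_h)

lemma prob_square_le_integral_square: "(prob A)\<^sup>2 \<le> (\<integral>z. (h (fst z))\<^sup>2 \<partial>P)"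
proof -
  have "0 \<le> (\<integral>z. (h (fst z) - prob A)\<^sup>2 \<partial>P)" by simp
  then show ?thesis unfolding variance_h by simp
qed

lemma integrable_indicator_h: "integrable P (\<lambda>z. h (fst z) * indicator A z)"
  by (rule integrable_const_bound[where B = 1]) (auto simp: h_nonneg h_le_1 indicator_def)

lemma distance_from_indicator:
  "(\<integral>z. (indicator A z - h (fst z))\<^sup>2 \<partial>P) = prob A - (\<integral>z. (h (fst z))\<^sup>2 \<partial>P)"
proof -
  have "(\<integral>z. (indicator A z - h (fst z))\<^sup>2 \<partial>P) =
     (\<integral>z. indicator A z - 2 * (h (fst z) * indicator A z) + (h (fst z))\<^sup>2 \<partial>P)"
    by (intro Bochner_Integration.integral_cong) (auto simp: indicator_def power2_eq_square algebra_simps)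
  also have "\<dots> = (\<integral>z. indicat_real A z \<partial>P) - 2 * (\<integral>z. h (fst z) * indicator A z \<partial>P) + (\<integral>z. (h (fst z))\<^sup>2 \<partial>P)"
    using integrable_h_square integrable_indicator_h A_sets sets_P
    by (subst Bochner_Integration.integral_add Bochner_Integration.integral_diff; simp add: emeasure_eq_measure)+
  also have "(\<integral>z. h (fst z) * indicator A z \<partial>P) = (\<integral>z. (h (fst z))\<^sup>2 \<partial>P)"
    using integral_mult_indicator[OF h_measurable h_nonneg h_le_1] by (simp add: power2_eq_square)
  finally show ?thesis using A_sets sets_P by simp
qed

end

text \<open>
  With expectations \<open>E\<close>, \<open>E (h\<^sup>2) = E (h * 1\<^sub>A) \<le> E (h * 1\<^sub>A\<^sub>') = E (h * h') = E (h' * 1\<^sub>A) \<le> E (h' * 1\<^sub>A\<^sub>') = E (h'\<^sup>2)\<close>.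
  For \<open>A = A'\<close> this shows that the second moment is independent of the version; for tail events it makes
  the second moment monotone, hence measurable, in the level.
\<close>

lemma conditional_probability_square_mono:
  assumes "conditional_probability P A h" "conditional_probability P A' h'" "A \<subseteq> A'"
  shows "(\<integral>z. (h (fst z))\<^sup>2 \<partial>P) \<le> (\<integral>z. (h' (fst z))\<^sup>2 \<partial>P)"
proof -
  interpret A: conditional_probability P A h by fact
  interpret A': conditional_probability P A' h' by fact
  note [measurable] = A.A_sets A'.A_sets
  have int: "integrable P (\<lambda>z. q (fst z) * indicat_real B z)"
    if [measurable]: "q \<in> borel_measurable borel" "B \<in> sets (borel \<Otimes>\<^sub>M borel)"
      and q: "\<And>x. 0 \<le> q x" "\<And>x. q x \<le> 1" for q :: "real \<Rightarrow> real" and B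
    by (rule A.integrable_const_bound[where B = 1]) (auto simp: q indicator_def)
  have "(\<integral>z. (h (fst z))\<^sup>2 \<partial>P) = (\<integral>z. h (fst z) * indicator A z \<partial>P)"
    using A.integral_mult_indicator[OF A.h_measurable A.h_nonneg A.h_le_1] by (simp add: power2_eq_square)
  also have "\<dots> \<le> (\<integral>z. h (fst z) * indicator A' z \<partial>P)"
    using \<open>A \<subseteq> A'\<close> by (intro integral_mono int A.h_nonneg A.h_le_1) (auto simp: indicator_def A.h_nonneg)
  also have "\<dots> = (\<integral>z. h (fst z) * h' (fst z) \<partial>P)"
    by (rule A'.integral_mult_indicator[OF A.h_measurable A.h_nonneg A.h_le_1])
  also have "\<dots> = (\<integral>z. h' (fst z) * indicator A z \<partial>P)"
    using A.integral_mult_indicator[OF A'.h_measurable A'.h_nonneg A'.h_le_1] by (simp add: mult.commute)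
  also have "\<dots> \<le> (\<integral>z. h' (fst z) * indicator A' z \<partial>P)"
    using \<open>A \<subseteq> A'\<close> by (intro integral_mono int A'.h_nonneg A'.h_le_1) (auto simp: indicator_def A'.h_nonneg)
  also have "\<dots> = (\<integral>z. (h' (fst z))\<^sup>2 \<partial>P)"
    using A'.integral_mult_indicator[OF A'.h_measurable A'.h_nonneg A'.h_le_1] by (simp add: power2_eq_square)
  finally show ?thesis .
qed

section \<open>The limiting coefficient\<close>
lemma conditional_probability_square_unique:
  assumes "conditional_probability P A h" "conditional_probability P A h'"
  shows "(\<integral>z. (h (fst z))\<^sup>2 \<partial>P) = (\<integral>z. (h' (fst z))\<^sup>2 \<partial>P)"
  using conditional_probability_square_mono[OF assms] conditional_probability_square_mono[OF assms(2,1)]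
  by simp

locale conditional_tails = prob_space P for P :: "(real \<times> real) measure" +
  fixes h :: "real \<Rightarrow> real \<Rightarrow> real"
  assumes tails: "conditional_probability P {z. t \<le> snd z} (h t)"
begin

sublocale tail: conditional_probability P "{z. t \<le> snd z}" "h t" for t
  by (rule tails)

declare tail.sets_P [measurable_cong]

definition \<mu> :: "real measure" where "\<mu> = distr P borel snd"
definition G :: "real \<Rightarrow> real" where "G t = measure \<mu> {t..}"
definition H :: "real \<Rightarrow> real" where "H t = (\<integral>z. (h t (fst z))\<^sup>2 \<partial>P)"

lemma measurable_snd_P [measurable]: "snd \<in> P \<rightarrow>\<^sub>M (borel :: real measure)"
  and measurable_fst_P [measurable]: "fst \<in> P \<rightarrow>\<^sub>M (borel :: real measure)"
  by (simp_all add: measurable_cong_sets[OF tail.sets_P refl])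

sublocale \<mu>: cdf_distribution \<mu>
proof -
  interpret \<mu>: prob_space \<mu> unfolding \<mu>_def by (rule prob_space_distr) simp
  show "cdf_distribution \<mu>" by standard (simp add: \<mu>_def)
qed

lemma measure_\<mu>: "B \<in> sets borel \<Longrightarrow> measure \<mu> B = prob (snd -` B)"
  unfolding \<mu>_def using tail.space_P by (subst measure_distr) auto

lemma prob_tail: "prob {z. t \<le> snd z} = G t"
  by (simp add: G_def measure_\<mu> vimage_def)

lemma G_bounds: "0 \<le> G t" "G t \<le> 1"
  by (simp_all add: G_def)

lemma H_bounds: "(G t)\<^sup>2 \<le> H t" "H t \<le> G t"
  unfolding H_def prob_tail[symmetric]
  by (rule tail.prob_square_le_integral_square, rule tail.integral_square_le_prob)

lemma H_nonneg: "0 \<le> H t" and H_le_1: "H t \<le> 1"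
  using H_bounds[of t] G_bounds[of t] by (auto intro: order_trans[OF zero_le_power2])

lemma borel_measurable_G [measurable]: "G \<in> borel_measurable borel"
proof -
  have "mono (\<lambda>t. - G t)"
    by (auto simp: mono_def G_def intro!: \<mu>.finite_measure_mono)
  from borel_measurable_uminus[OF borel_measurable_mono[OF this]] show ?thesis by simp
qed

lemma borel_measurable_H [measurable]: "H \<in> borel_measurable borel"
proof -
  have "mono (\<lambda>t. - H t)"
    by (auto simp: mono_def H_def intro!: conditional_probability_square_mono[OF tails tails])
  from borel_measurable_uminus[OF borel_measurable_mono[OF this]] show ?thesis by simp
qed

lemma borel_measurable_\<mu>: "borel_measurable \<mu> = borel_measurable borel"
  by (intro measurable_cong_sets) auto

lemma integrable_bounded: "f \<in> borel_measurable borel \<Longrightarrow> (\<And>t. 0 \<le> f t) \<Longrightarrow> (\<And>t. f t \<le> 1) \<Longrightarrow> integrable \<mu> f"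
  for f :: "real \<Rightarrow> real"
  by (rule \<mu>.integrable_const_bound[where B = 1]) (simp_all add: borel_measurable_\<mu>)

lemma integrable_G: "integrable \<mu> G"
  by (rule integrable_bounded[OF borel_measurable_G G_bounds])

lemma integrable_H: "integrable \<mu> H"
  by (rule integrable_bounded[OF borel_measurable_H H_nonneg H_le_1])

lemma integrable_G2: "integrable \<mu> (\<lambda>t. (G t)\<^sup>2)"
  by (rule integrable_bounded) (simp_all add: G_bounds power_le_one)

text \<open>
  Since \<open>h t\<close> has mean \<open>G t\<close>, the first integrand is the variance of \<open>h t\<close>; the second is the variance of
  the indicator of the tail event.
\<close>

definition numerator :: real where "numerator = (\<integral>t. H t - (G t)\<^sup>2 \<partial>\<mu>)"
definition denominator :: real where "denominator = (\<integral>t. G t * (1 - G t) \<partial>\<mu>)"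

lemma denominator_eq: "denominator = (\<integral>t. G t - (G t)\<^sup>2 \<partial>\<mu>)"
  by (simp add: denominator_def power2_eq_square algebra_simps)

lemma denominator_minus_numerator: "denominator - numerator = (\<integral>t. G t - H t \<partial>\<mu>)"
  unfolding denominator_eq numerator_def
  using integrable_G integrable_H integrable_G2 by simp

lemma numerator_nonneg: "0 \<le> numerator"
  unfolding numerator_def by (rule integral_nonneg_AE) (simp add: H_bounds)

lemma numerator_le_denominator: "numerator \<le> denominator"
proof -
  have "0 \<le> (\<integral>t. G t - H t \<partial>\<mu>)" by (rule integral_nonneg_AE) (simp add: H_bounds)
  then show ?thesis using denominator_minus_numerator by simp
qed

lemma numerator_eq_0_iff: "numerator = 0 \<longleftrightarrow> (AE t in \<mu>. H t = (G t)\<^sup>2)"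
  unfolding numerator_def
  using integrable_H integrable_G2
  by (subst integral_nonneg_eq_0_iff_AE) (auto simp: H_bounds)

lemma numerator_eq_denominator_iff: "numerator = denominator \<longleftrightarrow> (AE t in \<mu>. H t = G t)"
proof -
  have "numerator = denominator \<longleftrightarrow> (\<integral>t. G t - H t \<partial>\<mu>) = 0"
    unfolding denominator_minus_numerator[symmetric] by auto
  also have "\<dots> \<longleftrightarrow> (AE t in \<mu>. G t - H t = 0)"
    using integrable_H integrable_G by (subst integral_nonneg_eq_0_iff_AE) (auto simp: H_bounds)
  also have "\<dots> \<longleftrightarrow> (AE t in \<mu>. H t = G t)"
    by (intro arg_cong[where f = "\<lambda>Q. AE t in \<mu>. Q t"] ext) auto
  finally show ?thesis .
qed

lemma denominator_pos:
  assumes "\<not> (\<exists>s. AE t in \<mu>. t = s)"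
  shows "0 < denominator"
proof -
  have nn: "0 \<le> G t * (1 - G t)" for t using G_bounds[of t] by simp
  have int: "integrable \<mu> (\<lambda>t. G t * (1 - G t))"
    using integrable_G integrable_G2 by (simp add: right_diff_distrib power2_eq_square)
  have "denominator \<noteq> 0"
  proof
    assume "denominator = 0"
    then have "AE t in \<mu>. G t * (1 - G t) = 0"
      unfolding denominator_def using int nn by (subst (asm) integral_nonneg_eq_0_iff_AE) auto
    then have "AE t in \<mu>. measure \<mu> {t..} = 0 \<or> measure \<mu> {t..} = 1"
      by eventually_elim (auto simp: G_def)
    with assms \<mu>.AE_eq_const_if_upper_tail_trivial show False by blast
  qed
  moreover have "0 \<le> denominator"
    unfolding denominator_def by (rule integral_nonneg_AE) (simp add: nn)
  ultimately show ?thesis by simp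
qed

lemma ex_in_positive_measure:
  assumes "B \<in> sets borel" "measure \<mu> B \<noteq> 0" "AE t in \<mu>. Q t"
  shows "\<exists>t. t \<in> B \<and> Q t"
proof (rule ccontr)
  assume "\<not> ?thesis"
  with assms(3) have "AE t in \<mu>. t \<notin> B" by (auto elim!: eventually_mono)
  then show False using assms(1,2) \<mu>.prob_eq_0[of B] by simp
qed

lemma sets_fst_vimage: "C \<in> sets borel \<Longrightarrow> fst -` C \<in> sets P"
  using measurable_sets[OF measurable_fst_P, of C] by (simp add: tail.space_P)

lemma sets_snd_vimage: "C \<in> sets borel \<Longrightarrow> snd -` C \<in> sets P"
  using measurable_sets[OF measurable_snd_P, of C] by (simp add: tail.space_P)

text \<open>
  If the numerator vanishes, then \<open>h t = G t\<close> almost surely for almost every \<open>t\<close>, and the product formula holds at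
  these good levels. For an arbitrary \<open>t\<close> with \<open>G t > 0\<close>, let \<open>s\<close> be a quantile for a probability slightly larger
  than the mass below \<open>t\<close>. The interval \<open>{t..s}\<close> has positive mass, hence contains a good level \<open>u\<close>, while \<open>{t..<u}\<close>
  has little mass, so that both sides of the formula hardly change between \<open>t\<close> and \<open>u\<close>.
\<close>

lemma numerator_eq_0_iff_indep:
  "numerator = 0 \<longleftrightarrow> (\<forall>C\<in>sets borel. \<forall>t. prob ({z. t \<le> snd z} \<inter> fst -` C) = prob (fst -` C) * G t)"
    (is "_ \<longleftrightarrow> ?indep")
proof
  assume ?indep
  have "H t = (G t)\<^sup>2" for t
  proof -
    have "conditional_probability P {z. t \<le> snd z} (\<lambda>_. G t)"
    proof
      fix C :: "real set" assume C: "C \<in> sets borel"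
      note [measurable] = C
      have "(\<integral>z. indicator C (fst z) * G t \<partial>P) = (\<integral>z. indicat_real (fst -` C) z \<partial>P) * G t"
        by (simp add: indicator_vimage)
      also have "\<dots> = prob (fst -` C) * G t" using sets_fst_vimage[OF C] by simp
      finally have eq: "(\<integral>z. indicator C (fst z) * G t \<partial>P) = prob (fst -` C) * G t" .
      show "prob ({z. t \<le> snd z} \<inter> fst -` C) = (\<integral>z. indicator C (fst z) * G t \<partial>P)"
        unfolding eq using \<open>?indep\<close> C by blast
    qed (auto simp: G_bounds tail.sets_P tail.A_sets)
    from conditional_probability_square_unique[OF tails this] show ?thesis using prob_space by (simp add: H_def)
  qed
  then show "numerator = 0" by (simp add: numerator_def)
next
  assume "numerator = 0"
  then have good: "AE t in \<mu>. H t = (G t)\<^sup>2" by (simp add: numerator_eq_0_iff)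
  have indep_good: "prob ({z. t \<le> snd z} \<inter> fst -` C) = prob (fst -` C) * G t"
    if t: "H t = (G t)\<^sup>2" and C: "C \<in> sets borel" for t C
  proof -
    have "(\<integral>z. (h t (fst z) - G t)\<^sup>2 \<partial>P) = 0"
      using tail.variance_h[of t] t by (simp add: prob_tail H_def)
    moreover have "integrable P (\<lambda>z. (h t (fst z) - G t)\<^sup>2)"
    proof (rule integrable_const_bound[where B = 1])
      have "\<bar>h t x - G t\<bar> \<le> 1" for x
        using G_bounds[of t] tail.h_nonneg[of t x] tail.h_le_1[of t x] by auto
      then show "AE z in P. norm ((h t (fst z) - G t)\<^sup>2) \<le> 1"
        by (simp add: abs_square_le_1)
    qed simp
    ultimately have "AE z in P. (h t (fst z) - G t)\<^sup>2 = 0"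
      by (subst (asm) integral_nonneg_eq_0_iff_AE) auto
    then have "AE z in P. h t (fst z) = G t" by eventually_elim simp
    note [measurable] = C
    have "prob ({z. t \<le> snd z} \<inter> fst -` C) = (\<integral>z. indicator C (fst z) * h t (fst z) \<partial>P)"
      by (rule tail.prob_Int[OF C])
    also have "\<dots> = (\<integral>z. indicat_real (fst -` C) z * G t \<partial>P)"
    proof (rule integral_cong_AE)
      show "AE z in P. indicator C (fst z) * h t (fst z) = indicat_real (fst -` C) z * G t"
        using \<open>AE z in P. h t (fst z) = G t\<close> by eventually_elim (simp add: indicator_vimage)
      show "(\<lambda>z. indicat_real (fst -` C) z * G t) \<in> borel_measurable P"
        using sets_fst_vimage[OF C] by simp
    qed simp
    also have "\<dots> = prob (fst -` C) * G t" using sets_fst_vimage[OF C] by simp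
    finally show ?thesis .
  qed
  show ?indep
  proof (intro ballI allI)
    fix C :: "real set" and t assume C: "C \<in> sets borel"
    let ?D = "\<lambda>t. prob ({z. t \<le> snd z} \<inter> fst -` C) - prob (fst -` C) * G t"
    have tail_sets: "{z. t \<le> snd z} \<inter> fst -` C \<in> sets P" for t
      using sets_fst_vimage[OF C] tail.A_sets by (simp add: tail.sets_P)
    have diff: "\<bar>?D t - ?D s\<bar> \<le> 2 * measure \<mu> {t..<s}" if "t \<le> s" for s
    proof -
      have "prob ({z. t \<le> snd z} \<inter> fst -` C) - prob ({z. s \<le> snd z} \<inter> fst -` C) \<le> measure \<mu> {t..<s}"
      proof -
        have "prob ({z. t \<le> snd z} \<inter> fst -` C) - prob ({z. s \<le> snd z} \<inter> fst -` C)
          = prob (({z. t \<le> snd z} \<inter> fst -` C) - ({z. s \<le> snd z} \<inter> fst -` C))"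
          using \<open>t \<le> s\<close> by (intro finite_measure_Diff[OF tail_sets tail_sets, symmetric]) auto
        also have "\<dots> \<le> prob (snd -` {t..<s})"
          using sets_snd_vimage[of "{t..<s}"] by (intro finite_measure_mono) auto
        finally show ?thesis by (simp add: measure_\<mu>)
      qed
      moreover have "prob ({z. s \<le> snd z} \<inter> fst -` C) \<le> prob ({z. t \<le> snd z} \<inter> fst -` C)"
        using \<open>t \<le> s\<close> by (intro finite_measure_mono[OF _ tail_sets]) auto
      moreover have "G t - G s = measure \<mu> {t..<s}"
      proof -
        have "G t - G s = measure \<mu> ({t..} - {s..})"
          unfolding G_def using \<open>t \<le> s\<close> by (intro \<mu>.finite_measure_Diff[symmetric]) auto
        also have "{t..} - {s..} = {t..<s}" by auto
        finally show ?thesis .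
      qed
      moreover have "0 \<le> prob (fst -` C) * (G t - G s)" "prob (fst -` C) * (G t - G s) \<le> G t - G s"
        using \<open>G t - G s = measure \<mu> {t..<s}\<close> by (simp_all add: mult_left_le_one_le)
      moreover have "prob (fst -` C) * (G t - G s) = prob (fst -` C) * G t - prob (fst -` C) * G s"
        by (rule right_diff_distrib)
      moreover have "0 \<le> measure \<mu> {t..<s}" by simp
      ultimately show ?thesis unfolding abs_le_iff by linarith
    qed
    have "\<bar>?D t\<bar> \<le> 2 * e" if "e > 0" for e
    proof (cases "G t = 0")
      case True
      have "prob ({z. t \<le> snd z} \<inter> fst -` C) \<le> prob {z. t \<le> snd z}"
        using tail.A_sets tail.sets_P by (intro finite_measure_mono) auto
      then show ?thesis using True that by (simp add: prob_tail measure_le_0_iff)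
    next
      case False
      define m where "m = measure \<mu> {..<t}"
      have mG: "m + G t = 1"
        using \<mu>.prob_compl[of "{t..}"] by (simp add: m_def G_def Compl_eq_Diff_UNIV[symmetric])
      define d where "d = min e (G t / 2)"
      have d: "d > 0" "d \<le> e" "m + d < 1" "m + d > 0"
      proof -
        have "0 < G t" "0 \<le> m" using False G_bounds(1)[of t] by (simp_all add: m_def less_le)
        then show "d > 0" "d \<le> e" "m + d < 1" "m + d > 0"
          using that mG by (auto simp: d_def min_less_iff_disj intro: add_nonneg_pos)
      qed
      then obtain s where s: "\<And>x. m + d \<le> cdf \<mu> x \<longleftrightarrow> s \<le> x" "measure \<mu> {..<s} \<le> m + d"
        using \<mu>.ex_quantile[of "m + d"] by blast
      have "t \<le> s"
      proof (rule ccontr)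
        assume "\<not> t \<le> s"
        then have "cdf \<mu> s \<le> m" unfolding m_def cdf_def by (intro \<mu>.finite_measure_mono) auto
        then show False using s(1)[of s] d(1) by simp
      qed
      have "measure \<mu> {t..s} = cdf \<mu> s - m"
      proof -
        have "measure \<mu> {t..s} = measure \<mu> ({..s} - {..<t})"
          by (rule arg_cong[where f = "measure \<mu>"]) auto
        also have "\<dots> = cdf \<mu> s - m"
          unfolding cdf_def m_def using \<open>t \<le> s\<close> by (intro \<mu>.finite_measure_Diff) auto
        finally show ?thesis .
      qed
      also have "\<dots> > 0" using s(1)[of s] d(1) by simp
      finally obtain u where u: "u \<in> {t..s}" "H u = (G u)\<^sup>2"
        using ex_in_positive_measure[OF _ _ good, of "{t..s}"] by (metis atLeastAtMost_borel less_irrefl)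
      have "measure \<mu> {t..<u} \<le> measure \<mu> ({..<s} - {..<t})"
        using u(1) by (intro \<mu>.finite_measure_mono) auto
      also have "\<dots> = measure \<mu> {..<s} - m"
        unfolding m_def using \<open>t \<le> s\<close> by (intro \<mu>.finite_measure_Diff) auto
      also have "\<dots> \<le> e" using s(2) d(2) by simp
      finally have "measure \<mu> {t..<u} \<le> e" .
      moreover have "?D u = 0" using indep_good[OF u(2) C] by simp
      ultimately show ?thesis using diff[of u] u(1) by simp
    qed
    then have "\<bar>?D t\<bar> \<le> 0 + e" if "e > 0" for e
      using that by (metis add_0 field_sum_of_halves half_gt_zero mult_2)
    then have "\<bar>?D t\<bar> \<le> 0" by (rule field_le_epsilon)
    then show "prob ({z. t \<le> snd z} \<inter> fst -` C) = prob (fst -` C) * G t" by simp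
  qed
qed

text \<open>
  Take all atoms, and a good level from every rational interval \<open>{a<..b}\<close> of positive mass. By \<open>AE_cdf_less\<close>
  almost every \<open>y\<close> has mass in each interval ending at \<open>y\<close>; if \<open>y\<close> is not an atom, then a rational \<open>b < y\<close> already
  captures some of this mass.
\<close>

lemma ex_countable_dense_good_levels:
  assumes "AE t in \<mu>. Q t"
  shows "\<exists>T. countable T \<and> (\<forall>t\<in>T. Q t) \<and> (AE y in \<mu>. \<forall>e>0. \<exists>t\<in>T. t \<le> y \<and> y - e < t)"
proof -
  define R where "R = {(a, b) \<in> \<rat> \<times> \<rat>. measure \<mu> {a<..b} \<noteq> 0}"
  have "countable R"
    unfolding R_def by (rule countable_subset[OF _ countable_SIGMA[OF countable_rat countable_rat]]) auto
  have "\<forall>p\<in>R. \<exists>t. t \<in> {fst p<..snd p} \<and> Q t"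
  proof
    fix p assume "p \<in> R"
    then have "measure \<mu> {fst p<..snd p} \<noteq> 0" by (auto simp: R_def)
    then show "\<exists>t. t \<in> {fst p<..snd p} \<and> Q t"
      using assms by (intro ex_in_positive_measure) auto
  qed
  then obtain sel where sel: "\<And>p. p \<in> R \<Longrightarrow> sel p \<in> {fst p<..snd p}" "\<And>p. p \<in> R \<Longrightarrow> Q (sel p)"
    by metis
  define Atoms where "Atoms = {x. measure \<mu> {x} > 0}"
  have "countable Atoms" unfolding Atoms_def by (rule \<mu>.countable_atoms)
  have "Q x" if "x \<in> Atoms" for x
    using ex_in_positive_measure[of "{x}" Q] assms that by (auto simp: Atoms_def)
  moreover have "AE y in \<mu>. \<forall>e>0. \<exists>t\<in>Atoms \<union> sel ` R. t \<le> y \<and> y - e < t"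
  proof -
    have "AE y in \<mu>. \<forall>q\<in>\<rat>. \<not> (q < y \<and> measure \<mu> {q<..y} = 0)"
      unfolding AE_ball_countable[OF countable_rat] by (intro ballI \<mu>.AE_cdf_less)
    then show ?thesis
    proof eventually_elim
      case (elim y)
      show ?case
      proof (cases "y \<in> Atoms")
        case True
        then show ?thesis by (intro allI impI bexI[of _ y]) auto
      next
        case False
        show ?thesis
        proof (intro allI impI)
          fix e :: real assume "e > 0"
          then obtain a where a: "a \<in> \<rat>" "y - e < a" "a < y"
            using Rats_dense_in_real[of "y - e" y] by auto
          then have pos: "measure \<mu> {a<..y} \<noteq> 0" using elim by blast
          have "\<mu>.C y = measure \<mu> {..<y}"
          proof -
            have "\<mu>.C y = measure \<mu> {..<y} + measure \<mu> {y}"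
              unfolding cdf_def by (subst \<mu>.finite_measure_Union[symmetric]) (auto intro!: arg_cong[where f = "measure \<mu>"])
            then show ?thesis using False by (simp add: Atoms_def zero_less_measure_iff)
          qed
          then have "(\<mu>.C \<longlongrightarrow> \<mu>.C y) (at_left y)" using \<mu>.cdf_at_left[of y] by simp
          moreover have "\<mu>.C a < \<mu>.C y"
            using pos \<mu>.cdf_diff_eq[OF a(3)] measure_nonneg[of \<mu> "{a<..y}"] by linarith
          ultimately have "\<forall>\<^sub>F b in at_left y. \<mu>.C a < \<mu>.C b" by (rule order_tendstoD(1))
          then obtain b0 where b0: "b0 < y" "\<And>b. b0 < b \<Longrightarrow> b < y \<Longrightarrow> \<mu>.C a < \<mu>.C b"
            using eventually_at_left[of a y] a(3) by auto
          obtain b where b: "b \<in> \<rat>" "max a b0 < b" "b < y"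
            using Rats_dense_in_real[of "max a b0" y] a(3) b0(1) by auto
          then have "(a, b) \<in> R"
            using a(1) b0(2)[of b] \<mu>.cdf_diff_eq[of a b] by (simp add: R_def)
          with sel(1)[of "(a, b)"] a b have "sel (a, b) \<le> y \<and> y - e < sel (a, b)" by auto
          then show "\<exists>t\<in>Atoms \<union> sel ` R. t \<le> y \<and> y - e < t" using \<open>(a, b) \<in> R\<close> by blast
        qed
      qed
    qed
  qed
  ultimately show ?thesis
    using \<open>countable Atoms\<close> \<open>countable R\<close> sel(2)
    by (intro exI[of _ "Atoms \<union> sel ` R"]) auto
qed

text \<open>
  \<open>H t = G t\<close> says that the mean square distance of \<open>h t\<close> from the indicator of the tail event is 0. Hence,
  simultaneously for countably many good levels \<open>t\<close>, the first coordinate decides whether the second is at least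
  \<open>t\<close>, and the supremum of the positively decided levels is the second coordinate.
\<close>

lemma numerator_eq_denominator_iff_function:
  "numerator = denominator \<longleftrightarrow> (\<exists>f\<in>borel_measurable borel. AE z in P. snd z = f (fst z))"
proof
  assume "\<exists>f\<in>borel_measurable borel. AE z in P. snd z = f (fst z)"
  then obtain f where f [measurable]: "f \<in> borel_measurable borel" and eq: "AE z in P. snd z = f (fst z)" by blast
  have "H t = G t" for t
  proof -
    have AE_ind: "AE z in P. indicat_real {x. t \<le> f x} (fst z) = indicator {z. t \<le> snd z} z"
      using eq by eventually_elim (simp add: indicator_def)
    have "conditional_probability P {z. t \<le> snd z} (\<lambda>x. indicator {x. t \<le> f x} x)"
    proof
      fix C :: "real set" assume C [measurable]: "C \<in> sets borel"
      have "(\<integral>z. indicator C (fst z) * indicat_real {x. t \<le> f x} (fst z) \<partial>P) =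
          (\<integral>z. indicat_real ({z. t \<le> snd z} \<inter> fst -` C) z \<partial>P)"
      proof (rule integral_cong_AE)
        show "AE z in P. indicator C (fst z) * indicat_real {x. t \<le> f x} (fst z) =
            indicat_real ({z. t \<le> snd z} \<inter> fst -` C) z"
          using AE_ind by eventually_elim (auto simp: indicator_def)
        show "indicat_real ({z. t \<le> snd z} \<inter> fst -` C) \<in> borel_measurable P"
          using tail.A_sets[of t] sets_fst_vimage[OF C] by (simp add: tail.sets_P)
      qed measurable
      also have "\<dots> = prob ({z. t \<le> snd z} \<inter> fst -` C)"
        using tail.A_sets sets_fst_vimage[OF C] by (simp add: tail.sets_P)
      finally show "prob ({z. t \<le> snd z} \<inter> fst -` C) =
        (\<integral>z. indicator C (fst z) * indicat_real {x. t \<le> f x} (fst z) \<partial>P)" ..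
    qed (auto simp: tail.sets_P tail.A_sets)
    from conditional_probability_square_unique[OF tails this]
    have "H t = (\<integral>z. (indicat_real {x. t \<le> f x} (fst z))\<^sup>2 \<partial>P)" by (simp add: H_def)
    also have "\<dots> = (\<integral>z. indicat_real {z. t \<le> snd z} z \<partial>P)"
    proof (rule integral_cong_AE)
      show "AE z in P. (indicat_real {x. t \<le> f x} (fst z))\<^sup>2 = indicat_real {z. t \<le> snd z} z"
        using AE_ind by eventually_elim (auto simp: indicator_def)
      show "indicat_real {z. t \<le> snd z} \<in> borel_measurable P"
        using tail.A_sets[of t] by (simp add: tail.sets_P)
    qed measurable
    also have "\<dots> = G t" using tail.A_sets[of t] by (simp add: tail.sets_P prob_tail)
    finally show ?thesis .
  qed
  then show "numerator = denominator" by (simp add: numerator_eq_denominator_iff)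
next
  assume "numerator = denominator"
  then have "AE t in \<mu>. H t = G t" by (simp add: numerator_eq_denominator_iff)
  from ex_countable_dense_good_levels[OF this] obtain T where T: "countable T" "\<And>t. t \<in> T \<Longrightarrow> H t = G t"
    and dense: "AE y in \<mu>. \<forall>e>0. \<exists>t\<in>T. t \<le> y \<and> y - e < t"
    by blast
  have level: "AE z in P. indicator {z. t \<le> snd z} z = h t (fst z)" if "t \<in> T" for t
  proof -
    have [measurable]: "{z. t \<le> snd z} \<in> sets P" using tail.A_sets[of t] by (simp add: tail.sets_P)
    have "(\<integral>z. (indicator {z. t \<le> snd z} z - h t (fst z))\<^sup>2 \<partial>P) = 0"
      using tail.distance_from_indicator[of t] T(2)[OF that] by (simp add: H_def prob_tail)
    moreover have "integrable P (\<lambda>z. (indicator {z. t \<le> snd z} z - h t (fst z))\<^sup>2)"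
    proof (rule integrable_const_bound[where B = 1])
      have "\<bar>indicator {z. t \<le> snd z} z - h t (fst z)\<bar> \<le> 1" for z
        using tail.h_nonneg[of t "fst z"] tail.h_le_1[of t "fst z"] by (auto simp: indicator_def)
      then show "AE z in P. norm ((indicator {z. t \<le> snd z} z - h t (fst z))\<^sup>2) \<le> 1"
        by (simp add: abs_square_le_1)
    qed simp
    ultimately have "AE z in P. (indicator {z. t \<le> snd z} z - h t (fst z))\<^sup>2 = 0"
      by (subst (asm) integral_nonneg_eq_0_iff_AE) auto
    then show ?thesis by eventually_elim simp
  qed
  then have levels: "AE z in P. \<forall>t\<in>T. indicator {z. t \<le> snd z} z = h t (fst z)"
    unfolding AE_ball_countable[OF T(1)] by blast
  define B where "B t = {x. h t x = 1}" for t
  have B: "B t \<in> sets borel" for t unfolding B_def by measurable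
  have "\<exists>f\<in>borel_measurable borel. \<forall>x\<in>space borel. \<forall>y::real.
      (\<forall>t\<in>T. x \<in> B t \<longrightarrow> t \<le> y) \<and> (\<forall>e>0. \<exists>t\<in>T. x \<in> B t \<and> y - e < t) \<longrightarrow> f x = y"
    using countable_sup_selector[OF T(1), where B = B and S = borel] B by simp
  then obtain f where f: "f \<in> borel_measurable borel"
    and sup: "\<forall>x\<in>space borel. \<forall>y::real.
      (\<forall>t\<in>T. x \<in> B t \<longrightarrow> t \<le> y) \<and> (\<forall>e>0. \<exists>t\<in>T. x \<in> B t \<and> y - e < t) \<longrightarrow> f x = y"
    by (rule bexE)
  have "AE z in P. \<forall>e>0. \<exists>t\<in>T. t \<le> snd z \<and> snd z - e < t"
    using dense unfolding \<mu>_def by (rule AE_distrD[OF measurable_snd_P])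
  with levels have "AE z in P. snd z = f (fst z)"
  proof eventually_elim
    case (elim z)
    have iff: "fst z \<in> B t \<longleftrightarrow> t \<le> snd z" if "t \<in> T" for t
    proof -
      have "indicator {z. t \<le> snd z} z = h t (fst z)" using elim(1) that by blast
      then show ?thesis by (cases "t \<le> snd z") (simp_all add: B_def)
    qed
    have "\<forall>t\<in>T. fst z \<in> B t \<longrightarrow> t \<le> snd z" using iff by blast
    moreover have "\<forall>e>0. \<exists>t\<in>T. fst z \<in> B t \<and> snd z - e < t" using iff elim(2) by blast
    ultimately have "f (fst z) = snd z" using sup by simp
    then show ?case ..
  qed
  with f show "\<exists>f\<in>borel_measurable borel. AE z in P. snd z = f (fst z)" by blast
qed

end

section \<open>Convergence of the coefficient\<close>

lemma (in cdf_distribution) abs_cdf_diff_eq_integral: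
  "\<bar>cdf M y' - cdf M y\<bar> = (\<integral>t. \<bar>indicat_real {..y'} t - indicator {..y} t\<bar> \<partial>M)"
proof -
  have "\<bar>indicat_real {..y'} t - indicator {..y} t\<bar> = indicator {min y y'<..max y y'} t" for t
    by (auto simp: indicator_def min_def max_def)
  then have "(\<integral>t. \<bar>indicat_real {..y'} t - indicator {..y} t\<bar> \<partial>M) = measure M {min y y'<..max y y'}"
    by simp
  also have "\<dots> = \<bar>cdf M y' - cdf M y\<bar>"
    using cdf_diff_eq[of y y'] cdf_diff_eq[of y' y] cdf_nondecreasing[of y y'] cdf_nondecreasing[of y' y]
    by (cases y y' rule: linorder_cases) (auto simp: min_def max_def)
  finally show ?thesis ..
qed

text \<open>
  Fubini's theorem for null sets; the set of convergence is measurable because it is the zero set of a limit superior.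
\<close>

lemma (in pair_sigma_finite) AE_tendsto_commute:
  fixes v :: "nat \<Rightarrow> 'a \<Rightarrow> 'b \<Rightarrow> real"
  assumes v [measurable]: "\<And>n. (\<lambda>(x, y). v n x y) \<in> borel_measurable (M1 \<Otimes>\<^sub>M M2)"
    and D [measurable]: "D \<in> borel_measurable M1"
    and lim: "\<And>x. AE y in M2. (\<lambda>n. v n x y) \<longlonglongrightarrow> D x"
  shows "AE y in M2. AE x in M1. (\<lambda>n. v n x y) \<longlonglongrightarrow> D x"
proof -
  define L where "L z = limsup (\<lambda>n. ennreal \<bar>v n (fst z) (snd z) - D (fst z)\<bar>)" for z
  have [measurable]: "(\<lambda>z. v n (fst z) (snd z)) \<in> borel_measurable (M1 \<Otimes>\<^sub>M M2)" for n
    using v[of n] by (simp add: split_beta')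
  have L [measurable]: "L \<in> borel_measurable (M1 \<Otimes>\<^sub>M M2)"
    unfolding L_def by measurable
  have iff: "(\<lambda>n. v n (fst z) (snd z)) \<longlonglongrightarrow> D (fst z) \<longleftrightarrow> L z = 0" for z
  proof -
    have "(\<lambda>n. v n (fst z) (snd z)) \<longlonglongrightarrow> D (fst z) \<longleftrightarrow> (\<lambda>n. \<bar>v n (fst z) (snd z) - D (fst z)\<bar>) \<longlonglongrightarrow> 0"
      by (simp add: LIM_zero_iff tendsto_rabs_zero_iff)
    also have "\<dots> \<longleftrightarrow> (\<lambda>n. ennreal \<bar>v n (fst z) (snd z) - D (fst z)\<bar>) \<longlonglongrightarrow> 0"
      using tendsto_ennreal_iff[of "\<lambda>n. \<bar>v n (fst z) (snd z) - D (fst z)\<bar>" sequentially 0] by simp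
    also have "\<dots> \<longleftrightarrow> L z = 0"
      unfolding L_def using tendsto_0_if_Limsup_eq_0_ennreal lim_imp_Limsup[OF sequentially_bot] by blast
    finally show ?thesis .
  qed
  have "{z \<in> space (M1 \<Otimes>\<^sub>M M2). (\<lambda>n. v n (fst z) (snd z)) \<longlonglongrightarrow> D (fst z)} \<in> sets (M1 \<Otimes>\<^sub>M M2)"
    unfolding iff by measurable
  from AE_commute[OF this] show ?thesis using lim by simp
qed

locale sample_with_tails = rearranged_sample N P Xs Ys \<pi> + cond: conditional_tails P h
  for N :: "'b measure" and P :: "(real \<times> real) measure" and Xs Ys :: "nat \<Rightarrow> 'b \<Rightarrow> real"
    and \<pi> :: "nat \<Rightarrow> 'b \<Rightarrow> nat \<Rightarrow> nat" and h :: "real \<Rightarrow> real \<Rightarrow> real"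
begin

lemma measurable_Ys: "i \<ge> 1 \<Longrightarrow> Ys i \<in> borel_measurable N"
  using measurable_compose[OF measurable_Z measurable_snd, of i] by simp

lemma measurable_rearranged_Ys:
  assumes "n \<ge> 2" "i \<in> {1..n}"
  shows "(\<lambda>\<omega>. Ys (\<pi> n \<omega> i) \<omega>) \<in> borel_measurable N"
proof (rule measurable_rearranged[OF \<open>n \<ge> 2\<close>])
  fix \<sigma> assume "\<sigma> permutes {1..n}"
  then show "Ys (\<sigma> i) \<in> borel_measurable N"
    using permutes_in_image[of \<sigma> "{1..n}" i] assms(2) by (intro measurable_Ys) simp
qed

lemma variation_le: "(\<And>z. 0 \<le> f z \<and> f z \<le> 1) \<Longrightarrow> variation n f \<omega> \<le> n"
proof -
  assume f: "\<And>z. 0 \<le> f z \<and> f z \<le> 1"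
  have "\<bar>f z - f z'\<bar> \<le> 1" for z z' using f[of z] f[of z'] by auto
  then have "variation n f \<omega> \<le> (\<Sum>i=1..<n. 1)" unfolding variation_def by (intro sum_mono)
  then show ?thesis by simp
qed

lemma variation_diff_le:
  assumes "\<And>z. \<bar>f z - g z\<bar> \<le> e" "0 \<le> e"
  shows "\<bar>variation n f \<omega> - variation n g \<omega>\<bar> \<le> 2 * e * n"
proof -
  have *: "\<bar>\<bar>f z - f z'\<bar> - \<bar>g z - g z'\<bar>\<bar> \<le> 2 * e" for z z'
    using assms(1)[of z] assms(1)[of z'] by linarith
  have "\<bar>variation n f \<omega> - variation n g \<omega>\<bar> \<le> (\<Sum>i=1..<n. 2 * e)"
    unfolding variation_def sum_subtractf[symmetric] by (rule order_trans[OF sum_abs sum_mono]) (rule *)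
  also have "\<dots> \<le> 2 * e * n" using assms(2) by (simp add: mult.commute mult_left_mono of_nat_diff mult_mono)
  finally show ?thesis .
qed

lemma AE_AE_variation_tail:
  "AE \<omega> in N. AE t in cond.\<mu>. (\<lambda>n. variation n (indicator {z. t \<le> snd z}) \<omega> / n) \<longlonglongrightarrow> 2 * (cond.G t - cond.H t)"
proof -
  interpret pair_sigma_finite cond.\<mu> N by standard
  show ?thesis
  proof (rule AE_tendsto_commute)
    show "(\<lambda>t. 2 * (cond.G t - cond.H t)) \<in> borel_measurable cond.\<mu>"
      unfolding cond.borel_measurable_\<mu> by measurable
    show "AE \<omega> in N. (\<lambda>n. variation n (indicator {z. t \<le> snd z}) \<omega> / n) \<longlonglongrightarrow> 2 * (cond.G t - cond.H t)" for t
      using AE_variation_conditional[OF cond.tails[of t]] by (simp add: cond.prob_tail cond.H_def)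
    fix n
    show "(\<lambda>(t, \<omega>). variation n (indicator {z. t \<le> snd z}) \<omega> / n) \<in> borel_measurable (cond.\<mu> \<Otimes>\<^sub>M N)"
    proof (cases "n \<ge> 2")
      case True
      note [measurable_cong] = cond.\<mu>.events_eq_borel
      have meas: "(\<lambda>x. \<bar>(if fst x \<le> Ys (\<pi> n (snd x) (i + 1)) (snd x) then 1 else 0) -
          (if fst x \<le> Ys (\<pi> n (snd x) i) (snd x) then 1 else 0 :: real)\<bar>) \<in> borel_measurable (cond.\<mu> \<Otimes>\<^sub>M N)"
        if "i \<in> {1..<n}" for i
      proof -
        have [measurable]: "(\<lambda>\<omega>. Ys (\<pi> n \<omega> i) \<omega>) \<in> borel_measurable N" "(\<lambda>\<omega>. Ys (\<pi> n \<omega> (i + 1)) \<omega>) \<in> borel_measurable N"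
          using that True by (auto intro!: measurable_rearranged_Ys)
        have [measurable]: "fst \<in> borel_measurable (cond.\<mu> \<Otimes>\<^sub>M N)" by measurable
        show ?thesis by measurable
      qed
      have "(\<lambda>(t, \<omega>). variation n (indicator {z. t \<le> snd z}) \<omega> / n) =
        (\<lambda>x. (\<Sum>i=1..<n. \<bar>(if fst x \<le> Ys (\<pi> n (snd x) (i + 1)) (snd x) then 1 else 0) -
          (if fst x \<le> Ys (\<pi> n (snd x) i) (snd x) then 1 else 0 :: real)\<bar>) / n)"
        by (auto simp: variation_def fun_eq_iff indicator_def intro!: sum.cong)
      then show ?thesis using meas by (simp only:) (intro borel_measurable_divide borel_measurable_sum borel_measurable_const)
    qed (simp add: variation_def)
  qed
qed

lemma variation_cdf_eq_integral:
  "variation n (\<lambda>z. cdf cond.\<mu> (snd z)) \<omega> = (\<integral>t. variation n (indicator {z. t \<le> snd z}) \<omega> \<partial>cond.\<mu>)"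
proof -
  have ind: "indicat_real {z. t \<le> snd z} (x, y) = indicator {..y} t" for t x y :: real
    by (simp add: indicator_def)
  have "integrable cond.\<mu> (\<lambda>t. \<bar>indicat_real {..y'} t - indicator {..y} t\<bar>)" for y y'
    by (rule cond.\<mu>.integrable_const_bound[where B = 1]) (auto simp: indicator_def cond.borel_measurable_\<mu>)
  then show ?thesis
    unfolding variation_def ind snd_conv
    by (subst Bochner_Integration.integral_sum) (simp_all add: cond.\<mu>.abs_cdf_diff_eq_integral)
qed

text \<open>
  Dominated convergence in the level, for an outcome at which the variations converge at almost every level.
\<close>

lemma AE_variation_cdf:
  "AE \<omega> in N. (\<lambda>n. variation n (\<lambda>z. cdf cond.\<mu> (snd z)) \<omega> / n) \<longlonglongrightarrow> 2 * (cond.denominator - cond.numerator)"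
  using AE_AE_variation_tail
proof eventually_elim
  case (elim \<omega>)
  have "(\<lambda>n. \<integral>t. variation n (indicator {z. t \<le> snd z}) \<omega> / n \<partial>cond.\<mu>) \<longlonglongrightarrow> (\<integral>t. 2 * (cond.G t - cond.H t) \<partial>cond.\<mu>)"
  proof (rule integral_dominated_convergence[where w = "\<lambda>_. 1"])
    show "(\<lambda>t. 2 * (cond.G t - cond.H t)) \<in> borel_measurable cond.\<mu>"
      unfolding cond.borel_measurable_\<mu> by measurable
    show "(\<lambda>t. variation n (indicator {z. t \<le> snd z}) \<omega> / n) \<in> borel_measurable cond.\<mu>" for n
    proof -
      have ind: "indicat_real {z. t \<le> snd z} (x, y) = indicator {..y} t" for t x y :: real
        by (simp add: indicator_def)
      show ?thesis unfolding variation_def ind cond.borel_measurable_\<mu> by measurable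
    qed
    show "AE t in cond.\<mu>. norm (variation n (indicator {z. t \<le> snd z}) \<omega> / n) \<le> 1" for n
    proof (rule AE_I2)
      fix t
      have "variation n (indicator {z. t \<le> snd z}) \<omega> \<le> n" by (rule variation_le) (simp add: indicator_def)
      then show "norm (variation n (indicator {z. t \<le> snd z}) \<omega> / n) \<le> 1"
        by (simp add: variation_nonneg divide_le_eq)
    qed
  qed (use elim in simp_all)
  moreover have "(\<integral>t. 2 * (cond.G t - cond.H t) \<partial>cond.\<mu>) = 2 * (cond.denominator - cond.numerator)"
    unfolding cond.denominator_minus_numerator by (rule integral_mult_right_zero)
  ultimately show ?case by (simp only: variation_cdf_eq_integral integral_divide_zero)
qed

definition ecdf :: "nat \<Rightarrow> 'b \<Rightarrow> real \<Rightarrow> real" where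
  "ecdf n \<omega> t = card {j\<in>{1..n}. Ys j \<omega> \<le> t} / n"

definition etail :: "nat \<Rightarrow> 'b \<Rightarrow> real \<Rightarrow> real" where
  "etail n \<omega> t = card {j\<in>{1..n}. t \<le> Ys j \<omega>} / n"

lemma iid_Ys: "iid_sequence N borel cond.\<mu> Ys"
  using iid_sequence_compose[of snd borel] by (simp add: cond.\<mu>_def)

lemma AE_variation_ecdf:
  "AE \<omega> in N. (\<lambda>n. variation n (\<lambda>z. ecdf n \<omega> (snd z)) \<omega> / n) \<longlonglongrightarrow> 2 * (cond.denominator - cond.numerator)"
  using AE_variation_cdf glivenko_cantelli[OF iid_Ys]
proof eventually_elim
  case (elim \<omega>)
  let ?v = "\<lambda>n. variation n (\<lambda>z. ecdf n \<omega> (snd z)) \<omega> / n" and ?w = "\<lambda>n. variation n (\<lambda>z. cdf cond.\<mu> (snd z)) \<omega> / n"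
  have "(\<lambda>n. ?v n - ?w n) \<longlonglongrightarrow> 0"
  proof (rule tendstoI)
    fix e :: real assume "e > 0"
    then have "\<forall>\<^sub>F n in sequentially. \<forall>t\<in>UNIV. dist (ecdf n \<omega> t) (cdf cond.\<mu> t) < e / 3"
      using uniform_limitD[OF elim(2), of "e / 3"] by (simp add: ecdf_def)
    then show "\<forall>\<^sub>F n in sequentially. dist (?v n - ?w n) 0 < e"
      using eventually_gt_at_top[of 0]
    proof eventually_elim
      case (elim n)
      have "\<bar>variation n (\<lambda>z. ecdf n \<omega> (snd z)) \<omega> - variation n (\<lambda>z. cdf cond.\<mu> (snd z)) \<omega>\<bar> \<le> 2 * (e / 3) * n"
        by (rule variation_diff_le) (use elim(1) \<open>e > 0\<close> in \<open>auto simp: dist_real_def intro: less_imp_le\<close>)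
      then have "\<bar>?v n - ?w n\<bar> \<le> 2 * (e / 3)"
        using elim(2) by (simp add: diff_divide_distrib[symmetric] divide_le_eq)
      then show ?case using \<open>e > 0\<close> by (simp only: dist_real_def)
    qed
  qed
  from tendsto_add[OF this elim(1)] show ?case by simp
qed

lemma AE_mean_etail:
  "AE \<omega> in N. (\<lambda>n. (\<Sum>i=1..n. etail n \<omega> (Ys i \<omega>) * (1 - etail n \<omega> (Ys i \<omega>))) / n) \<longlonglongrightarrow> cond.denominator"
proof -
  have "AE \<omega> in N. (\<lambda>n. (\<Sum>i=1..n. cond.G (Ys i \<omega>) * (1 - cond.G (Ys i \<omega>))) / n) \<longlonglongrightarrow> (\<integral>t. cond.G t * (1 - cond.G t) \<partial>cond.\<mu>)"
    by (rule iid_sequence.strong_law_bounded[OF iid_Ys, where C = 1])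
       (simp_all add: abs_mult cond.G_bounds mult_le_one)
  with glivenko_cantelli_upper[OF iid_Ys] show ?thesis
  proof eventually_elim
    case (elim \<omega>)
    let ?v = "\<lambda>n. (\<Sum>i=1..n. etail n \<omega> (Ys i \<omega>) * (1 - etail n \<omega> (Ys i \<omega>)))"
    let ?w = "\<lambda>n. (\<Sum>i=1..n. cond.G (Ys i \<omega>) * (1 - cond.G (Ys i \<omega>)))"
    have "(\<lambda>n. ?v n / n - ?w n / n) \<longlonglongrightarrow> 0"
    proof (rule tendstoI)
      fix e :: real assume "e > 0"
      then have "\<forall>\<^sub>F n in sequentially. \<forall>t\<in>UNIV. dist (etail n \<omega> t) (cond.G t) < e / 2"
        using uniform_limitD[OF elim(1), of "e / 2"] by (simp add: etail_def cond.G_def)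
      then show "\<forall>\<^sub>F n in sequentially. dist (?v n / n - ?w n / n) 0 < e"
        using eventually_gt_at_top[of 0]
      proof eventually_elim
        case (elim n)
        have pw: "\<bar>etail n \<omega> t * (1 - etail n \<omega> t) - cond.G t * (1 - cond.G t)\<bar> \<le> e / 2" for t
        proof -
          have "card {j \<in> {1..n}. t \<le> Ys j \<omega>} \<le> card {1..n}" by (rule card_mono) auto
          then have "0 \<le> etail n \<omega> t" "etail n \<omega> t \<le> 1"
            using elim(2) by (simp_all add: etail_def)
          then have "\<bar>1 - etail n \<omega> t - cond.G t\<bar> \<le> 1" using cond.G_bounds[of t] by linarith
          then have "\<bar>etail n \<omega> t - cond.G t\<bar> * \<bar>1 - etail n \<omega> t - cond.G t\<bar> \<le> \<bar>etail n \<omega> t - cond.G t\<bar> * 1"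
            by (intro mult_left_mono) auto
          moreover have "\<bar>etail n \<omega> t - cond.G t\<bar> \<le> e / 2" using elim(1) by (auto simp: dist_real_def intro: less_imp_le)
          ultimately show ?thesis by (simp add: abs_mult[symmetric] algebra_simps)
        qed
        have "\<bar>?v n - ?w n\<bar> \<le> (\<Sum>i=1..n. e / 2)"
          unfolding sum_subtractf[symmetric] by (rule order_trans[OF sum_abs sum_mono]) (rule pw)
        then have "\<bar>?v n / n - ?w n / n\<bar> \<le> e / 2"
          using elim(2) by (simp add: diff_divide_distrib[symmetric] divide_le_eq mult.commute)
        then show ?case using \<open>e > 0\<close> by (simp only: dist_real_def)
      qed
    qed
    from tendsto_add[OF this elim(2)] show ?case by (simp add: cond.denominator_def)
  qed
qed

text \<open>
  A rearrangement does not change the number of data values below a given one, so the ranks are empirical distribution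
  functions at the rearranged values. Numerator and denominator of the coefficient are both of order \<open>n\<^sup>3\<close>.
\<close>

lemma xi_n_eq:
  assumes n: "n \<ge> 2" and \<omega>: "\<omega> \<in> space N"
    and W: "(\<Sum>i=1..n. etail n \<omega> (Ys i \<omega>) * (1 - etail n \<omega> (Ys i \<omega>))) \<noteq> 0"
  shows "xi_n n (\<lambda>i. Ys i \<omega>) (\<pi> n \<omega>) c =
    1 - (variation n (\<lambda>z. ecdf n \<omega> (snd z)) \<omega> / n) /
        (2 * ((\<Sum>i=1..n. etail n \<omega> (Ys i \<omega>) * (1 - etail n \<omega> (Ys i \<omega>))) / n))"
proof -
  let ?y = "\<lambda>i. Ys (\<pi> n \<omega> i) \<omega>"
  let ?W = "\<Sum>i=1..n. etail n \<omega> (Ys i \<omega>) * (1 - etail n \<omega> (Ys i \<omega>))"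
  have card: "card {j\<in>{1..n}. Q (\<pi> n \<omega> j)} = card {j\<in>{1..n}. Q j}" for Q
  proof (rule bij_betw_same_card)
    note \<pi> = \<pi>_permutes[OF n \<omega>]
    show "bij_betw (\<pi> n \<omega>) {j\<in>{1..n}. Q (\<pi> n \<omega> j)} {j\<in>{1..n}. Q j}"
      by (rule bij_betw_Collect[OF permutes_imp_bij[OF \<pi>]]) simp
  qed
  have r: "real (rank_le n ?y i) = n * ecdf n \<omega> (?y i)" for i
    using n card[of "\<lambda>j. Ys j \<omega> \<le> ?y i"] by (simp add: rank_le_def ecdf_def)
  have l: "real (rank_ge n ?y i) = n * etail n \<omega> (?y i)" for i
    using n card[of "\<lambda>j. ?y i \<le> Ys j \<omega>"] by (simp add: rank_ge_def etail_def)
  have "{1..n - 1} = {1..<n}" using n by auto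
  then have num: "(\<Sum>i=1..n - 1. \<bar>real (rank_le n ?y (i + 1)) - real (rank_le n ?y i)\<bar>) = n * variation n (\<lambda>z. ecdf n \<omega> (snd z)) \<omega>"
    unfolding r variation_def by (simp add: right_diff_distrib[symmetric] abs_mult sum_distrib_left)
  have den: "(\<Sum>i=1..n. real (rank_ge n ?y i) * (real n - real (rank_ge n ?y i))) = n\<^sup>2 * ?W"
  proof -
    have "(\<Sum>i=1..n. real (rank_ge n ?y i) * (real n - real (rank_ge n ?y i))) =
        (\<Sum>i=1..n. (\<lambda>j. n\<^sup>2 * (etail n \<omega> (Ys j \<omega>) * (1 - etail n \<omega> (Ys j \<omega>)))) (\<pi> n \<omega> i))"
      unfolding l by (intro sum.cong) (auto simp: power2_eq_square algebra_simps)
    also have "\<dots> = (\<Sum>i=1..n. n\<^sup>2 * (etail n \<omega> (Ys i \<omega>) * (1 - etail n \<omega> (Ys i \<omega>))))"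
      by (rule sum_rearranged[OF n \<omega>])
    finally show ?thesis by (simp add: sum_distrib_left)
  qed
  show ?thesis
    using n W unfolding xi_n_def Let_def num den by (simp add: power2_eq_square)
qed

lemma AE_xi_n_tendsto:
  assumes "\<not> (\<exists>s. AE t in cond.\<mu>. t = s)"
  shows "AE \<omega> in N. (\<lambda>n. xi_n n (\<lambda>i. Ys i \<omega>) (\<pi> n \<omega>) (c n \<omega>)) \<longlonglongrightarrow> cond.numerator / cond.denominator"
  using AE_variation_ecdf AE_mean_etail AE_space
proof eventually_elim
  case (elim \<omega>)
  have pos: "0 < cond.denominator" by (rule cond.denominator_pos[OF assms])
  let ?V = "\<lambda>n. variation n (\<lambda>z. ecdf n \<omega> (snd z)) \<omega> / n"
  let ?W = "\<lambda>n. (\<Sum>i=1..n. etail n \<omega> (Ys i \<omega>) * (1 - etail n \<omega> (Ys i \<omega>))) / n"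
  have "(\<lambda>n. 1 - ?V n / (2 * ?W n)) \<longlonglongrightarrow> 1 - (2 * (cond.denominator - cond.numerator)) / (2 * cond.denominator)"
    by (intro tendsto_intros elim) (use pos in simp)
  also have "1 - (2 * (cond.denominator - cond.numerator)) / (2 * cond.denominator) = cond.numerator / cond.denominator"
    using pos by (simp add: field_simps)
  finally have lim: "(\<lambda>n. 1 - ?V n / (2 * ?W n)) \<longlonglongrightarrow> cond.numerator / cond.denominator" .
  have "\<forall>\<^sub>F n in sequentially. 0 < ?W n" by (rule order_tendstoD(1)[OF elim(2) pos])
  then have "\<forall>\<^sub>F n in sequentially. 1 - ?V n / (2 * ?W n) = xi_n n (\<lambda>i. Ys i \<omega>) (\<pi> n \<omega>) (c n \<omega>)"
    using eventually_ge_at_top[of 2]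
  proof eventually_elim
    case (elim n)
    then have "(\<Sum>i=1..n. etail n \<omega> (Ys i \<omega>) * (1 - etail n \<omega> (Ys i \<omega>))) \<noteq> 0" by auto
    from xi_n_eq[OF elim(2) \<open>\<omega> \<in> space N\<close> this] show ?case by simp
  qed
  with lim show ?case by (rule Lim_transform_eventually)
qed

end

section \<open>Transfer to a pair of random variables\<close>

text \<open>
  The conditional expectation factorizes through \<open>X\<close>, and the factor is clipped to the unit interval, which
  changes it only on a null set.
\<close>

lemma (in prob_space) ex_conditional_probability_given:
  fixes X Y :: "'a \<Rightarrow> real"
  assumes X [measurable]: "X \<in> borel_measurable M" and Y [measurable]: "Y \<in> borel_measurable M"
  defines "E \<equiv> \<lambda>t. real_cond_exp M (vimage_algebra (space M) X borel) (indicator {\<omega> \<in> space M. Y \<omega> \<ge> t})"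
  shows "\<exists>h. conditional_probability (distr M (borel \<Otimes>\<^sub>M borel) (\<lambda>\<omega>. (X \<omega>, Y \<omega>))) {z. t \<le> snd z} h \<and>
    (AE \<omega> in M. E t \<omega> = h (X \<omega>))"
proof -
  let ?F = "vimage_algebra (space M) X borel"
  let ?P = "distr M (borel \<Otimes>\<^sub>M borel) (\<lambda>\<omega>. (X \<omega>, Y \<omega>))"
  let ?ind = "indicat_real {\<omega> \<in> space M. Y \<omega> \<ge> t}"
  interpret F: finite_measure_subalgebra M ?F
    by standard (simp add: subalgebra_def sets_image_in_sets[OF refl X])
  have int: "integrable M ?ind" by (simp add: emeasure_eq_measure)
  have "E t \<in> borel_measurable ?F" unfolding E_def by simp
  then have "\<exists>g\<in>borel_measurable borel. \<forall>\<omega>\<in>space M. E t \<omega> = g (X \<omega>)"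
    by (rule borel_measurable_vimage_algebra_factor) simp
  then obtain g where g [measurable]: "g \<in> borel_measurable borel" and Eg: "\<forall>\<omega>\<in>space M. E t \<omega> = g (X \<omega>)"
    by (rule bexE)
  define h where "h x = max 0 (min 1 (g x))" for x
  have [measurable]: "h \<in> borel_measurable borel" unfolding h_def by measurable
  have "AE \<omega> in M. 0 \<le> E t \<omega>"
    unfolding E_def by (rule F.real_cond_exp_ge_c[OF int]) simp
  moreover have "AE \<omega> in M. E t \<omega> \<le> 1"
    unfolding E_def by (rule F.real_cond_exp_le_c[OF int]) (simp add: indicator_def)
  ultimately have Eh: "AE \<omega> in M. E t \<omega> = h (X \<omega>)"
    using AE_space
  proof eventually_elim
    case (elim \<omega>)
    then show ?case using bspec[OF Eg elim(3)] by (simp add: h_def)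
  qed
  interpret P: prob_space ?P by (rule prob_space_distr) simp
  have "conditional_probability ?P {z. t \<le> snd z} h"
  proof
    fix C :: "real set" assume C [measurable]: "C \<in> sets borel"
    have XC: "X -` C \<inter> space M \<in> sets ?F" by (rule in_vimage_algebra[OF C])
    have [measurable]: "X -` C \<inter> space M \<in> sets M" by measurable
    have S: "{z :: real \<times> real. t \<le> snd z} \<inter> fst -` C \<in> sets (borel \<Otimes>\<^sub>M borel)"
    proof -
      have "{z \<in> space (borel \<Otimes>\<^sub>M borel). t \<le> snd z \<and> fst z \<in> C} \<in> sets (borel \<Otimes>\<^sub>M (borel :: real measure))" by measurable
      moreover have "{z \<in> space (borel \<Otimes>\<^sub>M borel). t \<le> snd z \<and> fst z \<in> C} = {z :: real \<times> real. t \<le> snd z} \<inter> fst -` C"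
        by (auto simp: space_pair_measure)
      ultimately show ?thesis by simp
    qed
    have "P.prob ({z. t \<le> snd z} \<inter> fst -` C) = prob ({\<omega> \<in> space M. Y \<omega> \<ge> t} \<inter> (X -` C \<inter> space M))"
    proof -
      have "(\<lambda>\<omega>. (X \<omega>, Y \<omega>)) -` ({z. t \<le> snd z} \<inter> fst -` C) \<inter> space M =
          {\<omega> \<in> space M. Y \<omega> \<ge> t} \<inter> (X -` C \<inter> space M)" by auto
      then show ?thesis using measure_distr[OF _ S, of "\<lambda>\<omega>. (X \<omega>, Y \<omega>)" M] by simp
    qed
    also have "\<dots> = (\<integral>\<omega>\<in>X -` C \<inter> space M. ?ind \<omega> \<partial>M)"
      by (simp add: set_lebesgue_integral_def flip: indicator_inter_arith) (simp add: Int_commute)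
    also have "\<dots> = (\<integral>\<omega>\<in>X -` C \<inter> space M. E t \<omega> \<partial>M)"
      unfolding E_def by (rule F.real_cond_exp_intA[OF int XC])
    also have "\<dots> = (\<integral>\<omega>. indicator C (X \<omega>) * h (X \<omega>) \<partial>M)"
      unfolding set_lebesgue_integral_def
    proof (rule integral_cong_AE)
      show "(\<lambda>\<omega>. indicat_real (X -` C \<inter> space M) \<omega> *\<^sub>R E t \<omega>) \<in> borel_measurable M"
        unfolding E_def by measurable
      show "AE \<omega> in M. indicat_real (X -` C \<inter> space M) \<omega> *\<^sub>R E t \<omega> = indicator C (X \<omega>) * h (X \<omega>)"
        using Eh AE_space by eventually_elim (auto simp: indicator_def)
    qed measurable
    also have "\<dots> = (\<integral>z. indicator C (fst z) * h (fst z) \<partial>?P)"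
      by (subst integral_distr) auto
    finally show "P.prob ({z. t \<le> snd z} \<inter> fst -` C) = (\<integral>z. indicator C (fst z) * h (fst z) \<partial>?P)" .
  next
    have "{z \<in> space (borel \<Otimes>\<^sub>M borel). t \<le> snd z} \<in> sets ((borel :: real measure) \<Otimes>\<^sub>M (borel :: real measure))" by measurable
    then show "{z. t \<le> snd z} \<in> sets ((borel :: real measure) \<Otimes>\<^sub>M (borel :: real measure))"
      by (simp add: space_pair_measure)
  qed (auto simp: h_def)
  with Eh show ?thesis by blast
qed

text \<open>The half-lines \<open>{t..}\<close> form a generator of the Borel sets that is stable under intersection.\<close>

lemma (in prob_space) indep_var_iff_tails:
  fixes X Y :: "'a \<Rightarrow> real"
  assumes X [measurable]: "X \<in> borel_measurable M" and Y [measurable]: "Y \<in> borel_measurable M"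
  shows "indep_var borel X borel Y \<longleftrightarrow> (\<forall>C\<in>sets borel. \<forall>t.
    prob ({\<omega> \<in> space M. t \<le> Y \<omega>} \<inter> (X -` C \<inter> space M)) = prob (X -` C \<inter> space M) * prob {\<omega> \<in> space M. t \<le> Y \<omega>})"
    (is "_ \<longleftrightarrow> ?tails")
proof
  assume ind: "indep_var borel X borel Y"
  show ?tails
  proof (intro ballI allI)
    fix C :: "real set" and t :: real assume C: "C \<in> sets borel"
    have "prob ((\<lambda>\<omega>. (X \<omega>, Y \<omega>)) -` (C \<times> {t..}) \<inter> space M) = prob (X -` C \<inter> space M) * prob (Y -` {t..} \<inter> space M)"
      by (rule indep_varD[OF ind C]) simp
    moreover have "(\<lambda>\<omega>. (X \<omega>, Y \<omega>)) -` (C \<times> {t..}) \<inter> space M = {\<omega> \<in> space M. t \<le> Y \<omega>} \<inter> (X -` C \<inter> space M)"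
      "Y -` {t..} \<inter> space M = {\<omega> \<in> space M. t \<le> Y \<omega>}" by auto
    ultimately show "prob ({\<omega> \<in> space M. t \<le> Y \<omega>} \<inter> (X -` C \<inter> space M)) = prob (X -` C \<inter> space M) * prob {\<omega> \<in> space M. t \<le> Y \<omega>}"
      by simp
  qed
next
  assume tails: ?tails
  define B where "B = {Y -` A \<inter> space M |A. A \<in> range atLeast}"
  have "indep_set {X -` A \<inter> space M |A. A \<in> sets borel} B"
  proof (rule indep_setI)
    show "{X -` A \<inter> space M |A. A \<in> sets borel} \<subseteq> events" "B \<subseteq> events"
      using measurable_sets[OF X] measurable_sets[OF Y] by (auto simp: B_def)
    fix a b assume "a \<in> {X -` A \<inter> space M |A. A \<in> sets borel}" "b \<in> B"
    then obtain C t where C: "C \<in> sets borel" "a = X -` C \<inter> space M" and b: "b = Y -` {t..} \<inter> space M"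
      by (auto simp: B_def)
    have b': "b = {\<omega> \<in> space M. t \<le> Y \<omega>}" using b by auto
    show "prob (a \<inter> b) = prob a * prob b"
      using tails C(1) unfolding C(2) b' by (simp add: Int_commute)
  qed
  then have "indep_set (sigma_sets (space M) {X -` A \<inter> space M |A. A \<in> sets borel}) (sigma_sets (space M) B)"
  proof (rule indep_set_sigma_sets)
    show "Int_stable {X -` A \<inter> space M |A. A \<in> sets borel}"
    proof (rule Int_stableI)
      fix a b assume "a \<in> {X -` A \<inter> space M |A. A \<in> sets borel}" "b \<in> {X -` A \<inter> space M |A. A \<in> sets borel}"
      then obtain C D where "C \<in> sets borel" "D \<in> sets borel" "a \<inter> b = X -` (C \<inter> D) \<inter> space M" by auto
      then show "a \<inter> b \<in> {X -` A \<inter> space M |A. A \<in> sets borel}" by blast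
    qed
    show "Int_stable B"
    proof (rule Int_stableI)
      fix a b assume "a \<in> B" "b \<in> B"
      then obtain s t where "a = Y -` {s..} \<inter> space M" "b = Y -` {t..} \<inter> space M" by (auto simp: B_def)
      then have "a \<inter> b = Y -` {max s t..} \<inter> space M" by auto
      then show "a \<inter> b \<in> B" unfolding B_def by blast
    qed
  qed
  moreover have "sigma_sets (space M) B = sigma_sets (space M) {Y -` A \<inter> space M |A. A \<in> sets borel}"
  proof -
    have "sets (borel :: real measure) = sigma_sets UNIV (range atLeast)"
      by (subst borel_Ici) (simp add: sets_measure_of)
    then have "{Y -` A \<inter> space M |A. A \<in> sets borel} = sigma_sets (space M) B"
      using sigma_sets_vimage_commute[of Y "space M" UNIV "range atLeast"] by (simp add: B_def)
    moreover have "B \<subseteq> Pow (space M)" by (auto simp: B_def)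
    ultimately show ?thesis by (simp add: sigma_sets_sigma_sets_eq)
  qed
  ultimately show "indep_var borel X borel Y" by (simp add: indep_var_eq X Y)
qed

theorem theorem1p1:
  fixes M :: "'a measure" and X Y :: "'a \<Rightarrow> real"
    and N :: "'b measure" and Xs Ys :: "nat \<Rightarrow> 'b \<Rightarrow> real"
    and \<pi> :: "nat \<Rightarrow> 'b \<Rightarrow> nat \<Rightarrow> nat" and c :: "nat \<Rightarrow> 'b \<Rightarrow> real"
  assumes "prob_space M"
    and "X \<in> borel_measurable M" and "Y \<in> borel_measurable M"
    and "prob_space N"
    and "prob_space.indep_vars N (\<lambda>_. borel \<Otimes>\<^sub>M borel) (\<lambda>i \<omega>. (Xs i \<omega>, Ys i \<omega>)) {1..}"
    and "\<And>i. i \<ge> 1 \<Longrightarrow> distr N (borel \<Otimes>\<^sub>M borel) (\<lambda>\<omega>. (Xs i \<omega>, Ys i \<omega>))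
                     = distr M (borel \<Otimes>\<^sub>M borel) (\<lambda>\<omega>. (X \<omega>, Y \<omega>))"
    and "\<And>n. n \<ge> 2 \<Longrightarrow> uniform_increasing_rearrangement N Xs Ys n (\<pi> n)"
    and "\<not> (\<exists>y. AE \<omega> in M. Y \<omega> = y)"
  shows "(AE \<omega> in N. (\<lambda>n. xi_n n (\<lambda>i. Ys i \<omega>) (\<pi> n \<omega>) (c n \<omega>)) \<longlonglongrightarrow> xi_limit M X Y)
    \<and> xi_limit M X Y \<in> {0..1}
    \<and> (xi_limit M X Y = 0 \<longleftrightarrow> prob_space.indep_var M borel X borel Y)
    \<and> (xi_limit M X Y = 1 \<longleftrightarrow> (\<exists>f \<in> borel_measurable borel. AE \<omega> in M. Y \<omega> = f (X \<omega>)))"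
proof -
  interpret M: prob_space M by fact
  note X [measurable] = assms(2) and Y [measurable] = assms(3)
  define P where "P = distr M (borel \<Otimes>\<^sub>M borel) (\<lambda>\<omega>. (X \<omega>, Y \<omega>))"
  define E where "E t = real_cond_exp M (vimage_algebra (space M) X borel) (indicator {\<omega> \<in> space M. Y \<omega> \<ge> t})" for t
  have XY [measurable]: "(\<lambda>\<omega>. (X \<omega>, Y \<omega>)) \<in> M \<rightarrow>\<^sub>M borel \<Otimes>\<^sub>M borel" by measurable
  have "\<forall>t. \<exists>h. conditional_probability P {z. t \<le> snd z} h \<and> (AE \<omega> in M. E t \<omega> = h (X \<omega>))"
    unfolding P_def E_def by (intro allI M.ex_conditional_probability_given X Y)
  then obtain h where h: "\<And>t. conditional_probability P {z. t \<le> snd z} (h t)"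
    and Eh: "\<And>t. AE \<omega> in M. E t \<omega> = h t (X \<omega>)" by metis
  interpret cond: conditional_tails P h
  proof -
    have "prob_space P" unfolding P_def by (rule M.prob_space_distr) simp
    then show "conditional_tails P h"
      unfolding conditional_tails_def conditional_tails_axioms_def using h by blast
  qed
  interpret S: sample_with_tails N P Xs Ys \<pi> h
  proof -
    interpret N: prob_space N by fact
    show "sample_with_tails N P Xs Ys \<pi> h"
      by unfold_locales (use assms P_def in auto)
  qed
  have \<mu>_eq: "cond.\<mu> = distr M borel Y"
    unfolding cond.\<mu>_def unfolding P_def by (subst distr_distr) (auto simp: comp_def)
  have prob_P: "measure P S = M.prob {\<omega> \<in> space M. (X \<omega>, Y \<omega>) \<in> S}" if "S \<in> sets (borel \<Otimes>\<^sub>M borel)" for S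
    unfolding P_def using that by (subst measure_distr) (auto intro!: arg_cong[where f = M.prob])
  have G_eq: "M.prob {\<omega> \<in> space M. t \<le> Y \<omega>} = cond.G t" for t
    using prob_P[OF cond.tail.A_sets, of t] by (simp add: cond.prob_tail)
  have not_const: "\<not> (\<exists>s. AE t in cond.\<mu>. t = s)"
    using assms(8) unfolding \<mu>_eq by (subst AE_distr_iff) auto
  note pos = cond.denominator_pos[OF not_const]
  have var_E: "M.variance (E t) = cond.H t - (cond.G t)\<^sup>2" for t
  proof -
    have [measurable]: "E t \<in> borel_measurable M" unfolding E_def by simp
    have [measurable]: "h t \<in> borel_measurable borel" by simp
    have "M.expectation (E t) = (\<integral>\<omega>. h t (X \<omega>) \<partial>M)"
      by (rule integral_cong_AE) (use Eh in auto)
    also have "\<dots> = (\<integral>z. h t (fst z) \<partial>P)" unfolding P_def by (subst integral_distr) auto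
    finally have mean: "M.expectation (E t) = cond.G t" by (simp add: cond.tail.integral_h cond.prob_tail)
    have "M.variance (E t) = (\<integral>\<omega>. (h t (X \<omega>) - cond.G t)\<^sup>2 \<partial>M)"
      unfolding mean
    proof (rule integral_cong_AE)
      show "AE \<omega> in M. (E t \<omega> - cond.G t)\<^sup>2 = (h t (X \<omega>) - cond.G t)\<^sup>2"
        using Eh[of t] by eventually_elim simp
    qed measurable
    also have "\<dots> = (\<integral>z. (h t (fst z) - cond.G t)\<^sup>2 \<partial>P)" unfolding P_def by (subst integral_distr) auto
    finally show ?thesis using cond.tail.variance_h[of t] by (simp add: cond.prob_tail cond.H_def)
  qed
  have var_ind: "M.variance (indicator {\<omega> \<in> space M. Y \<omega> \<ge> t}) = cond.G t * (1 - cond.G t)" for t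
  proof -
    let ?I = "indicat_real {\<omega> \<in> space M. Y \<omega> \<ge> t}"
    have mean: "M.expectation ?I = cond.G t" by (simp add: G_eq)
    have square: "(\<lambda>\<omega>. (?I \<omega>)\<^sup>2) = ?I" by (auto simp: indicator_def)
    have "M.variance ?I = M.expectation (\<lambda>\<omega>. (?I \<omega>)\<^sup>2) - (M.expectation ?I)\<^sup>2"
    proof (rule M.variance_eq)
      show "integrable M ?I" by (simp add: M.emeasure_eq_measure)
      then show "integrable M (\<lambda>\<omega>. (?I \<omega>)\<^sup>2)" unfolding square .
    qed
    also note square
    finally show ?thesis unfolding mean by (simp add: power2_eq_square algebra_simps)
  qed
  have xi: "xi_limit M X Y = cond.numerator / cond.denominator"
    unfolding xi_limit_def E_def[symmetric] var_E var_ind \<mu>_eq[symmetric] cond.numerator_def cond.denominator_def ..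
  have zero: "xi_limit M X Y = 0 \<longleftrightarrow> M.indep_var borel X borel Y"
  proof -
    have "M.prob ({\<omega> \<in> space M. t \<le> Y \<omega>} \<inter> (X -` C \<inter> space M)) = measure P ({z. t \<le> snd z} \<inter> fst -` C)"
      and "M.prob (X -` C \<inter> space M) = measure P (fst -` C)" if "C \<in> sets borel" for C t
    proof -
      have "fst -` C \<in> sets (borel \<Otimes>\<^sub>M (borel :: real measure))" using cond.sets_fst_vimage[OF that] by (simp add: cond.tail.sets_P)
      then show "M.prob ({\<omega> \<in> space M. t \<le> Y \<omega>} \<inter> (X -` C \<inter> space M)) = measure P ({z. t \<le> snd z} \<inter> fst -` C)"
        "M.prob (X -` C \<inter> space M) = measure P (fst -` C)"
        using cond.tail.A_sets[of t] by (subst prob_P; auto intro!: arg_cong[where f = M.prob])+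
    qed
    then have "M.indep_var borel X borel Y \<longleftrightarrow> cond.numerator = 0"
      unfolding M.indep_var_iff_tails[OF X Y] cond.numerator_eq_0_iff_indep G_eq by simp
    then show ?thesis using pos by (simp add: xi)
  qed
  have one: "xi_limit M X Y = 1 \<longleftrightarrow> (\<exists>f \<in> borel_measurable borel. AE \<omega> in M. Y \<omega> = f (X \<omega>))"
  proof -
    have "(AE z in P. snd z = f (fst z)) \<longleftrightarrow> (AE \<omega> in M. Y \<omega> = f (X \<omega>))"
      if [measurable]: "f \<in> borel_measurable borel" for f
      unfolding P_def by (subst AE_distr_iff) auto
    then have fn: "cond.numerator = cond.denominator \<longleftrightarrow> (\<exists>f \<in> borel_measurable borel. AE \<omega> in M. Y \<omega> = f (X \<omega>))"
      unfolding cond.numerator_eq_denominator_iff_function by simp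
    have "xi_limit M X Y = 1 \<longleftrightarrow> cond.numerator = cond.denominator"
      unfolding xi divide_eq_1_iff using not_sym[OF less_imp_neq[OF pos]] by blast
    from this fn show ?thesis by (rule trans)
  qed
  have range: "xi_limit M X Y \<in> {0..1}"
    unfolding xi atLeastAtMost_iff divide_le_eq_1_pos[OF pos]
    using divide_nonneg_pos[OF cond.numerator_nonneg pos] cond.numerator_le_denominator by (rule conjI)
  have lim: "AE \<omega> in N. (\<lambda>n. xi_n n (\<lambda>i. Ys i \<omega>) (\<pi> n \<omega>) (c n \<omega>)) \<longlonglongrightarrow> xi_limit M X Y"
    unfolding xi by (rule S.AE_xi_n_tendsto[OF not_const, of c])
  show ?thesis by (rule conjI[OF lim conjI[OF range conjI[OF zero one]]])
qed

end
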